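(* Let $\ell>0$, let $r$ be a vocal-tract radius in class $\mathcal{A}$ on $[0,\ell]$, and let $P(k,x)$ be the corresponding pressure. Say that data $X$ "yields" data $Y$ if any two pairs $(\ell,r)$, $(\tilde\ell,\tilde r)$ of this kind having the same $X$ have the same $Y$. Then: (a) The knowledge of $|P(k,\ell)|$ for $k\in\mathbf{R}^+$ yields $|P(k,\ell)|$ for $k\in\mathbf{R}$, the constants $r_0$ and $r_\ell$, the normalized impedance $z(k)$, and the quantity $|G(k)|$ for $k\in\mathbf{R}$. (b) The quantity $P(k,\ell)$ has a simple zero at $k=0$ and is meromorphic in $\mathbf{C}$ with its poles in $\mathbf{C}\setminus\{0\}$ coinciding with the nonzero zeros of $G(k)$ in $\mathbf{C}$. Hence the set $\{k_j^-\}_{j=1}^{N^-}$ of zeros of $G$ in the open fourth quadrant is the set of poles of $P(k,\ell)$ in the open fourth quadrant, and the set $\{k_j^+\}_{j=1}^{N^+}$ of zeros of $G$ in the open first quadrant is the set of poles of $P(k,\ell)$ in the open first quadrant. (c) In addition to the quantities mentioned in (a), the combined knowledge of $|P(k,\ell)|$ for $k\in\mathbf{R}^+$ and of the poles (including multiplicities) of $P(k,\ell)$ in the open fourth quadrant yields $G(k)$ for $k\in\mathbf{C}$, the quantity $E(k)$ for $k\in\mathbf{C}$, and the constant $\ell$. (d) The knowledge of $P(k,\ell)$ for $k\in\mathbf{R}^+$ yields $P(k,\ell)$ for $k\in\mathbf{C}$ and hence also yields $G(k)$ for $k\in\mathbf{C}$, the quantity $E(k)$ for $k\in\mathbf{C}$,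 and the constant $\ell$.
   Context: Class $\mathcal{A}$: $r:[0,\ell]\to\mathbf{R}$ with $r(x)>0$ on $[0,\ell]$, $r'$ continuous on $[0,\ell]$ (and absolutely continuous), $r''$ integrable on $(0,\ell)$. Notation: prime is $d/dx$, $r_0=r(0)$, $r_\ell=r(\ell)$, $r_0'=r'(0)$, $r_\ell'=r'(\ell)$, $\mathbf{R}^+=(0,+\infty)$. The constants $c,\mu>0$ are fixed and known (the same for all $r$). Normalized impedance: $z(k)=1-\dfrac{J_1(2kr_\ell)}{kr_\ell}+i\,\dfrac{\mathbf{H}_1(2kr_\ell)}{kr_\ell}$, $k\in\mathbf{C}$ (value at $k=0$ by removing the singularity), $J_1$ the Bessel function and $\mathbf{H}_1$ the Struve function of order one. Pressure: $P(k,x)$ is the solution of $[r(x)^2P'(k,x)]'+k^2r(x)^2P(k,x)=0$, $x\in(0,\ell)$, with $P'(k,0)=-\dfrac{ikc\mu}{\pi r_0^2}$ and $P'(k,\ell)+\dfrac{ik}{z(k)}P(k,\ell)=0$ (for the $k$ for which this boundary value problem is uniquely solvable), extended meromorphically in $k$. With $q(x)=r''(x)/r(x)$, let $\varphi(k,x)$ be the solution of $-\psi''+q\psi=k^2\psi$ on $(0,\ell)$ with $\varphi(k,0)=1$, $\varphi'(k,0)=r_0'/r_0$, and set $$G(k)=\varphi(k,\ell)\Big[\frac{r_\ell'}{r_\ell}z(k)-ik\Big]-\varphi'(k,\ell)\,z(k),\qquad k\in\mathbf{C}.$$ $\{k_j^+\}_{j=1}^{N^+}$ and $\{k_j^-\}_{j=1}^{N^-}$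 are the zeros of $G$, listed with multiplicity and in order of nondecreasing modulus, in the open first and open fourth quadrant, respectively ($N^-$ finite, $N^+=+\infty$), and $$E(k)=-ik\prod_{\sigma\in\{-,+\}}\ \prod_{j=1}^{N^\sigma}\Big(1-\frac{k}{k_j^\sigma}\Big)e^{k/k_j^\sigma}\Big(1+\frac{k}{(k_j^\sigma)^*}\Big)e^{-k/(k_j^\sigma)^*},$$ where $*$ is complex conjugation. *)

theory Defs
  imports
    "HOL-Complex_Analysis.Complex_Analysis"
    "HOL-Library.Extended_Nat"
    "HOL-Library.FuncSet"
begin

text \<open>Absolute continuity of a function on \<open>[a, b]\<close>. (The constant \<open>absolutely_continuous\<close> of
  HOL-Analysis is a relation between measures.)\<close>

definition abs_continuous_fun_on :: "real \<Rightarrow> real \<Rightarrow> (real \<Rightarrow> 'a::real_normed_vector) \<Rightarrow> bool" where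
  "abs_continuous_fun_on a b f \<longleftrightarrow>
     (\<forall>\<epsilon>>0. \<exists>\<delta>>0. \<forall>(n::nat) u v.
        (\<forall>i<n. a \<le> u i \<and> u i \<le> v i \<and> v i \<le> b) \<longrightarrow>
        disjoint_family_on (\<lambda>i. {u i<..<v i}) {..<n} \<longrightarrow>
        (\<Sum>i<n. v i - u i) < \<delta> \<longrightarrow>
        (\<Sum>i<n. norm (f (v i) - f (u i))) < \<epsilon>)"

text \<open>The prime in \<open>r'\<close>, \<open>P'\<close>, \<open>\<phi>'\<close>: the derivative on \<open>[0, l]\<close>, one-sided at the two endpoints.
  It depends only on the values of the function on \<open>[0, l]\<close>.\<close>

definition tract_deriv :: "real \<Rightarrow> (real \<Rightarrow> 'a::real_normed_vector) \<Rightarrow> real \<Rightarrow> 'a" where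
  "tract_deriv l f x = vector_derivative f (at x within {0..l})"

text \<open>The radius functions; \<open>r''\<close> exists only almost everywhere.\<close>

definition class_A :: "real \<Rightarrow> (real \<Rightarrow> real) \<Rightarrow> bool" where
  "class_A l r \<longleftrightarrow>
     (\<forall>x\<in>{0..l}. 0 < r x) \<and>
     r differentiable_on {0..l} \<and>
     continuous_on {0..l} (tract_deriv l r) \<and>
     abs_continuous_fun_on 0 l (tract_deriv l r) \<and>
     (AE x in lebesgue. x \<in> {0<..<l} \<longrightarrow> tract_deriv l r differentiable (at x)) \<and>
     (\<lambda>x. vector_derivative (tract_deriv l r) (at x)) absolutely_integrable_on {0<..<l}"

definition potential :: "real \<Rightarrow> (real \<Rightarrow> real) \<Rightarrow> real \<Rightarrow> real" where
  "potential l r x = vector_derivative (tract_deriv l r) (at x) / r x"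

text \<open>The Bessel function and the Struve function of order one, by their power series.\<close>

definition bessel_J1 :: "complex \<Rightarrow> complex" where
  "bessel_J1 w = (\<Sum>m. (-1) ^ m / (fact m * fact (m + 1)) * (w / 2) ^ (2 * m + 1))"

definition struve_H1 :: "complex \<Rightarrow> complex" where
  "struve_H1 w =
     (\<Sum>m. (-1) ^ m / (Gamma (of_nat m + 3 / 2) * Gamma (of_nat m + 5 / 2)) * (w / 2) ^ (2 * m + 2))"

text \<open>The argument \<open>a\<close> is the lip radius \<open>r(l)\<close>.\<close>

definition impedance :: "real \<Rightarrow> complex \<Rightarrow> complex" where
  "impedance a = remove_sings (\<lambda>k.
     1 - bessel_J1 (2 * k * of_real a) / (k * of_real a)
       + \<i> * (struve_H1 (2 * k * of_real a) / (k * of_real a)))"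

text \<open>The boundary value problem for the pressure. Solutions are functions on \<open>[0, l]\<close>, so
  their values elsewhere are fixed by extensionality; otherwise they could not be unique.
  The condition at \<open>x = l\<close> divides by the impedance, and the problem is posed only where that
  does not vanish.\<close>

definition pressure_solution ::
  "real \<Rightarrow> real \<Rightarrow> real \<Rightarrow> (real \<Rightarrow> real) \<Rightarrow> complex \<Rightarrow> (real \<Rightarrow> complex) \<Rightarrow> bool" where
  "pressure_solution c mu l r k p \<longleftrightarrow>
     p \<in> extensional {0..l} \<and>
     impedance (r l) k \<noteq> 0 \<and>
     p differentiable_on {0..l} \<and>
     continuous_on {0..l} (tract_deriv l p) \<and>
     (\<forall>x\<in>{0<..<l}. ((\<lambda>x. of_real (r x ^ 2) * tract_deriv l p x) has_vector_derivative
                       - (k ^ 2 * of_real (r x ^ 2) * p x)) (at x)) \<and>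
     tract_deriv l p 0 = - (\<i> * k * of_real c * of_real mu / of_real (pi * r 0 ^ 2)) \<and>
     tract_deriv l p l + \<i> * k / impedance (r l) k * p l = 0"

text \<open>\<open>pressure c mu l r k x\<close> is \<open>P(k, x)\<close>, continued meromorphically in \<open>k\<close>. The value 0 given to
  the inner function where the problem is not uniquely solvable is immaterial at isolated
  points, because \<open>remove_sings\<close> takes limits; at the poles themselves \<open>remove_sings\<close>
  returns 0 by convention.\<close>

definition pressure ::
  "real \<Rightarrow> real \<Rightarrow> real \<Rightarrow> (real \<Rightarrow> real) \<Rightarrow> complex \<Rightarrow> real \<Rightarrow> complex" where
  "pressure c mu l r k x = remove_sings (\<lambda>\<kappa>.
     if \<exists>!p. pressure_solution c mu l r \<kappa> p
     then (THE p. pressure_solution c mu l r \<kappa> p) x else 0) k"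

abbreviation lip_pressure :: "real \<Rightarrow> real \<Rightarrow> real \<Rightarrow> (real \<Rightarrow> real) \<Rightarrow> complex \<Rightarrow> complex" where
  "lip_pressure c mu l r k \<equiv> pressure c mu l r k l"

text \<open>The solution \<open>\<phi>\<close> of \<open>- \<psi>'' + q \<psi> = k\<^sup>2 \<psi>\<close>. The potential \<open>q\<close> is merely integrable, so this is
  the usual Caratheodory notion: \<open>\<psi>'\<close> is absolutely continuous and the equation holds almost
  everywhere.\<close>

definition phi_solution :: "real \<Rightarrow> (real \<Rightarrow> real) \<Rightarrow> complex \<Rightarrow> (real \<Rightarrow> complex) \<Rightarrow> bool" where
  "phi_solution l r k y \<longleftrightarrow>
     y \<in> extensional {0..l} \<and>
     y differentiable_on {0..l} \<and>
     abs_continuous_fun_on 0 l (tract_deriv l y) \<and>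
     (AE x in lebesgue. x \<in> {0<..<l} \<longrightarrow>
        (\<exists>d. (tract_deriv l y has_vector_derivative d) (at x) \<and>
             - d + of_real (potential l r x) * y x = k ^ 2 * y x)) \<and>
     y 0 = 1 \<and>
     tract_deriv l y 0 = of_real (tract_deriv l r 0 / r 0)"

definition phi :: "real \<Rightarrow> (real \<Rightarrow> real) \<Rightarrow> complex \<Rightarrow> real \<Rightarrow> complex" where
  "phi l r k = (THE y. phi_solution l r k y)"

definition G_fun :: "real \<Rightarrow> (real \<Rightarrow> real) \<Rightarrow> complex \<Rightarrow> complex" where
  "G_fun l r k =
     phi l r k l * (of_real (tract_deriv l r l / r l) * impedance (r l) k - \<i> * k)
     - tract_deriv l (phi l r k) l * impedance (r l) k"

definition quadrant1 :: "complex set" where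
  "quadrant1 = {w. 0 < Re w \<and> 0 < Im w}"

definition quadrant4 :: "complex set" where
  "quadrant4 = {w. 0 < Re w \<and> Im w < 0}"

text \<open>\<open>zero_listing f Q N s\<close>: the sequence of the \<open>s j\<close> with \<open>j < N\<close> (\<open>N\<close> possibly infinite, indices
  starting at 0) lists the zeros of \<open>f\<close> in \<open>Q\<close> with multiplicity, by nondecreasing modulus.\<close>

definition zero_listing :: "(complex \<Rightarrow> complex) \<Rightarrow> complex set \<Rightarrow> enat \<Rightarrow> (nat \<Rightarrow> complex) \<Rightarrow> bool" where
  "zero_listing f Q N s \<longleftrightarrow>
     (\<forall>j. enat j < N \<longrightarrow> s j \<in> Q \<and> f (s j) = 0) \<and>
     (\<forall>w\<in>Q. f w = 0 \<longrightarrow> int (card {j. enat j < N \<and> s j = w}) = zorder f w) \<and>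
     (\<forall>i j. i \<le> j \<and> enat j < N \<longrightarrow> norm (s i) \<le> norm (s j))"

text \<open>Such a listing is unique up to the order of zeros of equal modulus; one is chosen.\<close>

definition listed_zeros :: "(complex \<Rightarrow> complex) \<Rightarrow> complex set \<Rightarrow> enat \<times> (nat \<Rightarrow> complex)" where
  "listed_zeros f Q = (SOME (N, s). zero_listing f Q N s)"

definition zero_number :: "(complex \<Rightarrow> complex) \<Rightarrow> complex set \<Rightarrow> enat" where
  "zero_number f Q = fst (listed_zeros f Q)"

definition zero_seq :: "(complex \<Rightarrow> complex) \<Rightarrow> complex set \<Rightarrow> nat \<Rightarrow> complex" where
  "zero_seq f Q = snd (listed_zeros f Q)"

definition E_factor :: "complex \<Rightarrow> complex \<Rightarrow> complex" where
  "E_factor a k = (1 - k / a) * exp (k / a) * (1 + k / cnj a) * exp (- k / cnj a)"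

definition quadrant_product :: "(complex \<Rightarrow> complex) \<Rightarrow> complex set \<Rightarrow> complex \<Rightarrow> complex" where
  "quadrant_product f Q k =
     (\<Prod>j. if enat j < zero_number f Q then E_factor (zero_seq f Q j) k else 1)"

definition E_fun :: "real \<Rightarrow> (real \<Rightarrow> real) \<Rightarrow> complex \<Rightarrow> complex" where
  "E_fun l r k =
     - \<i> * k * (quadrant_product (G_fun l r) quadrant4 k * quadrant_product (G_fun l r) quadrant1 k)"

definition poles_with_mult :: "(complex \<Rightarrow> complex) \<Rightarrow> complex set \<Rightarrow> (complex \<times> int) set" where
  "poles_with_mult f Q = {(w, - zorder f w) | w. w \<in> Q \<and> is_pole f w}"

text \<open>Data and conclusions are functions of the pair \<open>(l, r)\<close>. Knowledge of a function on a
  proper subset of its domain is expressed with \<open>restrict\<close>.\<close>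

definition yields :: "(real \<Rightarrow> (real \<Rightarrow> real) \<Rightarrow> 'x) \<Rightarrow> (real \<Rightarrow> (real \<Rightarrow> real) \<Rightarrow> 'y) \<Rightarrow> bool" where
  "yields X Y \<longleftrightarrow>
     (\<forall>l r l' r'. 0 < l \<and> class_A l r \<and> 0 < l' \<and> class_A l' r' \<longrightarrow>
        X l r = X l' r' \<longrightarrow> Y l r = Y l' r')"

end

theory Submission
  imports Defs
begin

text \<open>
  Writing \<open>P\<close> for a solution and \<open>P\<^sub>0\<close> for \<open>\<phi> / r\<close>, the Wronskian \<open>r\<^sup>2 (P' P\<^sub>0 - P P\<^sub>0')\<close> is constant, which gives
  \<open>P(k, l) = - \<i> k c \<mu> z(k) / (\<pi> r(0) r(l) G(k))\<close>. As \<open>k \<rightarrow> \<infinity>\<close> along the positive axis the modulus tends to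
  \<open>c \<mu> / (\<pi> r(0) r(l))\<close>, and as \<open>k \<rightarrow> 0\<close> it is asymptotic to \<open>8 c \<mu> k / (3 \<pi>\<^sup>2 r(l))\<close>; so the modulus on the
  positive axis determines \<open>r(0)\<close>, \<open>r(l)\<close>, the impedance and \<open>|G|\<close> on the real axis.

  The impedance is \<open>1\<close> minus the Fourier-Laplace transform of a probability density on \<open>[0, 1]\<close>, hence has
  positive real part on the closed lower half-plane without \<open>0\<close>. An energy identity then shows that \<open>G\<close> has no zero
  there, so that \<open>N\<^sup>- = 0\<close> and the knowledge of the poles in the fourth quadrant adds nothing.
  Since moreover \<open>G(k) exp (- \<i> k l) / (- \<i> k) \<rightarrow> 1\<close> at infinity in the closed lower half-plane, the maximum modulus
  principle shows that \<open>|G|\<close> on the real axis determines \<open>G(k) exp (- \<i> k l)\<close>. Finally \<open>l\<close> is read off the growth of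
  \<open>G\<close> on the positive imaginary axis.
\<close>

section \<open>Linear systems with a positive weight\<close>

text \<open>The potential r''/r is merely integrable, so the work is done on the first-order system
  u' = v / r^2, v' = - k^2 r^2 u, whose coefficients are continuous; \<open>phi\<close> is recovered
  as r u / r(0). The almost-everywhere equation enters only in this identification, whose uniqueness
  half rests on the constancy of absolutely continuous functions with derivative zero almost
  everywhere. When moduli on the real axis are compared, the lengths of the two tracts are not yet
  known to agree. Each G is therefore normalised with its own factor exp(- i k l), which has modulus
  1 on the real axis and removes the growth of G in the lower half-plane. The zero at 0, common to
  all tracts, is divided out before quotients are formed. The lower half-plane cannot separate the
  lengths, because both normalised functions tend to 1 there. On the positive imaginary axis the
  growth of G and the factor exp(- i k l) reinforce each other, and the impedance is negative, so
  that the two terms of G cannot cancel; since r(l) is already known, the impedance is the same for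
  both tracts.\<close>

lemma gronwall_right:
  fixes e e' :: "real \<Rightarrow> real"
  assumes ab: "a \<le> b" and cont: "continuous_on {a..b} e"
    and der: "\<And>x. a < x \<Longrightarrow> x < b \<Longrightarrow> (e has_real_derivative e' x) (at x)"
    and le: "\<And>x. a < x \<Longrightarrow> x < b \<Longrightarrow> e' x \<le> C * e x"
  shows "e b \<le> e a * exp (C * (b - a))"
proof -
  have "e a * exp (- C * a) \<ge> e b * exp (- C * b)"
  proof (rule DERIV_nonpos_imp_decreasing_open[OF ab, of "\<lambda>x. e x * exp (- C * x)"])
    fix x assume x: "a < x" "x < b"
    have "((\<lambda>x. e x * exp (- C * x)) has_real_derivative
        (e' x - C * e x) * exp (- C * x)) (at x)"
      by (rule derivative_eq_intros der[OF x] refl)+ (simp add: algebra_simps)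
    moreover have "(e' x - C * e x) * exp (- C * x) \<le> 0"
      using le[OF x] by (simp add: mult_nonpos_nonneg)
    ultimately show "\<exists>y. ((\<lambda>x. e x * exp (- C * x)) has_real_derivative y) (at x) \<and> y \<le> 0"
      by blast
  qed (intro continuous_intros cont)
  then have "e b * exp (- C * b) * exp (C * b) \<le> e a * exp (- C * a) * exp (C * b)"
    by (rule mult_right_mono) simp
  then show ?thesis by (simp add: mult.assoc flip: exp_add) (simp add: algebra_simps)
qed

lemma gronwall_left:
  fixes e e' :: "real \<Rightarrow> real"
  assumes ab: "a \<le> b" and cont: "continuous_on {a..b} e"
    and der: "\<And>x. a < x \<Longrightarrow> x < b \<Longrightarrow> (e has_real_derivative e' x) (at x)"
    and ge: "\<And>x. a < x \<Longrightarrow> x < b \<Longrightarrow> - C * e x \<le> e' x"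
  shows "e a \<le> e b * exp (C * (b - a))"
proof -
  \<comment> \<open>The forward estimate applied to the reflected function
    \<open>\<lambda>x. e (- x)\<close> on [-b, -a].\<close>
  have "e (- (- a)) \<le> e (- (- b)) * exp (C * (- a - - b))"
  proof (rule gronwall_right[where e' = "\<lambda>x. - e' (- x)" and e = "\<lambda>x. e (- x)"])
    show "continuous_on {- b..- a} (\<lambda>x. e (- x))"
      by (rule continuous_on_compose2[OF cont]) (auto intro!: continuous_intros)
    fix x assume x: "- b < x" "x < - a"
    show "((\<lambda>x. e (- x)) has_real_derivative - e' (- x)) (at x)"
      using der[of "- x"] x by (simp flip: DERIV_mirror)
    show "- e' (- x) \<le> C * e (- x)" using ge[of "- x"] x by simp
  qed (use ab in auto)
  then show ?thesis by (simp add: algebra_simps)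
qed

text \<open>The equation (\<rho> u')' + \<kappa> \<rho> u = 0 with the flux v = \<rho> u' as second
  unknown. The pressure equation is the case \<rho> = r^2, \<kappa> = k^2.\<close>

definition sturm_system :: "(real \<Rightarrow> real) \<Rightarrow> real \<Rightarrow> complex \<Rightarrow> (real \<Rightarrow> complex) \<Rightarrow> (real \<Rightarrow> complex) \<Rightarrow> bool" where
  "sturm_system \<rho> l \<kappa> u v \<longleftrightarrow> continuous_on {0..l} u \<and> continuous_on {0..l} v \<and>
     (\<forall>x\<in>{0<..<l}. (u has_vector_derivative v x / of_real (\<rho> x)) (at x) \<and>
                   (v has_vector_derivative - (\<kappa> * of_real (\<rho> x) * u x)) (at x))"

lemma has_real_derivative_norm_power2:
  fixes f :: "real \<Rightarrow> 'a::real_inner"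
  assumes "(f has_vector_derivative f') (at x)"
  shows "((\<lambda>x. (norm (f x))\<^sup>2) has_real_derivative 2 * inner (f x) f') (at x)"
proof -
  have "((\<lambda>x. inner (f x) (f x)) has_derivative (\<lambda>h. inner (f x) (h *\<^sub>R f') + inner (h *\<^sub>R f') (f x))) (at x)"
    using assms[unfolded has_vector_derivative_def] by (intro has_derivative_inner)
  then show ?thesis
    by (simp add: has_field_derivative_def power2_norm_eq_inner inner_commute algebra_simps
          mult_commute_abs)
qed

text \<open>The energy |u|^2 + |v|^2 changes at a rate of at most C times itself, with C a bound for
  1/\<rho> + |\<kappa>| \<rho>, so it vanishes everywhere once it vanishes at one point. The base
  point \<open>x0\<close> is arbitrary because \<open>phi\<close> is fixed by data at 0, whereas two
  pressures are compared at l.\<close>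

lemma sturm_system_unique:
  assumes sys: "sturm_system \<rho> l \<kappa> u v"
    and cont: "continuous_on {0..l} \<rho>" and pos: "\<And>x. x \<in> {0..l} \<Longrightarrow> 0 < \<rho> x"
    and x0: "x0 \<in> {0..l}" "u x0 = 0" "v x0 = 0" and x: "x \<in> {0..l}"
  shows "u x = 0 \<and> v x = 0"
proof -
  define e where "e = (\<lambda>x. (norm (u x))\<^sup>2 + (norm (v x))\<^sup>2)"
  define e' where "e' = (\<lambda>x. 2 * inner (u x) (v x / of_real (\<rho> x)) + 2 * inner (v x) (- (\<kappa> * of_real (\<rho> x) * u x)))"
  have "continuous_on {0..l} (\<lambda>x. \<bar>1 / \<rho> x\<bar> + norm \<kappa> * \<bar>\<rho> x\<bar>)"
    by (intro continuous_intros cont) (use pos in force)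
  then have "bounded ((\<lambda>x. \<bar>1 / \<rho> x\<bar> + norm \<kappa> * \<bar>\<rho> x\<bar>) ` {0..l})"
    by (intro compact_imp_bounded compact_continuous_image) auto
  then obtain C where C: "\<And>x. x \<in> {0..l} \<Longrightarrow> \<bar>1 / \<rho> x\<bar> + norm \<kappa> * \<bar>\<rho> x\<bar> \<le> C"
    unfolding bounded_iff by fastforce
  have cont_e: "continuous_on {0..l} e"
    using sys unfolding e_def sturm_system_def by (intro continuous_intros) auto
  have der: "(e has_real_derivative e' x) (at x)" if "0 < x" "x < l" for x
    unfolding e_def e'_def
    by (intro DERIV_add has_real_derivative_norm_power2)
       (use sys that in \<open>auto simp: sturm_system_def\<close>)
  have bound: "\<bar>e' x\<bar> \<le> C * e x" if "0 < x" "x < l" for x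
  proof -
    have 1: "\<bar>inner (u x) (v x / of_real (\<rho> x))\<bar> \<le> norm (u x) * (norm (v x) * \<bar>1 / \<rho> x\<bar>)"
      using Cauchy_Schwarz_ineq2[of "u x" "v x / of_real (\<rho> x)"] by (simp add: norm_divide)
    have 2: "\<bar>inner (v x) (- (\<kappa> * of_real (\<rho> x) * u x))\<bar> \<le> norm (v x) * (norm \<kappa> * \<bar>\<rho> x\<bar> * norm (u x))"
      using Cauchy_Schwarz_ineq2[of "v x" "- (\<kappa> * of_real (\<rho> x) * u x)"] by (simp add: norm_mult)
    have "\<bar>e' x\<bar> \<le> 2 * (norm (u x) * (norm (v x) * \<bar>1 / \<rho> x\<bar>)) + 2 * (norm (v x) * (norm \<kappa> * \<bar>\<rho> x\<bar> * norm (u x)))"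
      unfolding e'_def using 1 2 by linarith
    also have "\<dots> = 2 * norm (u x) * norm (v x) * (\<bar>1 / \<rho> x\<bar> + norm \<kappa> * \<bar>\<rho> x\<bar>)"
      by (simp add: algebra_simps)
    also have "\<dots> \<le> e x * (\<bar>1 / \<rho> x\<bar> + norm \<kappa> * \<bar>\<rho> x\<bar>)"
      unfolding e_def by (intro mult_right_mono sum_squares_bound) auto
    also have "\<dots> \<le> e x * C"
      by (intro mult_left_mono C) (use that in \<open>auto simp: e_def\<close>)
    finally show ?thesis by (simp add: mult.commute)
  qed
  have e0: "e x0 = 0" using x0 by (simp add: e_def)
  have "e x \<le> 0"
  proof (cases "x0 \<le> x")
    case True
    have "e x \<le> e x0 * exp (C * (x - x0))"
    proof (rule gronwall_right[OF True, where e' = e'])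
      show "continuous_on {x0..x} e"
        by (rule continuous_on_subset[OF cont_e]) (use x0 x in auto)
      fix t assume "x0 < t" "t < x"
      then have t: "0 < t" "t < l" using x0 x by auto
      show "(e has_real_derivative e' t) (at t)" "e' t \<le> C * e t"
        using der[OF t] bound[OF t] by auto
    qed
    then show ?thesis using e0 by simp
  next
    case False
    have "e x \<le> e x0 * exp (C * (x0 - x))"
    proof (rule gronwall_left[where e' = e'])
      show "continuous_on {x..x0} e"
        by (rule continuous_on_subset[OF cont_e]) (use x0 x in auto)
      fix t assume "x < t" "t < x0"
      then have t: "0 < t" "t < l" using x0 x by auto
      show "(e has_real_derivative e' t) (at t)" "- C * e t \<le> e' t"
        using der[OF t] bound[OF t] by auto
    qed (use False in simp)
    then show ?thesis using e0 by simp
  qed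
  then have "(norm (u x))\<^sup>2 + (norm (v x))\<^sup>2 \<le> 0" by (simp add: e_def)
  then have "norm (u x) = 0 \<and> norm (v x) = 0" by (simp add: sum_power2_le_zero_iff)
  then show ?thesis by simp
qed

lemma constant_on_interval:
  fixes f :: "real \<Rightarrow> 'a::real_normed_vector"
  assumes "continuous_on {a..b} f" and "\<And>x. a < x \<Longrightarrow> x < b \<Longrightarrow> (f has_vector_derivative 0) (at x)"
    and "x \<in> {a..b}"
  shows "f x = f a"
proof (cases "a < x")
  case True
  have "norm (f x - f a) \<le> (\<lambda>_. 0) x - (\<lambda>_. 0::real) a"
    by (rule differentiable_bound_general[where f' = "\<lambda>_. 0" and \<phi>' = "\<lambda>_. 0"])
       (use assms True in \<open>auto intro: continuous_on_subset\<close>)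
  then show ?thesis by simp
qed (use assms in auto)

text \<open>In the derivative the products v w / \<rho> and \<kappa> \<rho> u p each occur twice
  with opposite signs.\<close>

lemma sturm_wronskian:
  assumes 1: "sturm_system \<rho> l \<kappa> u v" and 2: "sturm_system \<rho> l \<kappa> p w"
    and pos: "\<And>x. x \<in> {0..l} \<Longrightarrow> 0 < \<rho> x" and x: "x \<in> {0..l}"
  shows "u x * w x - v x * p x = u 0 * w 0 - v 0 * p 0"
proof (rule constant_on_interval[where b = l, OF _ _ x])
  show "continuous_on {0..l} (\<lambda>x. u x * w x - v x * p x)"
    using 1 2 unfolding sturm_system_def by (intro continuous_intros) auto
  fix x assume x: "0 < x" "x < l"
  then have "\<rho> x \<noteq> 0" using pos[of x] by simp
  then show "((\<lambda>x. u x * w x - v x * p x) has_vector_derivative 0) (at x)"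
    using 1 2 x unfolding sturm_system_def
    by (auto intro!: derivative_eq_intros simp: field_simps)
qed

section \<open>Power series solutions\<close>

text \<open>The map h -> h d has operator norm |d|, so uniform convergence of the derivatives is
  exactly the operator estimate that termwise differentiation asks for.\<close>

lemma has_vector_derivative_series:
  fixes f :: "nat \<Rightarrow> real \<Rightarrow> 'a::banach"
  assumes S: "convex S"
    and der: "\<And>n x. x \<in> S \<Longrightarrow> (f n has_vector_derivative d n x) (at x within S)"
    and unif: "uniform_limit S (\<lambda>n x. \<Sum>i<n. d i x) D sequentially"
    and summ: "\<And>x. x \<in> S \<Longrightarrow> summable (\<lambda>n. f n x)" and x: "x \<in> S"
  shows "((\<lambda>x. \<Sum>n. f n x) has_vector_derivative D x) (at x within S)"
proof -
  have "\<exists>g. \<forall>x\<in>S. (\<lambda>n. f n x) sums (g x) \<and> (g has_derivative (\<lambda>h. h *\<^sub>R D x)) (at x within S)"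
  proof (rule has_derivative_series[OF S])
    show "(f n has_derivative (\<lambda>h. h *\<^sub>R d n x)) (at x within S)" if "x \<in> S" for n x
      using der[OF that] by (simp add: has_vector_derivative_def)
    show "\<forall>\<^sub>F n in sequentially. \<forall>x\<in>S. \<forall>h. norm ((\<Sum>i<n. h *\<^sub>R d i x) - h *\<^sub>R D x) \<le> e * norm h"
      if "0 < e" for e
    proof -
      have "\<forall>\<^sub>F n in sequentially. \<forall>x\<in>S. dist (\<Sum>i<n. d i x) (D x) < e"
        using unif that by (simp add: uniform_limit_iff)
      then show ?thesis
      proof eventually_elim
        case (elim n)
        show ?case
        proof (intro ballI allI)
          fix x h assume "x \<in> S"
          have "norm ((\<Sum>i<n. h *\<^sub>R d i x) - h *\<^sub>R D x) = norm h * dist (\<Sum>i<n. d i x) (D x)"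
            by (simp add: dist_norm flip: scaleR_sum_right scaleR_diff_right)
          also have "\<dots> \<le> norm h * e"
            using elim \<open>x \<in> S\<close> by (intro mult_left_mono) (auto intro: less_imp_le)
          finally show "norm ((\<Sum>i<n. h *\<^sub>R d i x) - h *\<^sub>R D x) \<le> e * norm h"
            by (simp add: mult.commute)
        qed
      qed
    qed
    show "x \<in> S" by fact
    show "(\<lambda>n. f n x) sums (\<Sum>n. f n x)" using summ[OF x] by (rule summable_sums)
  qed
  then obtain g where g: "\<And>x. x \<in> S \<Longrightarrow> (\<lambda>n. f n x) sums (g x)"
    "\<And>x. x \<in> S \<Longrightarrow> (g has_derivative (\<lambda>h. h *\<^sub>R D x)) (at x within S)"
    by blast
  have "g y = (\<Sum>n. f n y)" if "y \<in> S" for y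
    using g(1)[OF that] by (simp add: sums_iff)
  then show ?thesis
    unfolding has_vector_derivative_def
    by (intro has_derivative_transform[OF x _ g(2)[OF x]]) simp
qed

text \<open>The Picard iterates for u(0) = 1, v(0) = 0 with signs and powers of \<kappa> taken out:
  even indices build u, odd indices build v. Because the terms are real and independent of \<kappa>,
  u and v become everywhere convergent power series in \<kappa> with real coefficients, which gives
  entireness and conjugation symmetry.\<close>

fun sturm_term :: "(real \<Rightarrow> real) \<Rightarrow> nat \<Rightarrow> real \<Rightarrow> real" where
  "sturm_term \<rho> 0 x = 1"
| "sturm_term \<rho> (Suc n) x =
     integral {0..x} (\<lambda>t. (if even n then \<rho> t else 1 / \<rho> t) * sturm_term \<rho> n t)"

declare sturm_term.simps(2) [simp del]

abbreviation sturm_even :: "(real \<Rightarrow> real) \<Rightarrow> nat \<Rightarrow> real \<Rightarrow> real" where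
  "sturm_even \<rho> n x \<equiv> (-1) ^ n * sturm_term \<rho> (2 * n) x"

abbreviation sturm_odd :: "(real \<Rightarrow> real) \<Rightarrow> nat \<Rightarrow> real \<Rightarrow> real" where
  "sturm_odd \<rho> n x \<equiv> (-1) ^ n * sturm_term \<rho> (2 * n + 1) x"

definition sturm_u :: "(real \<Rightarrow> real) \<Rightarrow> complex \<Rightarrow> real \<Rightarrow> complex" where
  "sturm_u \<rho> \<kappa> x = (\<Sum>n. of_real (sturm_even \<rho> n x) * \<kappa> ^ n)"

definition sturm_v :: "(real \<Rightarrow> real) \<Rightarrow> complex \<Rightarrow> real \<Rightarrow> complex" where
  "sturm_v \<rho> \<kappa> x = - \<kappa> * (\<Sum>n. of_real (sturm_odd \<rho> n x) * \<kappa> ^ n)"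

locale sturm_weight =
  fixes \<rho> :: "real \<Rightarrow> real" and l :: real
  assumes l_pos: "0 < l" and cont_weight: "continuous_on {0..l} \<rho>"
    and weight_pos: "x \<in> {0..l} \<Longrightarrow> 0 < \<rho> x"
begin

lemma weight_bounds: "\<exists>K. \<forall>x\<in>{0..l}. \<rho> x \<le> K \<and> 1 / \<rho> x \<le> K"
proof -
  have "continuous_on {0..l} (\<lambda>x. \<rho> x + 1 / \<rho> x)"
    by (intro continuous_intros cont_weight) (use weight_pos in force)
  then have "bounded ((\<lambda>x. \<rho> x + 1 / \<rho> x) ` {0..l})"
    by (intro compact_imp_bounded compact_continuous_image) auto
  then obtain K where K: "\<And>x. x \<in> {0..l} \<Longrightarrow> norm (\<rho> x + 1 / \<rho> x) \<le> K"
    unfolding bounded_iff by blast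
  have "\<rho> x \<le> K \<and> 1 / \<rho> x \<le> K" if "x \<in> {0..l}" for x
  proof -
    have "0 \<le> 1 / \<rho> x" using weight_pos[OF that] by simp
    moreover have "\<rho> x + 1 / \<rho> x \<le> K" using K[OF that] unfolding real_norm_def by linarith
    ultimately show ?thesis using weight_pos[OF that] by linarith
  qed
  then show ?thesis by blast
qed

definition K :: real where "K = (SOME K. \<forall>x\<in>{0..l}. \<rho> x \<le> K \<and> 1 / \<rho> x \<le> K)"

lemma K: "x \<in> {0..l} \<Longrightarrow> \<rho> x \<le> K \<and> 1 / \<rho> x \<le> K"
  using someI_ex[OF weight_bounds, folded K_def] by (rule bspec)

lemma K0: "0 \<le> K"
  using K[of 0] weight_pos[of 0] l_pos by auto

lemma cont_factor: "continuous_on {0..l} (\<lambda>t. if even n then \<rho> t else 1 / \<rho> t)"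
proof -
  have "continuous_on {0..l} (\<lambda>t. 1 / \<rho> t)"
    by (intro continuous_intros cont_weight) (use weight_pos in force)
  then show ?thesis using cont_weight by (cases "even n") auto
qed

lemma cont_sturm_term: "continuous_on {0..l} (sturm_term \<rho> n)"
proof (induction n)
  case (Suc n)
  have "continuous_on {0..l} (\<lambda>x. integral {0..x} (\<lambda>t. (if even n then \<rho> t else 1 / \<rho> t) * sturm_term \<rho> n t))"
    by (intro indefinite_integral_continuous_1 integrable_continuous_real
          continuous_on_mult cont_factor Suc)
  then show ?case by (simp add: sturm_term.simps)
qed simp

lemma deriv_sturm_term:
  assumes "x \<in> {0..l}"
  shows "(sturm_term \<rho> (Suc n) has_real_derivative
      (if even n then \<rho> x else 1 / \<rho> x) * sturm_term \<rho> n x) (at x within {0..l})"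
proof -
  have eq: "sturm_term \<rho> (Suc n) =
      (\<lambda>x. integral {0..x} (\<lambda>t. (if even n then \<rho> t else 1 / \<rho> t) * sturm_term \<rho> n t))"
    by (rule ext) (simp add: sturm_term.simps)
  show ?thesis
    unfolding eq
    by (rule integral_has_real_derivative[OF continuous_on_mult[OF cont_factor[of n] cont_sturm_term[of n]] assms])
qed

lemma sturm_term_nonneg: "x \<in> {0..l} \<Longrightarrow> 0 \<le> sturm_term \<rho> n x"
proof (induction n arbitrary: x)
  case (Suc n)
  have "0 \<le> integral {0..x} (\<lambda>t. (if even n then \<rho> t else 1 / \<rho> t) * sturm_term \<rho> n t)"
  proof (rule integral_nonneg)
    show "(\<lambda>t. (if even n then \<rho> t else 1 / \<rho> t) * sturm_term \<rho> n t) integrable_on {0..x}"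
      by (intro integrable_continuous_real continuous_on_subset[OF continuous_on_mult[OF cont_factor cont_sturm_term]])
         (use Suc.prems in auto)
    fix t assume "t \<in> {0..x}"
    then have "t \<in> {0..l}" using Suc.prems by auto
    then show "0 \<le> (if even n then \<rho> t else 1 / \<rho> t) * sturm_term \<rho> n t"
      using Suc.IH weight_pos by (simp add: less_imp_le)
  qed
  then show ?case by (simp add: sturm_term.simps)
qed simp

text \<open>Every integration has a kernel between 0 and \<open>K\<close>, so the iterated integral
  is at most K^n times the volume x^n / n! of a simplex. In the induction the difference of the two
  sides vanishes at 0 and has nonnegative derivative.\<close>

lemma sturm_term_le:
  "x \<in> {0..l} \<Longrightarrow> sturm_term \<rho> n x \<le> (K * x) ^ n / fact n"
proof (induction n arbitrary: x)
  case (Suc n)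
  have "(\<lambda>x. K ^ Suc n * x ^ Suc n / fact (Suc n) - sturm_term \<rho> (Suc n) x) x
      \<ge> (\<lambda>x. K ^ Suc n * x ^ Suc n / fact (Suc n) - sturm_term \<rho> (Suc n) x) 0"
  proof (rule DERIV_nonneg_imp_increasing_open[of 0 x "\<lambda>x. K ^ Suc n * x ^ Suc n / fact (Suc n) - sturm_term \<rho> (Suc n) x"])
    show "continuous_on {0..x} (\<lambda>x. K ^ Suc n * x ^ Suc n / fact (Suc n) - sturm_term \<rho> (Suc n) x)"
      using Suc.prems by (intro continuous_intros continuous_on_subset[OF cont_sturm_term]) auto
    fix t assume t: "0 < t" "t < x"
    then have tl: "t \<in> {0..l}" using Suc.prems by auto
    have "at t within {0..l} = at t"
      using t Suc.prems by (intro at_within_interior) auto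
    then have "(sturm_term \<rho> (Suc n) has_real_derivative
      (if even n then \<rho> t else 1 / \<rho> t) * sturm_term \<rho> n t) (at t)"
      using deriv_sturm_term[OF tl, of n] by simp
    moreover have "K ^ Suc n * (real (Suc n) * t ^ (Suc n - Suc 0)) / fact (Suc n) = K * ((K * t) ^ n / fact n)"
      unfolding fact_Suc power_mult_distrib by (simp del: of_nat_Suc)
    then have "((\<lambda>x. K ^ Suc n * x ^ Suc n / fact (Suc n)) has_real_derivative K * ((K * t) ^ n / fact n)) (at t)"
      using DERIV_cdivide[OF DERIV_cmult[OF DERIV_pow[of "Suc n" t]], of "K ^ Suc n" "fact (Suc n)"] by (simp only:)
    ultimately have d: "((\<lambda>x. K ^ Suc n * x ^ Suc n / fact (Suc n) - sturm_term \<rho> (Suc n) x) has_real_derivative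
       K * ((K * t) ^ n / fact n) - (if even n then \<rho> t else 1 / \<rho> t) * sturm_term \<rho> n t) (at t)"
      by (intro DERIV_diff)
    have "(if even n then \<rho> t else 1 / \<rho> t) * sturm_term \<rho> n t \<le> K * ((K * t) ^ n / fact n)"
      using K[OF tl] K0 by (intro mult_mono Suc.IH tl sturm_term_nonneg) auto
    then show "\<exists>y. ((\<lambda>x. K ^ Suc n * x ^ Suc n / fact (Suc n) - sturm_term \<rho> (Suc n) x) has_real_derivative y) (at t) \<and> 0 \<le> y"
      by (intro exI conjI) (rule d, simp)
  qed (use Suc.prems in auto)
  moreover have "sturm_term \<rho> (Suc n) 0 = 0" "K ^ Suc n * 0 ^ Suc n / fact (Suc n) = 0"
    by (simp_all add: sturm_term.simps)
  ultimately show ?case unfolding power_mult_distrib by linarith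
qed simp

definition growth :: real where "growth = (K * l)\<^sup>2"

definition scale :: real where "scale = K * l"

lemma growth_scale: "0 \<le> growth" "0 \<le> scale"
  using K0 l_pos by (simp_all add: growth_def scale_def)

text \<open>One power of \<kappa> costs two integrations, hence the square in \<open>growth\<close>;
  \<open>scale\<close> pays for the extra integration in v. Weakening (2n)! and (2n+1)! to n! turns
  the majorant into an exponential series in |\<kappa>|.\<close>

lemma sturm_term_le_fact:
  assumes x: "x \<in> {0..l}"
  shows "sturm_term \<rho> (2 * n) x \<le> growth ^ n / fact n"
    and "sturm_term \<rho> (2 * n + 1) x \<le> scale * (growth ^ n / fact n)"
proof -
  have le: "sturm_term \<rho> n x \<le> (K * l) ^ n / fact m" if "m \<le> n" for n m
  proof -
    have "sturm_term \<rho> n x \<le> (K * x) ^ n / fact n" by (rule sturm_term_le[OF x])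
    also have "\<dots> \<le> (K * l) ^ n / fact m"
      using x that K0 by (intro frac_le power_mono mult_left_mono fact_mono) auto
    finally show ?thesis .
  qed
  show "sturm_term \<rho> (2 * n) x \<le> growth ^ n / fact n"
    using le[of n "2 * n"] by (simp add: power_mult growth_def)
  show "sturm_term \<rho> (2 * n + 1) x \<le> scale * (growth ^ n / fact n)"
    using le[of n "2 * n + 1"] by (simp add: power_mult growth_def scale_def)
qed

lemma summable_bound: "summable (\<lambda>n. B ^ n / fact n * (b::real) ^ n)"
  using summable_exp[of "B * b"] by (simp add: field_simps power_mult_distrib)

lemma summable_sturm_even:
  "x \<in> {0..l} \<Longrightarrow> summable (\<lambda>n. of_real (sturm_even \<rho> n x) * (\<kappa>::complex) ^ n)"
proof -
  assume x: "x \<in> {0..l}"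
  have "norm (of_real (sturm_even \<rho> n x) * \<kappa> ^ n)
      \<le> growth ^ n / fact n * norm \<kappa> ^ n" for n
    using mult_right_mono[OF sturm_term_le_fact(1)[OF x, of n], of "norm \<kappa> ^ n"] sturm_term_nonneg[OF x, of "2 * n"]
    by (simp add: norm_mult norm_power)
  then show ?thesis
    by (intro summable_comparison_test[OF _ summable_bound[of growth "norm \<kappa>"]]) auto
qed

lemma summable_sturm_odd:
  "x \<in> {0..l} \<Longrightarrow> summable (\<lambda>n. of_real (sturm_odd \<rho> n x) * (\<kappa>::complex) ^ n)"
proof -
  assume x: "x \<in> {0..l}"
  have "norm (of_real (sturm_odd \<rho> n x) * \<kappa> ^ n)
      \<le> scale * (growth ^ n / fact n * norm \<kappa> ^ n)" for n
    using mult_right_mono[OF sturm_term_le_fact(2)[OF x, of n], of "norm \<kappa> ^ n"] sturm_term_nonneg[OF x, of "2 * n + 1"]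
    by (simp add: norm_mult norm_power mult.assoc)
  then show ?thesis
    by (intro summable_comparison_test[OF _ summable_mult[OF summable_bound[of growth "norm \<kappa>"], of scale]])
       (auto)
qed

lemma sturm_u_deriv:
  assumes x: "x \<in> {0..l}"
  shows "(sturm_u \<rho> \<kappa> has_vector_derivative sturm_v \<rho> \<kappa> x / of_real (\<rho> x)) (at x within {0..l})"
proof -
  \<comment> \<open>Differentiation lowers the index by one: the constant term drops out and term m
    + 1 yields the odd iterate 2m + 1. The sum is re-indexed at the end to - \<kappa> / \<rho> times
    the odd series.\<close>
  define d :: "nat \<Rightarrow> real \<Rightarrow> complex" where
    "d = (\<lambda>n x. case n of 0 \<Rightarrow> 0 | Suc m \<Rightarrow> of_real ((-1) ^ Suc m * (sturm_term \<rho> (2 * m + 1) x / \<rho> x)) * \<kappa> ^ Suc m)"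
  define M where "M = (\<lambda>n. case n of 0 \<Rightarrow> 0 | Suc m \<Rightarrow> K * scale * norm \<kappa> * (growth ^ m / fact m * norm \<kappa> ^ m))"
  have "((\<lambda>x. \<Sum>n. of_real (sturm_even \<rho> n x) * \<kappa> ^ n) has_vector_derivative (\<Sum>n. d n x)) (at x within {0..l})"
  proof (rule has_vector_derivative_series)
    show "((\<lambda>x. of_real (sturm_even \<rho> n x) * \<kappa> ^ n) has_vector_derivative d n x) (at x within {0..l})"
      if "x \<in> {0..l}" for n x
    proof (cases n)
      case (Suc m)
      have "2 * n = Suc (2 * m + 1)" using Suc by simp
      then have "(sturm_term \<rho> (2 * n) has_real_derivative sturm_term \<rho> (2 * m + 1) x / \<rho> x) (at x within {0..l})"
        using deriv_sturm_term[OF that, of "2 * m + 1"] by simp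
      then have "((\<lambda>x. of_real (sturm_even \<rho> n x) * \<kappa> ^ n) has_vector_derivative
         of_real ((-1) ^ n * (sturm_term \<rho> (2 * m + 1) x / \<rho> x)) * \<kappa> ^ n) (at x within {0..l})"
        by (intro has_vector_derivative_mult_left has_vector_derivative_of_real DERIV_cmult)
      then show ?thesis by (simp add: d_def Suc)
    qed (simp add: d_def)
    show "uniform_limit {0..l} (\<lambda>n x. \<Sum>i<n. d i x) (\<lambda>x. \<Sum>n. d n x) sequentially"
    proof (rule Weierstrass_m_test)
      show "norm (d n x) \<le> M n" if "x \<in> {0..l}" for n x
      proof (cases n)
        case (Suc m)
        have "1 / \<rho> x * sturm_term \<rho> (2 * m + 1) x \<le> K * (scale * (growth ^ m / fact m))"
          using K[OF that] weight_pos[OF that] by (intro mult_mono growth_scale K0 sturm_term_le_fact that sturm_term_nonneg) (auto intro: order_trans[of _ "1 / \<rho> x"])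
        then have "1 / \<rho> x * sturm_term \<rho> (2 * m + 1) x * norm \<kappa> ^ Suc m \<le> K * (scale * (growth ^ m / fact m)) * norm \<kappa> ^ Suc m"
          by (intro mult_right_mono) auto
        then show ?thesis
          using sturm_term_nonneg[OF that, of "2 * m + 1"] weight_pos[OF that]
          by (simp add: d_def M_def Suc norm_mult norm_power norm_divide mult_ac)
      qed (simp add: d_def M_def)
      have "summable (\<lambda>n. M (Suc n))"
        unfolding M_def by (simp only: nat.case) (intro summable_mult summable_bound)
      then show "summable M" using summable_Suc_iff[of M] by simp
    qed
  qed (use x summable_sturm_even in auto)
  moreover have "(\<Sum>n. d n x) = sturm_v \<rho> \<kappa> x / of_real (\<rho> x)"
  proof -
    have s: "summable (\<lambda>n. of_real (sturm_odd \<rho> n x) * \<kappa> ^ n)"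
      by (rule summable_sturm_odd[OF x])
    have d0: "d 0 x = 0" by (simp add: d_def)
    have *: "d (Suc n) x = (- \<kappa> / of_real (\<rho> x)) * (of_real (sturm_odd \<rho> n x) * \<kappa> ^ n)" for n
      by (simp add: d_def field_simps)
    then have "summable (\<lambda>n. d (Suc n) x)"
      using summable_mult[OF s, of "- \<kappa> / of_real (\<rho> x)"] by (simp only: *)
    then have "summable (\<lambda>n. d n x)" using summable_Suc_iff[of "\<lambda>n. d n x"] by simp
    then have "(\<Sum>n. d n x) = (\<Sum>n. d (Suc n) x)"
      using suminf_split_head[of "\<lambda>n. d n x"] d0 by simp
    also have "\<dots> = (- \<kappa> / of_real (\<rho> x)) * (\<Sum>n. of_real (sturm_odd \<rho> n x) * \<kappa> ^ n)"
      unfolding * by (rule suminf_mult[OF s])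
    finally show ?thesis by (simp add: sturm_v_def)
  qed
  moreover have "sturm_u \<rho> \<kappa> = (\<lambda>x. \<Sum>n. of_real (sturm_even \<rho> n x) * \<kappa> ^ n)"
    by (rule ext) (simp only: sturm_u_def)
  ultimately show ?thesis by simp
qed

lemma sturm_v_deriv:
  assumes x: "x \<in> {0..l}"
  shows "(sturm_v \<rho> \<kappa> has_vector_derivative - (\<kappa> * of_real (\<rho> x) * sturm_u \<rho> \<kappa> x)) (at x within {0..l})"
proof -
  define d :: "nat \<Rightarrow> real \<Rightarrow> complex" where
    "d = (\<lambda>n x. of_real (\<rho> x) * (of_real (sturm_even \<rho> n x) * \<kappa> ^ n))"
  have "((\<lambda>x. \<Sum>n. of_real (sturm_odd \<rho> n x) * \<kappa> ^ n) has_vector_derivative (\<Sum>n. d n x)) (at x within {0..l})"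
  proof (rule has_vector_derivative_series)
    show "((\<lambda>x. of_real (sturm_odd \<rho> n x) * \<kappa> ^ n) has_vector_derivative d n x) (at x within {0..l})"
      if "x \<in> {0..l}" for n x
    proof -
      have "(sturm_term \<rho> (2 * n + 1) has_real_derivative \<rho> x * sturm_term \<rho> (2 * n) x) (at x within {0..l})"
        using deriv_sturm_term[OF that, of "2 * n"] by simp
      then have "((\<lambda>x. of_real (sturm_odd \<rho> n x) * \<kappa> ^ n) has_vector_derivative
         of_real ((-1) ^ n * (\<rho> x * sturm_term \<rho> (2 * n) x)) * \<kappa> ^ n) (at x within {0..l})"
        by (intro has_vector_derivative_mult_left has_vector_derivative_of_real DERIV_cmult)
      then show ?thesis by (simp add: d_def mult_ac)
    qed
    show "uniform_limit {0..l} (\<lambda>n x. \<Sum>i<n. d i x) (\<lambda>x. \<Sum>n. d n x) sequentially"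
    proof (rule Weierstrass_m_test)
      show "norm (d n x) \<le> K * (growth ^ n / fact n * norm \<kappa> ^ n)" if "x \<in> {0..l}" for n x
      proof -
        have "\<rho> x * (sturm_term \<rho> (2 * n) x * norm \<kappa> ^ n) \<le> K * (growth ^ n / fact n * norm \<kappa> ^ n)"
          using K[OF that] weight_pos[OF that]
          by (intro mult_mono mult_nonneg_nonneg divide_nonneg_pos zero_le_power growth_scale sturm_term_le_fact that sturm_term_nonneg) auto
        then show ?thesis
          using sturm_term_nonneg[OF that, of "2 * n"] weight_pos[OF that]
          by (simp add: d_def norm_mult norm_power)
      qed
      show "summable (\<lambda>n. K * (growth ^ n / fact n * norm \<kappa> ^ n))"
        by (intro summable_mult summable_bound)
    qed
  qed (use x summable_sturm_odd in auto)
  moreover have "(\<Sum>n. d n x) = of_real (\<rho> x) * sturm_u \<rho> \<kappa> x"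
    unfolding d_def sturm_u_def by (rule suminf_mult[OF summable_sturm_even[OF x]])
  ultimately have "((\<lambda>x. - \<kappa> * (\<Sum>n. of_real (sturm_odd \<rho> n x) * \<kappa> ^ n)) has_vector_derivative
      - \<kappa> * (of_real (\<rho> x) * sturm_u \<rho> \<kappa> x)) (at x within {0..l})"
    by (intro has_vector_derivative_mult_right) simp
  then show ?thesis
    unfolding sturm_v_def[of \<rho> \<kappa>, abs_def] by (simp add: mult.assoc)
qed

lemma sturm_uv_at_0: "sturm_u \<rho> \<kappa> 0 = 1" "sturm_v \<rho> \<kappa> 0 = 0"
proof -
  have z: "sturm_term \<rho> (Suc n) 0 = 0" for n by (simp add: sturm_term.simps)
  have "sturm_u \<rho> \<kappa> 0 = (\<Sum>n\<in>{0}. of_real (sturm_even \<rho> n 0) * \<kappa> ^ n)"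
    unfolding sturm_u_def
  proof (rule suminf_finite)
    fix n :: nat assume "n \<notin> {0}"
    then obtain m where "2 * n = Suc m" by (cases "2 * n") auto
    then show "of_real (sturm_even \<rho> n 0) * \<kappa> ^ n = 0" by (simp add: z)
  qed simp
  then show "sturm_u \<rho> \<kappa> 0 = 1" by simp
  show "sturm_v \<rho> \<kappa> 0 = 0" by (simp add: sturm_v_def z)
qed

lemma sturm_system_uv: "sturm_system \<rho> l \<kappa> (sturm_u \<rho> \<kappa>) (sturm_v \<rho> \<kappa>)"
proof -
  have *: "at x within {0..l} = at x" if "x \<in> {0<..<l}" for x :: real
    using that by (intro at_within_interior) auto
  show ?thesis
    unfolding sturm_system_def
  proof (intro conjI ballI)
    show "continuous_on {0..l} (sturm_u \<rho> \<kappa>)"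
      by (rule continuous_on_vector_derivative[OF sturm_u_deriv])
    show "continuous_on {0..l} (sturm_v \<rho> \<kappa>)"
      by (rule continuous_on_vector_derivative[OF sturm_v_deriv])
    fix x assume x: "x \<in> {0<..<l}"
    then have "x \<in> {0..l}" by auto
    from sturm_u_deriv[OF this, of \<kappa>] sturm_v_deriv[OF this, of \<kappa>] *[OF x]
    show "(sturm_u \<rho> \<kappa> has_vector_derivative sturm_v \<rho> \<kappa> x / of_real (\<rho> x)) (at x)"
      "(sturm_v \<rho> \<kappa> has_vector_derivative - (\<kappa> * of_real (\<rho> x) * sturm_u \<rho> \<kappa> x)) (at x)"
      by simp_all
  qed
qed

lemma sturm_u_entire: "x \<in> {0..l} \<Longrightarrow> (\<lambda>\<kappa>. sturm_u \<rho> \<kappa> x) holomorphic_on UNIV"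
  and sturm_v_entire: "x \<in> {0..l} \<Longrightarrow> (\<lambda>\<kappa>. sturm_v \<rho> \<kappa> x) holomorphic_on UNIV"
proof -
  assume x: "x \<in> {0..l}"
  show "(\<lambda>\<kappa>. sturm_u \<rho> \<kappa> x) holomorphic_on UNIV"
    unfolding sturm_u_def
    using termdiffs_strong_converges_everywhere[OF summable_sturm_even[OF x]]
    by (auto simp: holomorphic_on_open)
  have "(\<lambda>\<kappa>. (\<Sum>n. of_real (sturm_odd \<rho> n x) * \<kappa> ^ n)) holomorphic_on (UNIV::complex set)"
    using termdiffs_strong_converges_everywhere[OF summable_sturm_odd[OF x]]
    by (auto simp: holomorphic_on_open)
  then show "(\<lambda>\<kappa>. sturm_v \<rho> \<kappa> x) holomorphic_on UNIV"
    unfolding sturm_v_def by (intro holomorphic_intros)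
qed

lemma sturm_cnj:
  assumes x: "x \<in> {0..l}"
  shows "sturm_u \<rho> (cnj \<kappa>) x = cnj (sturm_u \<rho> \<kappa> x)" "sturm_v \<rho> (cnj \<kappa>) x = cnj (sturm_v \<rho> \<kappa> x)"
proof -
  have "(\<lambda>n. cnj (of_real (sturm_even \<rho> n x) * \<kappa> ^ n)) sums cnj (sturm_u \<rho> \<kappa> x)"
    using summable_sums[OF summable_sturm_even[OF x, of \<kappa>]] unfolding sturm_u_def sums_cnj .
  then show "sturm_u \<rho> (cnj \<kappa>) x = cnj (sturm_u \<rho> \<kappa> x)"
    by (simp add: sturm_u_def sums_iff)
  have "(\<lambda>n. cnj (of_real (sturm_odd \<rho> n x) * \<kappa> ^ n))
      sums cnj (\<Sum>n. of_real (sturm_odd \<rho> n x) * \<kappa> ^ n)"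
    using summable_sums[OF summable_sturm_odd[OF x, of \<kappa>]] unfolding sums_cnj .
  then show "sturm_v \<rho> (cnj \<kappa>) x = cnj (sturm_v \<rho> \<kappa> x)"
    by (simp add: sturm_v_def sums_iff)
qed

end

section \<open>Absolutely continuous functions\<close>

text \<open>Isolating the inner clause lets a chosen \<delta> be carried around as one fact and
  applied to concrete families of intervals.\<close>

definition ac_modulus :: "real \<Rightarrow> real \<Rightarrow> (real \<Rightarrow> 'a::real_normed_vector) \<Rightarrow> real \<Rightarrow> real \<Rightarrow> bool" where
  "ac_modulus a b f \<epsilon> \<delta> \<longleftrightarrow> 0 < \<delta> \<and> (\<forall>(n::nat) u v.
        (\<forall>i<n. a \<le> u i \<and> u i \<le> v i \<and> v i \<le> b) \<longrightarrow>
        disjoint_family_on (\<lambda>i. {u i<..<v i}) {..<n} \<longrightarrow>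
        (\<Sum>i<n. v i - u i) < \<delta> \<longrightarrow>
        (\<Sum>i<n. norm (f (v i) - f (u i))) < \<epsilon>)"

lemma abs_continuous_fun_on_iff_modulus:
  "abs_continuous_fun_on a b f \<longleftrightarrow> (\<forall>\<epsilon>>0. \<exists>\<delta>. ac_modulus a b f \<epsilon> \<delta>)"
  unfolding abs_continuous_fun_on_def ac_modulus_def by (rule refl)

lemma abs_continuous_fun_onD:
  "abs_continuous_fun_on a b f \<Longrightarrow> 0 < \<epsilon> \<Longrightarrow> \<exists>\<delta>. ac_modulus a b f \<epsilon> \<delta>"
  by (simp add: abs_continuous_fun_on_iff_modulus)

lemma ac_modulusD:
  "ac_modulus a b f \<epsilon> \<delta> \<Longrightarrow> (\<And>i. i < n \<Longrightarrow> a \<le> u i \<and> u i \<le> v i \<and> v i \<le> b) \<Longrightarrow>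
    disjoint_family_on (\<lambda>i. {u i<..<v i}) {..<n::nat} \<Longrightarrow>
    (\<Sum>i<n. v i - u i) < \<delta> \<Longrightarrow> (\<Sum>i<n. norm (f (v i) - f (u i))) < \<epsilon>"
  unfolding ac_modulus_def by blast

lemma ac_modulus_pos: "ac_modulus a b f \<epsilon> \<delta> \<Longrightarrow> 0 < \<delta>"
  by (simp add: ac_modulus_def)

text \<open>The common source of the closure properties below: sums, products, real embeddings and
  Lipschitz functions all have increments bounded by a multiple of the increments of two given
  functions.\<close>

lemma abs_continuous_fun_on_dominated:
  fixes f :: "real \<Rightarrow> 'a::real_normed_vector" and g :: "real \<Rightarrow> 'b::real_normed_vector"
    and h :: "real \<Rightarrow> 'c::real_normed_vector"
  assumes f: "abs_continuous_fun_on a b f" and g: "abs_continuous_fun_on a b g"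
    and M: "\<And>x y. x \<in> {a..b} \<Longrightarrow> y \<in> {a..b} \<Longrightarrow>
       norm (h x - h y) \<le> M * (norm (f x - f y) + norm (g x - g y))"
  shows "abs_continuous_fun_on a b h"
  unfolding abs_continuous_fun_on_iff_modulus
proof (intro allI impI)
  fix \<epsilon> :: real assume "0 < \<epsilon>"
  \<comment> \<open>Chosen so that (|M| + 1) (\<eta> + \<eta>) = \<epsilon>. The sign of M is
    unknown, and |M| + 1 is a positive upper bound by which one can divide.\<close>
  define \<eta> where "\<eta> = \<epsilon> / (\<bar>M\<bar> + 1) / 2"
  have \<eta>: "0 < \<eta>" using \<open>0 < \<epsilon>\<close> by (simp add: \<eta>_def)
  obtain \<delta>1 where \<delta>1: "ac_modulus a b f \<eta> \<delta>1"
    using abs_continuous_fun_onD[OF f \<eta>] by blast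
  obtain \<delta>2 where \<delta>2: "ac_modulus a b g \<eta> \<delta>2"
    using abs_continuous_fun_onD[OF g \<eta>] by blast
  show "\<exists>\<delta>. ac_modulus a b h \<epsilon> \<delta>"
    unfolding ac_modulus_def
  proof (rule exI[of _ "min \<delta>1 \<delta>2"], intro conjI allI impI)
    fix n :: nat and u v :: "nat \<Rightarrow> real"
    assume uv: "\<forall>i<n. a \<le> u i \<and> u i \<le> v i \<and> v i \<le> b"
      and dis: "disjoint_family_on (\<lambda>i. {u i<..<v i}) {..<n}"
      and len: "(\<Sum>i<n. v i - u i) < min \<delta>1 \<delta>2"
    have 1: "(\<Sum>i<n. norm (f (v i) - f (u i))) < \<eta>"
      by (rule ac_modulusD[OF \<delta>1 _ dis]) (use uv len in auto)
    have 2: "(\<Sum>i<n. norm (g (v i) - g (u i))) < \<eta>"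
      by (rule ac_modulusD[OF \<delta>2 _ dis]) (use uv len in auto)
    have "(\<Sum>i<n. norm (h (v i) - h (u i)))
        \<le> (\<Sum>i<n. (\<bar>M\<bar> + 1) * (norm (f (v i) - f (u i)) + norm (g (v i) - g (u i))))"
    proof (rule sum_mono)
      fix i assume "i \<in> {..<n}"
      then have "a \<le> u i \<and> u i \<le> v i \<and> v i \<le> b" using uv by auto
      then have "norm (h (v i) - h (u i)) \<le> M * (norm (f (v i) - f (u i)) + norm (g (v i) - g (u i)))"
        by (intro M) auto
      also have "\<dots> \<le> (\<bar>M\<bar> + 1) * (norm (f (v i) - f (u i)) + norm (g (v i) - g (u i)))"
        by (intro mult_right_mono) auto
      finally show "norm (h (v i) - h (u i)) \<le> \<dots>" .
    qed
    also have "\<dots> = (\<bar>M\<bar> + 1) * ((\<Sum>i<n. norm (f (v i) - f (u i))) + (\<Sum>i<n. norm (g (v i) - g (u i))))"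
      by (simp add: sum.distrib flip: sum_distrib_left)
    also have "\<dots> < (\<bar>M\<bar> + 1) * (\<eta> + \<eta>)"
      by (intro mult_strict_left_mono add_strict_mono 1 2) auto
    also have "\<dots> = \<epsilon>"
    proof -
      have "\<bar>M\<bar> + 1 \<noteq> 0" by linarith
      then show ?thesis unfolding \<eta>_def field_sum_of_halves by simp
    qed
    finally show "(\<Sum>i<n. norm (h (v i) - h (u i))) < \<epsilon>" .
  qed (use ac_modulus_pos[OF \<delta>1] ac_modulus_pos[OF \<delta>2] in auto)
qed

lemma abs_continuous_fun_on_ident: "abs_continuous_fun_on a b (\<lambda>x. x)"
  unfolding abs_continuous_fun_on_iff_modulus ac_modulus_def by (auto intro!: exI)

text \<open>Domination by the identity, which fills both slots; this is why the constant is
  halved.\<close>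

lemma abs_continuous_fun_on_lipschitz:
  fixes f :: "real \<Rightarrow> 'a::real_normed_vector"
  assumes "\<And>x y. x \<in> {a..b} \<Longrightarrow> y \<in> {a..b} \<Longrightarrow> norm (f x - f y) \<le> L * \<bar>x - y\<bar>"
  shows "abs_continuous_fun_on a b f"
proof (rule abs_continuous_fun_on_dominated[OF abs_continuous_fun_on_ident abs_continuous_fun_on_ident])
  show "norm (f x - f y) \<le> L / 2 * (norm (x - y) + norm (x - y))" if "x \<in> {a..b}" "y \<in> {a..b}" for x y
    using assms[OF that] by simp
qed

lemma abs_continuous_fun_on_cong:
  "abs_continuous_fun_on a b f \<Longrightarrow> (\<And>x. x \<in> {a..b} \<Longrightarrow> g x = f x) \<Longrightarrow> abs_continuous_fun_on a b g"
  by (rule abs_continuous_fun_on_dominated[of _ _ f f _ 1]) auto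

lemma abs_continuous_fun_on_of_real:
  "abs_continuous_fun_on a b f \<Longrightarrow>
    abs_continuous_fun_on a b (\<lambda>x. of_real (f x) :: 'a::real_normed_algebra_1)"
  by (rule abs_continuous_fun_on_dominated[of _ _ f f _ 1]) (simp_all flip: of_real_diff)

lemma abs_continuous_fun_on_add:
  "abs_continuous_fun_on a b f \<Longrightarrow> abs_continuous_fun_on a b g \<Longrightarrow>
    abs_continuous_fun_on a b (\<lambda>x. f x + g x)"
  by (rule abs_continuous_fun_on_dominated[of _ _ f g _ 1])
     (simp_all add: norm_diff_triangle_ineq)

lemma abs_continuous_fun_on_diff:
  assumes f: "abs_continuous_fun_on a b f" and g: "abs_continuous_fun_on a b g"
  shows "abs_continuous_fun_on a b (\<lambda>x. f x - g x)"
proof (rule abs_continuous_fun_on_dominated[OF f g, of _ 1])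
  show "norm ((f x - g x) - (f y - g y)) \<le> 1 * (norm (f x - f y) + norm (g x - g y))" for x y
    using norm_triangle_ineq4[of "f x - f y" "g x - g y"] by (simp add: algebra_simps)
qed

lemma abs_continuous_fun_on_imp_continuous:
  fixes f :: "real \<Rightarrow> 'a::real_normed_vector"
  assumes f: "abs_continuous_fun_on a b f"
  shows "continuous_on {a..b} f"
  unfolding continuous_on_iff
proof (intro ballI allI impI)
  fix x and e :: real assume x: "x \<in> {a..b}" and "0 < e"
  then obtain \<delta> where \<delta>: "ac_modulus a b f e \<delta>"
    using abs_continuous_fun_onD[OF f] by blast
  have "dist (f y) (f x) < e" if "y \<in> {a..b}" "dist y x < \<delta>" for y
    using ac_modulusD[OF \<delta>, of 1 "\<lambda>_. x" "\<lambda>_. y"] ac_modulusD[OF \<delta>, of 1 "\<lambda>_. y" "\<lambda>_. x"] x that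
    by (cases "x \<le> y") (auto simp: disjoint_family_on_def dist_norm norm_minus_commute)
  then show "\<exists>d>0. \<forall>y\<in>{a..b}. dist y x < d \<longrightarrow> dist (f y) (f x) < e"
    using ac_modulus_pos[OF \<delta>] by blast
qed

lemma abs_continuous_fun_on_mult:
  fixes f g :: "real \<Rightarrow> 'a::real_normed_algebra"
  assumes f: "abs_continuous_fun_on a b f" and g: "abs_continuous_fun_on a b g"
  shows "abs_continuous_fun_on a b (\<lambda>x. f x * g x)"
proof -
  have "bounded ((\<lambda>x. norm (f x) + norm (g x)) ` {a..b})"
    by (intro compact_imp_bounded compact_continuous_image continuous_intros
          abs_continuous_fun_on_imp_continuous f g) auto
  then obtain M where M: "\<And>x. x \<in> {a..b} \<Longrightarrow> norm (f x) + norm (g x) \<le> M"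
    unfolding bounded_iff by fastforce
  show ?thesis
  proof (rule abs_continuous_fun_on_dominated[OF f g])
    fix x y assume xy: "x \<in> {a..b}" "y \<in> {a..b}"
    have "norm (f x) \<le> M" "norm (g y) \<le> M"
      using M[OF xy(1)] M[OF xy(2)] norm_ge_zero[of "g x"] norm_ge_zero[of "f y"] by linarith+
    then have "norm (f x * (g x - g y)) \<le> M * norm (g x - g y)"
      "norm ((f x - f y) * g y) \<le> norm (f x - f y) * M"
      by (meson norm_mult_ineq order_trans mult_right_mono mult_left_mono norm_ge_zero)+
    \<comment> \<open>The usual splitting of the increment of a product; M bounds both factors
      because absolutely continuous functions are continuous on a compact interval.\<close>
    moreover have "f x * g x - f y * g y = f x * (g x - g y) + (f x - f y) * g y"
      by (simp add: algebra_simps)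
    ultimately show "norm (f x * g x - f y * g y) \<le> M * (norm (f x - f y) + norm (g x - g y))"
      using norm_triangle_ineq[of "f x * (g x - g y)" "(f x - f y) * g y"]
      by (simp add: algebra_simps)
  qed
qed

lemma abs_continuous_fun_on_C1:
  fixes f :: "real \<Rightarrow> 'a::real_normed_vector"
  assumes der: "\<And>x. x \<in> {a..b} \<Longrightarrow> (f has_vector_derivative f' x) (at x within {a..b})"
    and cont: "continuous_on {a..b} f'"
  shows "abs_continuous_fun_on a b f"
proof -
  have "bounded ((\<lambda>x. norm (f' x)) ` {a..b})"
    by (intro compact_imp_bounded compact_continuous_image continuous_intros cont) auto
  then obtain L where L: "\<And>x. x \<in> {a..b} \<Longrightarrow> norm (f' x) \<le> L"
    unfolding bounded_iff by fastforce
  have contf: "continuous_on {a..b} f" by (rule continuous_on_vector_derivative[OF der])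
  have less: "norm (f y - f x) \<le> L * \<bar>y - x\<bar>" if "x \<in> {a..b}" "y \<in> {a..b}" "x < y" for x y
  proof -
    have "norm (f y - f x) \<le> L * y - L * x"
    proof (rule differentiable_bound_general[OF \<open>x < y\<close>, where f' = f' and \<phi>' = "\<lambda>_. L"])
      fix t assume t: "x < t" "t < y"
      then have "at t within {a..b} = at t" using that by (intro at_within_interior) auto
      then show "(f has_vector_derivative f' t) (at t)" using der[of t] t that by auto
      show "norm (f' t) \<le> L" using L[of t] t that by auto
      show "((\<lambda>x. L * x) has_vector_derivative L) (at t)"
        by (auto intro!: derivative_eq_intros simp flip: has_real_derivative_iff_has_vector_derivative)
    qed (use that contf in \<open>auto intro!: continuous_intros intro: continuous_on_subset\<close>)
    then show ?thesis using that by (simp add: algebra_simps)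
  qed
  show ?thesis
  proof (rule abs_continuous_fun_on_lipschitz)
    show "norm (f x - f y) \<le> L * \<bar>x - y\<bar>" if "x \<in> {a..b}" "y \<in> {a..b}" for x y
      using less[of x y] less[of y x] that
      by (cases x y rule: linorder_cases) (auto simp: norm_minus_commute abs_minus_commute)
  qed
qed

lemma abs_continuous_fun_on_subset:
  assumes "abs_continuous_fun_on a b f" "c \<le> b"
  shows "abs_continuous_fun_on a c f"
proof -
  have "ac_modulus a c f \<epsilon> \<delta>" if "ac_modulus a b f \<epsilon> \<delta>" for \<epsilon> \<delta>
    unfolding ac_modulus_def
  proof (intro conjI allI impI)
    fix n :: nat and u v :: "nat \<Rightarrow> real"
    assume uv: "\<forall>i<n. a \<le> u i \<and> u i \<le> v i \<and> v i \<le> c"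
      "disjoint_family_on (\<lambda>i. {u i<..<v i}) {..<n}" "(\<Sum>i<n. v i - u i) < \<delta>"
    show "(\<Sum>i<n. norm (f (v i) - f (u i))) < \<epsilon>"
      by (rule ac_modulusD[OF that]) (use uv assms(2) in force)+
  qed (rule ac_modulus_pos[OF that])
  then show ?thesis using assms(1) unfolding abs_continuous_fun_on_iff_modulus by blast
qed

text \<open>A gauge argument: intervals tagged outside the exceptional null set contribute little because
  the derivative vanishes, the others because they lie in an open set of small measure.\<close>

lemma abs_continuous_zero_derivative_aux:
  fixes g :: "real \<Rightarrow> 'a::real_normed_vector"
  assumes ac: "abs_continuous_fun_on a b g" and ab: "a \<le> b"
    and ae: "AE x in lebesgue. x \<in> {a<..<b} \<longrightarrow> (g has_vector_derivative 0) (at x)"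
    and \<epsilon>: "0 < \<epsilon>"
  shows "norm (g b - g a) \<le> \<epsilon> * (b - a) + \<epsilon>"
proof -
  obtain \<delta> where \<delta>: "ac_modulus a b g \<epsilon> \<delta>"
    using abs_continuous_fun_onD[OF ac \<epsilon>] by blast
  obtain N0 where N0: "N0 \<in> null_sets lebesgue"
    "{x \<in> space lebesgue. \<not> (x \<in> {a<..<b} \<longrightarrow> (g has_vector_derivative 0) (at x))} \<subseteq> N0"
    using ae unfolding eventually_ae_filter by blast
  \<comment> \<open>The derivative is given only in the open interval, so the endpoints join the
    exceptional set and are treated through the measure estimate.\<close>
  define N where "N = N0 \<union> {a, b}"
  have N: "N \<in> null_sets lebesgue"
    unfolding N_def by (intro null_sets.Un N0) (auto intro: finite_imp_null_set_lborel null_sets_completionI)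
  have der: "(g has_vector_derivative 0) (at x)" if "x \<in> {a..b} - N" for x
  proof (rule ccontr)
    assume "\<not> (g has_vector_derivative 0) (at x)"
    moreover have "x \<in> {a<..<b}" using that by (auto simp: N_def)
    ultimately have "x \<in> N0" using N0(2) by auto
    then show False using that by (simp add: N_def)
  qed
  obtain T where T: "open T" "N \<subseteq> T" "T - N \<in> lmeasurable" "emeasure lebesgue (T - N) < ennreal \<delta>"
    using sets_lebesgue_outer_open[OF null_setsD2[OF N] ac_modulus_pos[OF \<delta>]] by metis
  have mT: "emeasure lebesgue T < ennreal \<delta>"
    using T(4) emeasure_Diff_null_set[OF N, of T] T(1) by simp
  \<comment> \<open>The gauge: a ball inside the small open set T around exceptional points, and a
    ball on which increments are at most \<epsilon> |y - x| around the other points of the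
    interval.\<close>
  have "\<exists>d>0. (x \<in> N \<longrightarrow> ball x d \<subseteq> T) \<and> (x \<in> {a..b} - N \<longrightarrow> (\<forall>y\<in>ball x d. norm (g y - g x) \<le> \<epsilon> * \<bar>y - x\<bar>))" for x
  proof (cases "x \<in> N")
    case True
    then show ?thesis using T(1,2) open_contains_ball by blast
  next
    case False
    show ?thesis
    proof (cases "x \<in> {a..b}")
      case True
      then have "(g has_derivative (\<lambda>h. h *\<^sub>R 0)) (at x)"
        using der[of x] False by (simp add: has_vector_derivative_def)
      then obtain d where "d > 0" "\<And>y. norm (y - x) < d \<Longrightarrow> norm (g y - g x - (y - x) *\<^sub>R 0) \<le> \<epsilon> * norm (y - x)"
        unfolding has_derivative_at_alt using \<epsilon> by metis
      then show ?thesis using False by (intro exI[of _ d]) (auto simp: dist_norm norm_minus_commute)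
    qed (use False in \<open>auto intro: exI[of _ 1]\<close>)
  qed
  then obtain d where d: "\<And>x. d x > 0" "\<And>x. x \<in> N \<Longrightarrow> ball x (d x) \<subseteq> T"
    "\<And>x y. x \<in> {a..b} - N \<Longrightarrow> y \<in> ball x (d x) \<Longrightarrow> norm (g y - g x) \<le> \<epsilon> * \<bar>y - x\<bar>"
    by metis
  have "gauge (\<lambda>x. ball x (d x))" using d(1) by (simp add: gauge_def)
  then obtain p where p: "p tagged_division_of {a..b}" "(\<lambda>x. ball x (d x)) fine p"
    using fine_division_exists_real by metis
  have fin: "finite p" using p(1) by blast
  have shape: "\<exists>u v. K = {u..v} \<and> a \<le> u \<and> u \<le> x \<and> x \<le> v \<and> v \<le> b" if xK: "(x, K) \<in> p" for x K
  proof -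
    obtain u v where "K = {u..v}" using tagged_division_ofD(4)[OF p(1) xK] by auto
    then show ?thesis
      using tagged_division_ofD(2,3)[OF p(1) xK] by (auto simp: subset_iff)
  qed
  have Kbound: "Inf K \<le> x \<and> x \<le> Sup K \<and> a \<le> Inf K \<and> Sup K \<le> b \<and> K = {Inf K..Sup K}" if "(x, K) \<in> p" for x K
    using shape[OF that] by auto
  \<comment> \<open>The division is split by its tags. Intervals tagged off N contribute at most
    \<epsilon> times their length; those tagged in N have total length below \<delta>, since they
    lie in T, and absolute continuity applies.\<close>
  define p1 where "p1 = {z \<in> p. fst z \<in> N}"
  have p1: "finite p1" "p1 \<subseteq> p" using fin by (auto simp: p1_def)
  have total: "(\<Sum>(x, K)\<in>p. f (Sup K) - f (Inf K)) = f b - f a" for f :: "real \<Rightarrow> 'c::real_normed_vector"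
    by (rule additive_tagged_division_1[OF ab p(1)])
  have reg: "norm (\<Sum>(x, K)\<in>p - p1. g (Sup K) - g (Inf K)) \<le> \<epsilon> * (b - a)"
  proof -
    have "norm (\<Sum>(x, K)\<in>p - p1. g (Sup K) - g (Inf K)) \<le> (\<Sum>(x, K)\<in>p - p1. \<epsilon> * (Sup K - Inf K))"
    proof (intro sum_norm_le, clarify)
      fix x K assume xK: "(x, K) \<in> p" "(x, K) \<notin> p1"
      have K: "Inf K \<le> x" "x \<le> Sup K" "a \<le> Inf K" "Sup K \<le> b" and Keq: "K = {Inf K..Sup K}"
        using Kbound[OF xK(1)] by auto
      have x: "x \<in> {a..b} - N" using xK K by (auto simp: p1_def)
      have "K \<subseteq> ball x (d x)" using p(2) xK(1) by (auto simp: fine_def)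
      then have "Inf K \<in> ball x (d x)" "Sup K \<in> ball x (d x)"
        using Keq K by (metis atLeastAtMost_iff order_refl order_trans subsetD)+
      then have "norm (g (Sup K) - g x) \<le> \<epsilon> * (Sup K - x)" "norm (g x - g (Inf K)) \<le> \<epsilon> * (x - Inf K)"
        using d(3)[OF x, of "Sup K"] d(3)[OF x, of "Inf K"] K by (auto simp: norm_minus_commute)
      then have "norm (g (Sup K) - g (Inf K)) \<le> \<epsilon> * (Sup K - x) + \<epsilon> * (x - Inf K)"
        using norm_triangle_ineq[of "g (Sup K) - g x" "g x - g (Inf K)"] by simp
      then show "norm (g (Sup K) - g (Inf K)) \<le> \<epsilon> * (Sup K - Inf K)"
        by (simp add: algebra_simps)
    qed
    also have "\<dots> \<le> (\<Sum>(x, K)\<in>p. \<epsilon> * (Sup K - Inf K))"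
    proof (rule sum_mono2[OF fin])
      fix z assume "z \<in> p - (p - p1)"
      then show "0 \<le> (case z of (x, K) \<Rightarrow> \<epsilon> * (Sup K - Inf K))"
        using Kbound[of "fst z" "snd z"] \<epsilon> by (auto simp: case_prod_beta)
    qed auto
    also have "\<dots> = \<epsilon> * (b - a)"
      using total[of "\<lambda>x. x"] by (simp add: case_prod_beta flip: sum_distrib_left)
    finally show ?thesis .
  qed
  have sing: "norm (\<Sum>(x, K)\<in>p1. g (Sup K) - g (Inf K)) \<le> \<epsilon>"
  proof -
    \<comment> \<open>Absolute continuity speaks of families indexed by {..<n}, so the finite set of
      tagged intervals is numbered.\<close>
    obtain h where h: "bij_betw h {..<card p1} p1"
      using ex_bij_betw_nat_finite[OF p1(1)] by (auto simp: atLeast0LessThan)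
    define u where "u = (\<lambda>i. Inf (snd (h i)))"
    define v where "v = (\<lambda>i. Sup (snd (h i)))"
    have hp: "(fst (h i), snd (h i)) \<in> p1" if "i < card p1" for i
      using h that by (auto simp: bij_betw_def)
    have uv: "a \<le> u i \<and> u i \<le> v i \<and> v i \<le> b" if "i < card p1" for i
      using Kbound[of "fst (h i)" "snd (h i)"] hp[OF that] p1(2) by (auto simp: u_def v_def)
    have K: "snd (h i) = {u i..v i}" if "i < card p1" for i
      using Kbound[of "fst (h i)" "snd (h i)"] hp[OF that] p1(2) unfolding u_def v_def by blast
    have dis: "disjoint_family_on (\<lambda>i. {u i<..<v i}) {..<card p1}"
      unfolding disjoint_family_on_def
    proof (intro ballI impI)
      fix i j assume ij: "i \<in> {..<card p1}" "j \<in> {..<card p1}" "i \<noteq> j"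
      then have "h i \<noteq> h j" using h by (auto simp: bij_betw_def inj_on_def)
      then have "interior (snd (h i)) \<inter> interior (snd (h j)) = {}"
        using tagged_division_ofD(5)[OF p(1), of "fst (h i)" "snd (h i)" "fst (h j)" "snd (h j)"]
          hp[of i] hp[of j] ij p1(2) by (auto simp: prod_eq_iff)
      then show "{u i<..<v i} \<inter> {u j<..<v j} = {}"
        using K[of i] K[of j] ij by (simp add: interior_atLeastAtMost_real)
    qed
    have "ennreal (\<Sum>i<card p1. v i - u i) = (\<Sum>i<card p1. ennreal (v i - u i))"
      by (rule sum_ennreal[symmetric]) (use uv in auto)
    also have "\<dots> = (\<Sum>i<card p1. emeasure lebesgue {u i<..<v i})"
      using uv by (intro sum.cong refl) (simp add: emeasure_completion)
    also have "\<dots> = emeasure lebesgue (\<Union>i<card p1. {u i<..<v i})"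
      by (rule sum_emeasure[OF _ dis]) auto
    also have "\<dots> \<le> emeasure lebesgue T"
    proof (rule emeasure_mono)
      show "(\<Union>i<card p1. {u i<..<v i}) \<subseteq> T"
      proof (rule UN_least)
        fix i assume "i \<in> {..<card p1}"
        then have i: "(fst (h i), snd (h i)) \<in> p1" "snd (h i) = {u i..v i}" using hp K by auto
        then have "fst (h i) \<in> N" "(fst (h i), snd (h i)) \<in> p" by (auto simp: p1_def)
        moreover have "snd (h i) \<subseteq> ball (fst (h i)) (d (fst (h i)))"
          using p(2) calculation(2) unfolding fine_def by blast
        ultimately have "{u i..v i} \<subseteq> T" using d(2) i(2) by blast
        then show "{u i<..<v i} \<subseteq> T" by (auto simp: subset_iff)
      qed
    qed (use T(1) in auto)
    also have "\<dots> < ennreal \<delta>" by (rule mT)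
    finally have "(\<Sum>i<card p1. v i - u i) < \<delta>"
      by (subst (asm) ennreal_less_iff) (use uv in \<open>auto intro!: sum_nonneg\<close>)
    then have "(\<Sum>i<card p1. norm (g (v i) - g (u i))) < \<epsilon>"
      by (intro ac_modulusD[OF \<delta> uv dis])
    also have "(\<Sum>i<card p1. norm (g (v i) - g (u i))) = (\<Sum>(x, K)\<in>p1. norm (g (Sup K) - g (Inf K)))"
      using sum.reindex_bij_betw[OF h, of "\<lambda>(x, K). norm (g (Sup K) - g (Inf K))"]
      by (simp add: u_def v_def case_prod_beta)
    finally show ?thesis
      by (intro order_trans[OF norm_sum]) (simp add: case_prod_beta)
  qed
  have "g b - g a = (\<Sum>(x, K)\<in>p - p1. g (Sup K) - g (Inf K)) + (\<Sum>(x, K)\<in>p1. g (Sup K) - g (Inf K))"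
    using total[of g] sum.subset_diff[OF p1(2) fin, of "\<lambda>(x, K). g (Sup K) - g (Inf K)"] by simp
  then show ?thesis
    using reg sing norm_triangle_ineq[of "\<Sum>(x, K)\<in>p - p1. g (Sup K) - g (Inf K)" "\<Sum>(x, K)\<in>p1. g (Sup K) - g (Inf K)"]
    by simp
qed

text \<open>Applied to the initial segment [a, x] and with \<epsilon> tending to 0. This is the tool
  that turns the almost-everywhere equation for \<open>phi\<close> into an identity at every
  point.\<close>

lemma abs_continuous_zero_derivative:
  fixes g :: "real \<Rightarrow> 'a::real_normed_vector"
  assumes ac: "abs_continuous_fun_on a b g"
    and ae: "AE x in lebesgue. x \<in> {a<..<b} \<longrightarrow> (g has_vector_derivative 0) (at x)"
    and x: "x \<in> {a..b}"
  shows "g x = g a"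
proof -
  have "norm (g x - g a) \<le> \<epsilon> * (x - a) + \<epsilon>" if "0 < \<epsilon>" for \<epsilon>
  proof (rule abs_continuous_zero_derivative_aux[OF _ _ _ that])
    show "abs_continuous_fun_on a x g" by (rule abs_continuous_fun_on_subset[OF ac]) (use x in auto)
    show "AE t in lebesgue. t \<in> {a<..<x} \<longrightarrow> (g has_vector_derivative 0) (at t)"
      using ae by eventually_elim (use x in auto)
  qed (use x in auto)
  then have *: "norm (g x - g a) \<le> \<epsilon> * (x - a + 1)" if "0 < \<epsilon>" for \<epsilon>
    using that by (simp add: algebra_simps)
  have "norm (g x - g a) \<le> 0 + \<epsilon>" if "0 < \<epsilon>" for \<epsilon>
    using *[of "\<epsilon> / (x - a + 1)"] that x by simp
  then have "norm (g x - g a) \<le> 0" by (rule field_le_epsilon)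
  then show ?thesis by simp
qed

section \<open>The boundary value problem\<close>

lemma tract_deriv_eqI:
  "0 < l \<Longrightarrow> x \<in> {0..l} \<Longrightarrow> (f has_vector_derivative D) (at x within {0..l}) \<Longrightarrow> tract_deriv l f x = D"
  unfolding tract_deriv_def using vector_derivative_within_cbox[of 0 l x f D] by simp

lemma has_vector_derivative_tract_deriv:
  "f differentiable_on {0..l} \<Longrightarrow> x \<in> {0..l} \<Longrightarrow>
    (f has_vector_derivative tract_deriv l f x) (at x within {0..l})"
  unfolding tract_deriv_def differentiable_on_def by (simp add: vector_derivative_works)

lemma at_within_Icc_interior: "x \<in> {0<..<l} \<Longrightarrow> at x within {0..l} = at (x::real)"
  by (intro at_within_interior) auto

lemma sturm_system_diff:
  assumes 1: "sturm_system \<rho> l \<kappa> u v" and 2: "sturm_system \<rho> l \<kappa> p w"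
  shows "sturm_system \<rho> l \<kappa> (\<lambda>x. u x - c * p x) (\<lambda>x. v x - c * w x)"
  unfolding sturm_system_def
proof (intro conjI ballI)
  show "continuous_on {0..l} (\<lambda>x. u x - c * p x)" "continuous_on {0..l} (\<lambda>x. v x - c * w x)"
    using 1 2 unfolding sturm_system_def by (auto intro!: continuous_intros)
  fix x assume x: "x \<in> {0<..<l}"
  have "((\<lambda>x. u x - c * p x) has_vector_derivative (v x / of_real (\<rho> x) - c * (w x / of_real (\<rho> x)))) (at x)"
    "((\<lambda>x. v x - c * w x) has_vector_derivative (- (\<kappa> * of_real (\<rho> x) * u x) - c * - (\<kappa> * of_real (\<rho> x) * p x))) (at x)"
    by (intro has_vector_derivative_diff has_vector_derivative_mult_right;
        use 1 2 x in \<open>simp add: sturm_system_def\<close>)+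
  then show "((\<lambda>x. u x - c * p x) has_vector_derivative (v x - c * w x) / of_real (\<rho> x)) (at x)"
    "((\<lambda>x. v x - c * w x) has_vector_derivative - (\<kappa> * of_real (\<rho> x) * (u x - c * p x))) (at x)"
    by (simp_all add: algebra_simps diff_divide_distrib)
qed

lemma sturm_systemI:
  assumes "\<And>x. x \<in> {0..l} \<Longrightarrow> (u has_vector_derivative v x / of_real (\<rho> x)) (at x within {0..l})"
    and "\<And>x. x \<in> {0..l} \<Longrightarrow> (v has_vector_derivative - (\<kappa> * of_real (\<rho> x) * u x)) (at x within {0..l})"
  shows "sturm_system \<rho> l \<kappa> u v"
  unfolding sturm_system_def
proof (intro conjI ballI)
  show "continuous_on {0..l} u" "continuous_on {0..l} v"
    by (rule continuous_on_vector_derivative; fact)+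
  fix x assume x: "x \<in> {0<..<l}"
  then have "x \<in> {0..l}" by auto
  from assms[OF this] at_within_Icc_interior[OF x]
  show "(u has_vector_derivative v x / of_real (\<rho> x)) (at x)"
    "(v has_vector_derivative - (\<kappa> * of_real (\<rho> x) * u x)) (at x)" by simp_all
qed

section \<open>The regular solution of a tract, \<open>phi\<close> and \<open>G_fun\<close>\<close>

locale tract =
  fixes l :: real and r :: "real \<Rightarrow> real"
  assumes length_pos: "0 < l" and class_A: "class_A l r"
begin

lemma radius_pos: "x \<in> {0..l} \<Longrightarrow> 0 < r x"
  using class_A by (simp add: class_A_def)

lemma radius_deriv: "x \<in> {0..l} \<Longrightarrow> (r has_vector_derivative tract_deriv l r x) (at x within {0..l})"
  using class_A by (intro has_vector_derivative_tract_deriv) (auto simp: class_A_def)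

lemma cont_radius: "continuous_on {0..l} r"
  by (rule continuous_on_vector_derivative[OF radius_deriv])

lemma cont_radius_deriv: "continuous_on {0..l} (tract_deriv l r)"
  using class_A by (simp add: class_A_def)

sublocale sturm_weight "\<lambda>x. (r x)\<^sup>2" l
proof
  show "0 < (r x)\<^sup>2" if "x \<in> {0..l}" for x using radius_pos[OF that] by simp
qed (use length_pos in \<open>auto intro!: continuous_intros cont_radius\<close>)

lemma ends: "0 \<in> {0..l}" "l \<in> {0..l}" "0 < r 0" "0 < r l"
  using length_pos radius_pos by auto

text \<open>The regular solution with value 1 and flux 0 at x = 0, and its flux r^2 u'. Both depend
  on k only through k^2, which later allows passing from k to -k.\<close>

abbreviation uu :: "complex \<Rightarrow> real \<Rightarrow> complex" where "uu k \<equiv> sturm_u (\<lambda>x. (r x)\<^sup>2) (k\<^sup>2)"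
abbreviation vv :: "complex \<Rightarrow> real \<Rightarrow> complex" where "vv k \<equiv> sturm_v (\<lambda>x. (r x)\<^sup>2) (k\<^sup>2)"

lemma radius_real_deriv: "x \<in> {0..l} \<Longrightarrow> (r has_real_derivative tract_deriv l r x) (at x within {0..l})"
  using radius_deriv by (simp add: has_real_derivative_iff_has_vector_derivative)

lemma inverse_radius_deriv:
  assumes "x \<in> {0..l}"
  shows "((\<lambda>x. 1 / r x) has_real_derivative - (tract_deriv l r x / (r x)\<^sup>2)) (at x within {0..l})"
  using DERIV_inverse'[OF radius_real_deriv[OF assms]] radius_pos[OF assms]
  by (simp add: field_simps power2_eq_square)

lemma of_real_radius_deriv:
  "x \<in> {0..l} \<Longrightarrow> ((\<lambda>x. complex_of_real (r x)) has_vector_derivative of_real (tract_deriv l r x)) (at x within {0..l})"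
  by (intro has_vector_derivative_of_real radius_real_deriv)

lemma regular_deriv:
  assumes x: "x \<in> {0..l}"
  shows "((\<lambda>x. of_real (r x) * uu k x / of_real (r 0)) has_vector_derivative
    (of_real (tract_deriv l r x) * uu k x + vv k x / of_real (r x)) / of_real (r 0)) (at x within {0..l})"
proof -
  have rx: "r x \<noteq> 0" using radius_pos[OF x] by simp
  show ?thesis
    by (rule derivative_eq_intros refl radius_real_deriv[OF x] sturm_u_deriv[OF x])+ (use rx in \<open>simp add: field_simps power2_eq_square\<close>)
qed

text \<open>For y = r u / r(0) one has y' = (r' u + v / r) / r(0). In y'' the terms r' u' and v
  (1/r)' cancel and leave (r'' u - k^2 r u) / r(0), so the equation holds wherever r'' exists.
  Writing v / r as a product makes y' absolutely continuous by the product rule for such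
  functions.\<close>

lemma phi_solution_regular:
  "phi_solution l r k (\<lambda>x\<in>{0..l}. of_real (r x) * uu k x / of_real (r 0))"
proof -
  define y where "y = (\<lambda>x. of_real (r x) * uu k x / of_real (r 0))"
  define ir where "ir = (\<lambda>x. 1 / r x)"
  define y1 where "y1 = (\<lambda>x. (of_real (tract_deriv l r x) * uu k x + vv k x * of_real (ir x)) / of_real (r 0))"
  have der: "(restrict y {0..l} has_vector_derivative y1 x) (at x within {0..l})" if "x \<in> {0..l}" for x
    using has_vector_derivative_transform[OF that _ regular_deriv[OF that, of k], of "restrict y {0..l}"]
    by (simp add: y1_def y_def ir_def)
  have td: "tract_deriv l (restrict y {0..l}) x = y1 x" if "x \<in> {0..l}" for x
    by (rule tract_deriv_eqI[OF length_pos that der[OF that]])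
  have AC_r': "abs_continuous_fun_on 0 l (\<lambda>x. complex_of_real (tract_deriv l r x))"
    using class_A by (intro abs_continuous_fun_on_of_real) (simp add: class_A_def)
  have rnz: "x \<in> {0..l} \<Longrightarrow> complex_of_real (r x) \<noteq> 0" for x using radius_pos[of x] by simp
  have AC_u: "abs_continuous_fun_on 0 l (uu k)"
  proof (rule abs_continuous_fun_on_C1[OF sturm_u_deriv])
    show "continuous_on {0..l} (\<lambda>x. vv k x / complex_of_real ((r x)\<^sup>2))"
      using rnz by (intro continuous_intros cont_radius continuous_on_vector_derivative[OF sturm_v_deriv]) auto
  qed
  have AC_v: "abs_continuous_fun_on 0 l (vv k)"
  proof (rule abs_continuous_fun_on_C1[OF sturm_v_deriv])
    show "continuous_on {0..l} (\<lambda>x. - (k\<^sup>2 * complex_of_real ((r x)\<^sup>2) * uu k x))"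
      by (intro continuous_intros cont_radius continuous_on_vector_derivative[OF sturm_u_deriv])
  qed
  have AC_inv: "abs_continuous_fun_on 0 l (\<lambda>x. complex_of_real (ir x))"
    unfolding ir_def
  proof (intro abs_continuous_fun_on_of_real abs_continuous_fun_on_C1)
    show "((\<lambda>x. 1 / r x) has_vector_derivative - (tract_deriv l r x / (r x)\<^sup>2)) (at x within {0..l})"
      if "x \<in> {0..l}" for x
      using inverse_radius_deriv[OF that] by (simp only: has_real_derivative_iff_has_vector_derivative)
    show "continuous_on {0..l} (\<lambda>x. - (tract_deriv l r x / (r x)\<^sup>2))"
      using rnz by (intro continuous_intros cont_radius cont_radius_deriv) auto
  qed
  have AC_const: "abs_continuous_fun_on 0 l (\<lambda>x. 1 / complex_of_real (r 0))"
    by (rule abs_continuous_fun_on_lipschitz[of _ _ _ 0]) simp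
  have "abs_continuous_fun_on 0 l (\<lambda>x. (of_real (tract_deriv l r x) * uu k x + vv k x * of_real (ir x)) * (1 / of_real (r 0)))"
    by (intro abs_continuous_fun_on_mult abs_continuous_fun_on_add AC_r' AC_u AC_v AC_inv AC_const)
  then have AC: "abs_continuous_fun_on 0 l (tract_deriv l (restrict y {0..l}))"
    by (rule abs_continuous_fun_on_cong) (simp add: td y1_def)
  have ae: "AE x in lebesgue. x \<in> {0<..<l} \<longrightarrow> tract_deriv l r differentiable (at x)"
    using class_A by (simp add: class_A_def)
  have "AE x in lebesgue. x \<in> {0<..<l} \<longrightarrow>
        (\<exists>d. (tract_deriv l (restrict y {0..l}) has_vector_derivative d) (at x) \<and>
             - d + of_real (potential l r x) * restrict y {0..l} x = k\<^sup>2 * restrict y {0..l} x)"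
    using ae
  proof eventually_elim
    case (elim x)
    show ?case
    proof
      assume x: "x \<in> {0<..<l}"
      then have xl: "x \<in> {0..l}" by auto
      define r2 where "r2 = vector_derivative (tract_deriv l r) (at x)"
      have d2: "(tract_deriv l r has_real_derivative r2) (at x)"
        using elim x by (simp add: r2_def has_real_derivative_iff_has_vector_derivative vector_derivative_works)
      have ders: "(ir has_real_derivative - (tract_deriv l r x / (r x)\<^sup>2)) (at x)"
        "(uu k has_vector_derivative vv k x / of_real ((r x)\<^sup>2)) (at x)"
        "(vv k has_vector_derivative - (k\<^sup>2 * of_real ((r x)\<^sup>2) * uu k x)) (at x)"
        using inverse_radius_deriv[OF xl] sturm_u_deriv[OF xl] sturm_v_deriv[OF xl]
          at_within_Icc_interior[OF x] by (simp_all add: ir_def)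
      define d where "d = (of_real r2 * uu k x - k\<^sup>2 * of_real (r x) * uu k x) / of_real (r 0)"
      have "(y1 has_vector_derivative d) (at x)"
        unfolding y1_def d_def by (rule derivative_eq_intros refl d2 ders)+ (use rnz[OF xl] ends in \<open>simp add: ir_def field_simps power2_eq_square\<close>)
      then have "(tract_deriv l (restrict y {0..l}) has_vector_derivative d) (at x)"
        by (rule has_vector_derivative_transform_within_open[where S = "{0<..<l}"])
           (use x in \<open>auto simp: td\<close>)
      moreover have "- d + of_real (potential l r x) * restrict y {0..l} x = k\<^sup>2 * restrict y {0..l} x"
        using rnz[OF xl] xl ends
        by (simp add: d_def potential_def y_def field_simps flip: r2_def)
      ultimately show "\<exists>d. (tract_deriv l (restrict y {0..l}) has_vector_derivative d) (at x) \<and>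
             - d + of_real (potential l r x) * restrict y {0..l} x = k\<^sup>2 * restrict y {0..l} x"
        by blast
    qed
  qed
  moreover have "restrict y {0..l} differentiable_on {0..l}"
    unfolding differentiable_on_def using der by (blast intro: differentiableI_vector)
  moreover have "restrict y {0..l} 0 = 1"
    using ends by (simp add: y_def sturm_uv_at_0)
  moreover have "tract_deriv l (restrict y {0..l}) 0 = of_real (tract_deriv l r 0 / r 0)"
    using td[OF ends(1)] by (simp add: y1_def sturm_uv_at_0)
  ultimately show ?thesis
    using AC unfolding phi_solution_def y_def[symmetric] by (intro conjI restrict_extensional)
qed

text \<open>The quasi-Wronskian \<open>r y' - r' y\<close> is absolutely continuous although the potential is merely
  integrable; it reduces the equation to a system with continuous coefficients.\<close>

lemma phi_solution_eq:
  assumes sol: "phi_solution l r k y" and x: "x \<in> {0..l}"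
  shows "y x = of_real (r x) * uu k x / of_real (r 0)"
proof -
  define y' where "y' = tract_deriv l y"
  have AC_y': "abs_continuous_fun_on 0 l y'"
    and ae: "AE x in lebesgue. x \<in> {0<..<l} \<longrightarrow>
        (\<exists>d. (y' has_vector_derivative d) (at x) \<and> - d + of_real (potential l r x) * y x = k ^ 2 * y x)"
    and y0: "y 0 = 1" "y' 0 = of_real (tract_deriv l r 0 / r 0)"
    and diff: "y differentiable_on {0..l}"
    using sol by (simp_all add: phi_solution_def y'_def)
  have der: "(y has_vector_derivative y' x) (at x within {0..l})" if "x \<in> {0..l}" for x
    unfolding y'_def by (rule has_vector_derivative_tract_deriv[OF diff that])
  have cont_y: "continuous_on {0..l} y" by (rule continuous_on_vector_derivative[OF der])
  have rnz: "x \<in> {0..l} \<Longrightarrow> complex_of_real (r x) \<noteq> 0" for x using radius_pos[of x] by simp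
  have cont_ry: "continuous_on {0..l} (\<lambda>x. of_real (r x) * y x)"
    by (intro continuous_intros cont_radius cont_y)
  define I where "I = (\<lambda>x. integral {0..x} (\<lambda>t. of_real (r t) * y t))"
  have der_I: "(I has_vector_derivative of_real (r x) * y x) (at x within {0..l})" if "x \<in> {0..l}" for x
    unfolding I_def by (rule integral_has_vector_derivative[OF cont_ry that])
  \<comment> \<open>The equation gives r y'' - r'' y = - k^2 r y almost everywhere, so adding k^2
    times the integral of r y makes the derivative vanish. Moreover Z(0) = 0, because y'(0) = r'(0)
    / r(0) and y(0) = 1.\<close>
  define Z where "Z = (\<lambda>x. of_real (r x) * y' x - of_real (tract_deriv l r x) * y x + k\<^sup>2 * I x)"
  have AC_r': "abs_continuous_fun_on 0 l (\<lambda>x. complex_of_real (tract_deriv l r x))"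
    using class_A by (intro abs_continuous_fun_on_of_real) (simp add: class_A_def)
  have AC_r: "abs_continuous_fun_on 0 l (\<lambda>x. complex_of_real (r x))"
    by (rule abs_continuous_fun_on_C1[OF of_real_radius_deriv]) (auto intro!: continuous_intros cont_radius_deriv)
  have AC_y: "abs_continuous_fun_on 0 l y"
    by (rule abs_continuous_fun_on_C1[OF der]) (auto intro: abs_continuous_fun_on_imp_continuous AC_y')
  have AC_I: "abs_continuous_fun_on 0 l I"
    by (rule abs_continuous_fun_on_C1[OF der_I cont_ry])
  have AC_const: "abs_continuous_fun_on 0 l (\<lambda>x. k\<^sup>2)"
    by (rule abs_continuous_fun_on_lipschitz[of _ _ _ 0]) simp
  have AC_Z: "abs_continuous_fun_on 0 l Z"
    unfolding Z_def by (intro abs_continuous_fun_on_mult abs_continuous_fun_on_add abs_continuous_fun_on_diff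
      AC_r AC_y' AC_r' AC_y AC_I AC_const)
  have "AE x in lebesgue. x \<in> {0<..<l} \<longrightarrow> tract_deriv l r differentiable (at x)"
    using class_A by (simp add: class_A_def)
  with ae have "AE x in lebesgue. x \<in> {0<..<l} \<longrightarrow> (Z has_vector_derivative 0) (at x)"
  proof eventually_elim
    case (elim x)
    show ?case
    proof
      assume x: "x \<in> {0<..<l}"
      then have xl: "x \<in> {0..l}" by auto
      define r2 where "r2 = vector_derivative (tract_deriv l r) (at x)"
      have d2: "(tract_deriv l r has_real_derivative r2) (at x)"
        using elim x by (simp add: r2_def has_real_derivative_iff_has_vector_derivative vector_derivative_works)
      have ders: "(r has_real_derivative tract_deriv l r x) (at x)"
        "(y has_vector_derivative y' x) (at x)" "(I has_vector_derivative of_real (r x) * y x) (at x)"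
        using radius_real_deriv[OF xl] der[OF xl] der_I[OF xl]
          at_within_Icc_interior[OF x] by simp_all
      obtain d where d: "(y' has_vector_derivative d) (at x)"
        "- d + of_real (potential l r x) * y x = k ^ 2 * y x"
        using elim x by blast
      have "d = of_real (potential l r x) * y x - k\<^sup>2 * y x" using d(2) by (simp add: algebra_simps)
      then have rd: "of_real (r x) * d = of_real r2 * y x - k\<^sup>2 * of_real (r x) * y x"
        using rnz[OF xl] by (simp add: potential_def field_simps flip: r2_def)
      show "(Z has_vector_derivative 0) (at x)"
        unfolding Z_def
        by (rule derivative_eq_intros refl d2 d(1) ders)+ (use rd in \<open>simp add: algebra_simps\<close>)
    qed
  qed
  then have "Z x = Z 0" if "x \<in> {0..l}" for x
    by (intro abs_continuous_zero_derivative[OF AC_Z _ that])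
  moreover have "Z 0 = 0"
    using ends y0 by (simp add: Z_def I_def)
  ultimately have Z0: "of_real (r x) * y' x - of_real (tract_deriv l r x) * y x = - k\<^sup>2 * I x" if "x \<in> {0..l}" for x
    using that by (simp add: Z_def eq_neg_iff_add_eq_0)
  define ir where "ir = (\<lambda>x. 1 / r x)"
  \<comment> \<open>The flux r^2 (y / r)' equals r y' - r' y, which is now known to be - k^2 I.
    Hence y / r solves the same system as \<open>uu k\<close>, with initial value 1 / r(0) and
    initial flux 0.\<close>
  have sys: "sturm_system (\<lambda>x. (r x)\<^sup>2) l (k\<^sup>2) (\<lambda>x. y x * of_real (ir x)) (\<lambda>x. - k\<^sup>2 * I x)"
  proof (rule sturm_systemI)
    fix x assume x: "x \<in> {0..l}"
    have "((\<lambda>x. y x * of_real (ir x)) has_vector_derivative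
       (of_real (r x) * y' x - of_real (tract_deriv l r x) * y x) / of_real ((r x)\<^sup>2)) (at x within {0..l})"
      by (rule derivative_eq_intros refl der[OF x] inverse_radius_deriv[OF x, folded ir_def])+ (use rnz[OF x] in \<open>simp add: ir_def field_simps power2_eq_square\<close>)
    then show "((\<lambda>x. y x * of_real (ir x)) has_vector_derivative - k\<^sup>2 * I x / of_real ((r x)\<^sup>2)) (at x within {0..l})"
      unfolding Z0[OF x] .
    show "((\<lambda>x. - k\<^sup>2 * I x) has_vector_derivative - (k\<^sup>2 * of_real ((r x)\<^sup>2) * (y x * of_real (ir x)))) (at x within {0..l})"
      by (rule derivative_eq_intros refl der_I[OF x])+ (use rnz[OF x] in \<open>simp add: ir_def field_simps power2_eq_square\<close>)
  qed
  have "y x * of_real (ir x) - 1 / of_real (r 0) * uu k x = 0 \<and> - k\<^sup>2 * I x - 1 / of_real (r 0) * vv k x = 0"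
    by (rule sturm_system_unique[OF sturm_system_diff[OF sys sturm_system_uv] cont_weight weight_pos ends(1) _ _ x])
       (use y0 in \<open>simp_all add: ir_def sturm_uv_at_0 I_def\<close>)
  then show ?thesis using rnz[OF x] by (simp add: ir_def field_simps)
qed

lemma phi_eq: "phi l r k = (\<lambda>x\<in>{0..l}. of_real (r x) * uu k x / of_real (r 0))"
  unfolding phi_def
proof (rule the_equality, rule phi_solution_regular)
  fix y assume y: "phi_solution l r k y"
  have "y \<in> extensional {0..l}" using y by (simp add: phi_solution_def)
  then show "y = (\<lambda>x\<in>{0..l}. of_real (r x) * uu k x / of_real (r 0))"
    by (rule extensionalityI) (auto simp: phi_solution_eq[OF y])
qed

text \<open>The terms with r'(l) cancel, because phi' - (r'/r) phi at l is vv / (r(0) r(l)). What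
  remains involves only the end radii, the impedance and the regular solution.\<close>

lemma G_fun_eq:
  "G_fun l r k = - ((\<i> * k * (of_real (r l))\<^sup>2 * uu k l + impedance (r l) k * vv k l) / of_real (r 0 * r l))"
proof -
  have "(phi l r k has_vector_derivative (of_real (tract_deriv l r l) * uu k l + vv k l / of_real (r l)) / of_real (r 0)) (at l within {0..l})"
    unfolding phi_eq
    by (rule has_vector_derivative_transform[OF ends(2) _ regular_deriv[OF ends(2)]]) simp
  then have "tract_deriv l (phi l r k) l = (of_real (tract_deriv l r l) * uu k l + vv k l / of_real (r l)) / of_real (r 0)"
    by (rule tract_deriv_eqI[OF length_pos ends(2)])
  moreover have "phi l r k l = of_real (r l) * uu k l / of_real (r 0)"
    using ends(2) by (simp add: phi_eq)
  ultimately have "G_fun l r k = (of_real (r l) * uu k l / of_real (r 0)) *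
      (of_real (tract_deriv l r l / r l) * impedance (r l) k - \<i> * k)
      - (of_real (tract_deriv l r l) * uu k l + vv k l / of_real (r l)) / of_real (r 0) * impedance (r l) k"
    by (simp only: G_fun_def)
  also have "\<dots> = - ((\<i> * k * (of_real (r l))\<^sup>2 * uu k l + impedance (r l) k * vv k l) / of_real (r 0 * r l))"
    using ends(3,4) by (simp add: field_simps) (simp add: power2_eq_square)
  finally show ?thesis .
qed

section \<open>Existence, uniqueness and lip value of the pressure\<close>

lemma pressure_solution_system:
  assumes "pressure_solution c mu l r k p"
  shows "sturm_system (\<lambda>x. (r x)\<^sup>2) l (k\<^sup>2) p (\<lambda>x. of_real ((r x)\<^sup>2) * tract_deriv l p x)"
  unfolding sturm_system_def
proof (intro conjI ballI)
  have p: "p differentiable_on {0..l}" "continuous_on {0..l} (tract_deriv l p)"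
    "\<And>x. x \<in> {0<..<l} \<Longrightarrow> ((\<lambda>x. of_real (r x ^ 2) * tract_deriv l p x) has_vector_derivative
                       - (k ^ 2 * of_real (r x ^ 2) * p x)) (at x)"
    using assms by (auto simp: pressure_solution_def)
  show "continuous_on {0..l} p" by (rule differentiable_imp_continuous_on[OF p(1)])
  show "continuous_on {0..l} (\<lambda>x. of_real ((r x)\<^sup>2) * tract_deriv l p x)"
    by (intro continuous_intros p cont_radius)
  fix x assume x: "x \<in> {0<..<l}"
  then have xl: "x \<in> {0..l}" by auto
  show "(p has_vector_derivative of_real ((r x)\<^sup>2) * tract_deriv l p x / of_real ((r x)\<^sup>2)) (at x)"
    using has_vector_derivative_tract_deriv[OF p(1) xl] at_within_Icc_interior[OF x] radius_pos[OF xl] by simp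
  show "((\<lambda>x. of_real ((r x)\<^sup>2) * tract_deriv l p x) has_vector_derivative - (k\<^sup>2 * of_real ((r x)\<^sup>2) * p x)) (at x)"
    by (rule p(3)[OF x])
qed

lemma pressure_solutionI:
  assumes z: "impedance (r l) k \<noteq> 0"
    and u: "\<And>x. x \<in> {0..l} \<Longrightarrow> (u has_vector_derivative v x / of_real ((r x)\<^sup>2)) (at x within {0..l})"
    and v: "\<And>x. x \<in> {0..l} \<Longrightarrow> (v has_vector_derivative - (k\<^sup>2 * of_real ((r x)\<^sup>2) * u x)) (at x within {0..l})"
    and v0: "v 0 = - (\<i> * k * of_real c * of_real mu / of_real pi)"
    and vl: "v l + \<i> * k / impedance (r l) k * of_real ((r l)\<^sup>2) * u l = 0"
  shows "pressure_solution c mu l r k (restrict u {0..l})"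
proof -
  have der: "(restrict u {0..l} has_vector_derivative v x / of_real ((r x)\<^sup>2)) (at x within {0..l})" if "x \<in> {0..l}" for x
    by (rule has_vector_derivative_transform[OF that _ u[OF that]]) simp
  have td: "tract_deriv l (restrict u {0..l}) x = v x / of_real ((r x)\<^sup>2)" if "x \<in> {0..l}" for x
    by (rule tract_deriv_eqI[OF length_pos that der[OF that]])
  have rnz: "x \<in> {0..l} \<Longrightarrow> complex_of_real (r x) \<noteq> 0" for x using radius_pos[of x] by simp
  have "continuous_on {0..l} (\<lambda>x. v x / of_real ((r x)\<^sup>2))"
    using rnz by (intro continuous_intros cont_radius continuous_on_vector_derivative[OF v]) auto
  then have cont: "continuous_on {0..l} (tract_deriv l (restrict u {0..l}))"
    by (rule continuous_on_eq) (simp add: td)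
  have flux: "((\<lambda>x. of_real (r x ^ 2) * tract_deriv l (restrict u {0..l}) x) has_vector_derivative
                       - (k ^ 2 * of_real (r x ^ 2) * restrict u {0..l} x)) (at x)" if x: "x \<in> {0<..<l}" for x
  proof -
    have xl: "x \<in> {0..l}" using x by auto
    have "(v has_vector_derivative - (k ^ 2 * of_real (r x ^ 2) * restrict u {0..l} x)) (at x)"
      using v[OF xl] at_within_Icc_interior[OF x] xl by simp
    then show ?thesis
      by (rule has_vector_derivative_transform_within_open[where S = "{0<..<l}"])
         (use x rnz in \<open>auto simp: td\<close>)
  qed
  have "restrict u {0..l} differentiable_on {0..l}"
    unfolding differentiable_on_def using der by (blast intro: differentiableI_vector)
  moreover have "tract_deriv l (restrict u {0..l}) 0 = - (\<i> * k * of_real c * of_real mu / of_real (pi * r 0 ^ 2))"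
    using td[OF ends(1)] v0 ends(3) by (simp add: field_simps)
  moreover have "tract_deriv l (restrict u {0..l}) l + \<i> * k / impedance (r l) k * restrict u {0..l} l = 0"
  proof -
    have "v l = - (\<i> * k / impedance (r l) k * of_real ((r l)\<^sup>2) * u l)"
      using vl by (simp add: eq_neg_iff_add_eq_0)
    then have "tract_deriv l (restrict u {0..l}) l = - (\<i> * k / impedance (r l) k * u l)"
      using ends unfolding td[OF ends(2)] by simp
    then show ?thesis using ends by simp
  qed
  ultimately show ?thesis
    unfolding pressure_solution_def using z cont flux by simp
qed

text \<open>\<open>G_fun\<close> is, up to a nonvanishing factor, the residual of the regular
  solution in the lip condition. In this guise it enters both the construction of a pressure and the
  Wronskian formula.\<close>

lemma impedance_condition:
  assumes "impedance (r l) k \<noteq> 0"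
  shows "vv k l + \<i> * k / impedance (r l) k * of_real ((r l)\<^sup>2) * uu k l
     = - (G_fun l r k * of_real (r 0 * r l) / impedance (r l) k)"
  using assms ends(3,4) by (simp add: G_fun_eq field_simps)

lemma pressure_solution_exists:
  assumes k: "k \<noteq> 0" and z: "impedance (r l) k \<noteq> 0" and G: "G_fun l r k \<noteq> 0"
  shows "\<exists>p. pressure_solution c mu l r k p"
proof -
  interpret dual: sturm_weight "\<lambda>x. 1 / (r x)\<^sup>2" l
  proof
    show "continuous_on {0..l} (\<lambda>x. 1 / (r x)\<^sup>2)"
      using weight_pos by (intro continuous_intros cont_radius) force
    show "0 < 1 / (r x)\<^sup>2" if "x \<in> {0..l}" for x using radius_pos[OF that] by simp
  qed (use length_pos in auto)
  \<comment> \<open>A second solution, with value 0 and flux 1 at x = 0. Exchanging u and v replaces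
    the weight by its reciprocal, so the regular solution for the weight 1 / r^2 supplies it after
    division by - k^2.\<close>
  define u2 where "u2 = (\<lambda>x. - sturm_v (\<lambda>x. 1 / (r x)\<^sup>2) (k\<^sup>2) x / k\<^sup>2)"
  define v2 where "v2 = sturm_u (\<lambda>x. 1 / (r x)\<^sup>2) (k\<^sup>2)"
  have u2: "(u2 has_vector_derivative v2 x / of_real ((r x)\<^sup>2)) (at x within {0..l})" if "x \<in> {0..l}" for x
    unfolding u2_def v2_def using dual.sturm_v_deriv[OF that, of "k\<^sup>2"] k
    by (auto intro!: derivative_eq_intros)
  have v2: "(v2 has_vector_derivative - (k\<^sup>2 * of_real ((r x)\<^sup>2) * u2 x)) (at x within {0..l})" if "x \<in> {0..l}" for x
    using dual.sturm_u_deriv[OF that, of "k\<^sup>2"] k unfolding u2_def v2_def by (simp add: field_simps)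
  \<comment> \<open>In the ansatz a u + b u2 the inlet condition fixes b, since only u2 carries flux
    at 0; then a is chosen to cancel the residual R at the lips.\<close>
  define b where "b = - (\<i> * k * of_real c * of_real mu / of_real pi)"
  define z where "z = impedance (r l) k"
  define R where "R = (\<lambda>u v. v + \<i> * k / z * of_real ((r l)\<^sup>2) * u)"
  define a where "a = - b * R (u2 l) (v2 l) / R (uu k l) (vv k l)"
  have R: "R (uu k l) (vv k l) \<noteq> 0"
    using impedance_condition[OF z] G z ends unfolding R_def z_def by simp
  have "pressure_solution c mu l r k (restrict (\<lambda>x. a * uu k x + b * u2 x) {0..l})"
  proof (rule pressure_solutionI[OF z, where v = "\<lambda>x. a * vv k x + b * v2 x"])
    fix x assume x: "x \<in> {0..l}"
    show "((\<lambda>x. a * uu k x + b * u2 x) has_vector_derivative (a * vv k x + b * v2 x) / of_real ((r x)\<^sup>2)) (at x within {0..l})"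
      by (rule derivative_eq_intros refl sturm_u_deriv[OF x] u2[OF x])+ (simp add: add_divide_distrib)
    show "((\<lambda>x. a * vv k x + b * v2 x) has_vector_derivative - (k\<^sup>2 * of_real ((r x)\<^sup>2) * (a * uu k x + b * u2 x))) (at x within {0..l})"
      by (rule derivative_eq_intros refl sturm_v_deriv[OF x] v2[OF x])+ (simp add: algebra_simps)
  next
    show "a * vv k 0 + b * v2 0 = - (\<i> * k * of_real c * of_real mu / of_real pi)"
      by (simp add: sturm_uv_at_0 v2_def dual.sturm_uv_at_0 b_def)
    have "a * R (uu k l) (vv k l) + b * R (u2 l) (v2 l) = 0"
      using R by (simp add: a_def)
    then show "a * vv k l + b * v2 l + \<i> * k / impedance (r l) k * of_real ((r l)\<^sup>2) * (a * uu k l + b * u2 l) = 0"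
      by (simp add: R_def algebra_simps flip: z_def)
  qed
  then show ?thesis by blast
qed

lemma pressure_solution_flux:
  assumes "pressure_solution c mu l r k p"
  shows "of_real ((r 0)\<^sup>2) * tract_deriv l p 0 = - (\<i> * k * of_real c * of_real mu / of_real pi)"
    and "of_real ((r l)\<^sup>2) * tract_deriv l p l = - (\<i> * k / impedance (r l) k * of_real ((r l)\<^sup>2) * p l)"
proof -
  have "tract_deriv l p 0 = - (\<i> * k * of_real c * of_real mu / of_real (pi * r 0 ^ 2))"
    "tract_deriv l p l = - (\<i> * k / impedance (r l) k * p l)"
    using assms by (auto simp: pressure_solution_def eq_neg_iff_add_eq_0)
  then show "of_real ((r 0)\<^sup>2) * tract_deriv l p 0 = - (\<i> * k * of_real c * of_real mu / of_real pi)"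
    "of_real ((r l)\<^sup>2) * tract_deriv l p l = - (\<i> * k / impedance (r l) k * of_real ((r l)\<^sup>2) * p l)"
    using ends(3) by (auto simp: field_simps)
qed

lemma pressure_solution_lip:
  assumes sol: "pressure_solution c mu l r k p" and G: "G_fun l r k \<noteq> 0"
  shows "p l = - (\<i> * k * of_real c * of_real mu * impedance (r l) k / (of_real (pi * r 0 * r l) * G_fun l r k))"
proof -
  have z: "impedance (r l) k \<noteq> 0" using sol by (simp add: pressure_solution_def)
  \<comment> \<open>At 0 only the prescribed inlet flux survives, since the regular solution has
    value 1 and flux 0 there. At l the lip condition turns the left side into p(l) times the
    residual of the regular solution.\<close>
  have "p l * vv k l - (of_real ((r l)\<^sup>2) * tract_deriv l p l) * uu k l
      = p 0 * vv k 0 - (of_real ((r 0)\<^sup>2) * tract_deriv l p 0) * uu k 0"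
    by (rule sturm_wronskian[OF pressure_solution_system[OF sol] sturm_system_uv weight_pos ends(2)])
  then have "p l * (vv k l + \<i> * k / impedance (r l) k * of_real ((r l)\<^sup>2) * uu k l) = \<i> * k * of_real c * of_real mu / of_real pi"
    unfolding pressure_solution_flux[OF sol] sturm_uv_at_0 by (simp add: algebra_simps)
  then have "p l * (G_fun l r k * of_real (r 0 * r l) / impedance (r l) k) = - (\<i> * k * of_real c * of_real mu / of_real pi)"
    unfolding impedance_condition[OF z] by (metis minus_minus mult_minus_right)
  moreover have "G_fun l r k * of_real (r 0 * r l) / impedance (r l) k \<noteq> 0"
    using z G ends(3,4) by simp
  ultimately have "p l = - (\<i> * k * of_real c * of_real mu / of_real pi) / (G_fun l r k * of_real (r 0 * r l) / impedance (r l) k)"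
    by (metis nonzero_mult_div_cancel_right)
  then show ?thesis by (simp add: mult_ac)
qed

text \<open>The explicit lip value forces agreement at l, the lip condition then forces agreement of
  the fluxes there, and uniqueness for the system propagates this back along the interval.\<close>

lemma pressure_solution_unique:
  assumes 1: "pressure_solution c mu l r k p1" and 2: "pressure_solution c mu l r k p2"
    and G: "G_fun l r k \<noteq> 0"
  shows "p1 = p2"
proof (rule extensionalityI)
  show "p1 \<in> extensional {0..l}" "p2 \<in> extensional {0..l}" using 1 2 by (auto simp: pressure_solution_def)
  fix x assume x: "x \<in> {0..l}"
  have eq: "p1 l = p2 l" using pressure_solution_lip[OF 1 G] pressure_solution_lip[OF 2 G] by simp
  have "p1 x - 1 * p2 x = 0 \<and>
      of_real ((r x)\<^sup>2) * tract_deriv l p1 x - 1 * (of_real ((r x)\<^sup>2) * tract_deriv l p2 x) = 0"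
    by (rule sturm_system_unique[OF sturm_system_diff[OF pressure_solution_system[OF 1] pressure_solution_system[OF 2]]
          cont_weight weight_pos ends(2) _ _ x])
       (use eq in \<open>simp_all add: pressure_solution_flux(2)[OF 1] pressure_solution_flux(2)[OF 2] del: of_real_power\<close>)
  then show "p1 x = p2 x" by simp
qed

end

section \<open>The impedance\<close>

text \<open>Weierstrass approximation by a polynomial. It allows an oscillating or decaying
  exponential to be integrated by parts against a function that is only continuous, at the price of
  a uniform error \<epsilon>.\<close>

lemma C1_approximation:
  fixes h :: "real \<Rightarrow> real"
  assumes "continuous_on {a..b} h" "0 < \<epsilon>"
  obtains g g' where "\<And>x. (g has_real_derivative g' x) (at x)" "continuous_on UNIV g'"
    "\<And>x. x \<in> {a..b} \<Longrightarrow> \<bar>h x - g x\<bar> < \<epsilon>"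
proof -
  obtain g where g: "real_polynomial_function g" "\<And>x. x \<in> {a..b} \<Longrightarrow> \<bar>h x - g x\<bar> < \<epsilon>"
    using Stone_Weierstrass_real_polynomial_function[OF compact_Icc assms] by metis
  obtain g' where g': "real_polynomial_function g'" "\<And>x. (g has_real_derivative g' x) (at x)"
    using has_real_derivative_polynomial_function[OF g(1)] by blast
  have "continuous_on UNIV g'"
    using g'(1) by (intro continuous_on_polymonial_function) (simp add: real_polynomial_function_eq)
  then show thesis using g'(2) g(2) by (intro that[of g g']) auto
qed

section \<open>Semicircle moments and the Bessel and Struve series\<close>

abbreviation semicircle :: "real \<Rightarrow> real" where "semicircle u \<equiv> sqrt (1 - u\<^sup>2)"

definition semicircle_moment :: "nat \<Rightarrow> real" where
  "semicircle_moment n = integral {0..1} (\<lambda>u. u ^ n * semicircle u)"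

lemma semicircle_moment_has_integral:
  "((\<lambda>u. u ^ n * semicircle u) has_integral semicircle_moment n) {0..1}"
  unfolding semicircle_moment_def
  by (intro integrable_integral integrable_continuous_real continuous_intros)

lemma semicircle_deriv:
  assumes "u \<in> {0<..<1}"
  shows "((\<lambda>u. semicircle u) has_real_derivative - (u / semicircle u)) (at u)"
proof -
  have "0 < 1 - u\<^sup>2" using assms by (simp add: power_less_one_iff abs_square_less_1)
  then show ?thesis
    by (auto intro!: derivative_eq_intros simp: divide_simps)
qed

lemma semicircle_quot:
  assumes "u \<in> {0<..<1}"
  shows "(1 - u\<^sup>2) / semicircle u = semicircle u"
    "u / semicircle u * (1 - u\<^sup>2) = u * semicircle u"
proof -
  have "0 < 1 - u\<^sup>2" using assms by (simp add: power_less_one_iff abs_square_less_1)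
  then show q: "(1 - u\<^sup>2) / semicircle u = semicircle u" by (intro real_div_sqrt) simp
  have "u / semicircle u * (1 - u\<^sup>2) = u * ((1 - u\<^sup>2) / semicircle u)" by simp
  then show "u / semicircle u * (1 - u\<^sup>2) = u * semicircle u" by (simp only: q)
qed

lemma semicircle_moment_0: "semicircle_moment 0 = pi / 4"
proof -
  have "((\<lambda>u. semicircle u) has_integral (1 * sqrt (1 - 1\<^sup>2) + arcsin 1) / 2 - (0 * sqrt (1 - 0\<^sup>2) + arcsin 0) / 2) {0..1}"
  proof (rule fundamental_theorem_of_calculus_interior[of 0 1 "\<lambda>u. (u * semicircle u + arcsin u) / 2"])
    show "continuous_on {0..1} (\<lambda>u::real. (u * semicircle u + arcsin u) / 2)"
      by (auto intro!: continuous_intros)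
    fix u :: real assume u: "u \<in> {0<..<1}"
    have "((\<lambda>u. (u * semicircle u + arcsin u) / 2) has_real_derivative
        (1 * semicircle u + - (u / semicircle u) * u + inverse (semicircle u)) / 2) (at u)"
      by (intro DERIV_cdivide DERIV_add DERIV_mult DERIV_ident semicircle_deriv[OF u] DERIV_arcsin) (use u in auto)
    moreover have "(1 * semicircle u + - (u / semicircle u) * u + inverse (semicircle u)) / 2 = semicircle u"
    proof -
      have "- (u / semicircle u) * u + inverse (semicircle u) = (1 - u\<^sup>2) / semicircle u"
        by (simp add: divide_inverse algebra_simps power2_eq_square)
      then have "- (u / semicircle u) * u + inverse (semicircle u) = semicircle u"
        by (simp only: semicircle_quot(1)[OF u])
      then show ?thesis by (simp only: mult_1 add.assoc) simp
    qed
    ultimately show "((\<lambda>u. (u * semicircle u + arcsin u) / 2) has_vector_derivative semicircle u) (at u)"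
      by (simp only: has_real_derivative_iff_has_vector_derivative)
  qed simp
  then show ?thesis
    using semicircle_moment_has_integral[of 0] by (auto dest: has_integral_unique)
qed

lemma semicircle_moment_1: "semicircle_moment 1 = 1 / 3"
proof -
  have "((\<lambda>u. u ^ 1 * semicircle u) has_integral - ((1 - 1\<^sup>2) * sqrt (1 - 1\<^sup>2) / 3) - - ((1 - 0\<^sup>2) * sqrt (1 - 0\<^sup>2) / 3)) {0..1}"
  proof (rule fundamental_theorem_of_calculus_interior[of 0 1 "\<lambda>u. - ((1 - u\<^sup>2) * semicircle u / 3)"])
    show "continuous_on {0..1} (\<lambda>u::real. - ((1 - u\<^sup>2) * semicircle u / 3))"
      by (auto intro!: continuous_intros)
    fix u :: real assume u: "u \<in> {0<..<1}"
    have "((\<lambda>u. 1 - u\<^sup>2) has_real_derivative - 2 * u) (at u)"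
      by (auto intro!: derivative_eq_intros)
    then have "((\<lambda>u. - ((1 - u\<^sup>2) * semicircle u / 3)) has_real_derivative
        - ((- 2 * u * semicircle u + - (u / semicircle u) * (1 - u\<^sup>2)) / 3)) (at u)"
      by (intro DERIV_minus DERIV_cdivide DERIV_mult semicircle_deriv[OF u])
    moreover have "- ((- 2 * u * semicircle u + - (u / semicircle u) * (1 - u\<^sup>2)) / 3) = u ^ 1 * semicircle u"
    proof -
      have "- (u / semicircle u) * (1 - u\<^sup>2) = - (u * semicircle u)"
        using semicircle_quot(2)[OF u] by (simp only: mult_minus_left)
      then show ?thesis by simp
    qed
    ultimately show "((\<lambda>u. - ((1 - u\<^sup>2) * semicircle u / 3)) has_vector_derivative u ^ 1 * semicircle u) (at u)"
      by (simp only: has_real_derivative_iff_has_vector_derivative)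
  qed simp
  then show ?thesis
    using semicircle_moment_has_integral[of 1] by (auto dest: has_integral_unique)
qed

text \<open>Integrate the derivative of u^(n+1) (1 - u^2)^(3/2), which vanishes at 0 and at 1. The
  power 3/2 is written as (1 - u^2) times the square root.\<close>

lemma semicircle_moment_rec:
  "real (n + 4) * semicircle_moment (n + 2) = real (n + 1) * semicircle_moment n"
proof -
  have "((\<lambda>u. real (n + 1) * (u ^ n * semicircle u) - real (n + 4) * (u ^ (n + 2) * semicircle u)) has_integral
     1 ^ (n + 1) * ((1 - 1\<^sup>2) * sqrt (1 - 1\<^sup>2)) - 0 ^ (n + 1) * ((1 - 0\<^sup>2) * sqrt (1 - 0\<^sup>2))) {0..1}"
  proof (rule fundamental_theorem_of_calculus_interior[of 0 1 "\<lambda>u. u ^ (n + 1) * ((1 - u\<^sup>2) * semicircle u)"])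
    show "continuous_on {0..1} (\<lambda>u::real. u ^ (n + 1) * ((1 - u\<^sup>2) * semicircle u))"
      by (auto intro!: continuous_intros)
    fix u :: real assume u: "u \<in> {0<..<1}"
    have 1: "((\<lambda>u. 1 - u\<^sup>2) has_real_derivative - 2 * u) (at u)"
      by (auto intro!: derivative_eq_intros)
    have 2: "((\<lambda>u. u ^ (n + 1)) has_real_derivative real (n + 1) * u ^ n) (at u)"
      using DERIV_pow[of "n + 1" u] by simp
    have "((\<lambda>u. u ^ (n + 1) * ((1 - u\<^sup>2) * semicircle u)) has_real_derivative
        real (n + 1) * u ^ n * ((1 - u\<^sup>2) * semicircle u) +
        (- 2 * u * semicircle u + - (u / semicircle u) * (1 - u\<^sup>2)) * u ^ (n + 1)) (at u)"
      by (rule DERIV_mult[OF 2 DERIV_mult[OF 1 semicircle_deriv[OF u]]])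
    moreover have "real (n + 1) * u ^ n * ((1 - u\<^sup>2) * semicircle u) +
        (- 2 * u * semicircle u + - (u / semicircle u) * (1 - u\<^sup>2)) * u ^ (n + 1)
      = real (n + 1) * (u ^ n * semicircle u) - real (n + 4) * (u ^ (n + 2) * semicircle u)"
    proof -
      have "- (u / semicircle u) * (1 - u\<^sup>2) = - (u * semicircle u)"
        using semicircle_quot(2)[OF u] by (simp only: mult_minus_left)
      then show ?thesis by (simp add: algebra_simps power2_eq_square)
    qed
    ultimately show "((\<lambda>u. u ^ (n + 1) * ((1 - u\<^sup>2) * semicircle u)) has_vector_derivative real (n + 1) * (u ^ n * semicircle u) - real (n + 4) * (u ^ (n + 2) * semicircle u)) (at u)"
      by (simp only: has_real_derivative_iff_has_vector_derivative)
  qed simp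
  moreover have "((\<lambda>u. real (n + 1) * (u ^ n * semicircle u) - real (n + 4) * (u ^ (n + 2) * semicircle u)) has_integral
     real (n + 1) * semicircle_moment n - real (n + 4) * semicircle_moment (n + 2)) {0..1}"
    by (intro has_integral_diff has_integral_mult_right semicircle_moment_has_integral)
  ultimately show ?thesis by (auto dest: has_integral_unique)
qed

lemma semicircle_moment_bound: "0 \<le> semicircle_moment n" "semicircle_moment n \<le> 1"
proof -
  show "0 \<le> semicircle_moment n"
    by (rule has_integral_nonneg[OF semicircle_moment_has_integral]) (auto simp: power_le_one)
  have "((\<lambda>u::real. 1::real) has_integral 1) {0..1}" using has_integral_const_real[of 1 0 1] by simp
  moreover have "u ^ n * semicircle u \<le> 1 * 1" if "u \<in> {0..1}" for u :: real
    using that by (intro mult_mono) (auto simp: power_le_one)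
  ultimately show "semicircle_moment n \<le> 1"
    by (intro has_integral_le[OF semicircle_moment_has_integral]) auto
qed

text \<open>Up to the sign (-1)^m, the right side is the coefficient of y^(2m) in J_1(2y) / y, and
  4^m / (2m)! comes from the exponential series in 2uy. By the moment recursion both sides have
  successive quotient 1 / ((m+1)(m+2)).\<close>

lemma semicircle_moment_even:
  "4 / pi * (4 ^ m / fact (2 * m) * semicircle_moment (2 * m)) = 1 / (fact m * fact (m + 1))"
proof (induction m)
  case 0
  then show ?case by (simp add: semicircle_moment_0)
next
  case (Suc m)
  define I where "I = semicircle_moment (2 * m)"
  have rec: "semicircle_moment (2 * Suc m) = real (2 * m + 1) / real (2 * m + 4) * I"
    using semicircle_moment_rec[of "2 * m"] by (simp add: I_def field_simps)
  have f: "(fact (2 * Suc m) :: real) = real (2 * m + 2) * real (2 * m + 1) * fact (2 * m)"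
    by (simp add: algebra_simps)
  have "4 / pi * (4 ^ Suc m / fact (2 * Suc m) * semicircle_moment (2 * Suc m))
      = (4 / pi * (4 ^ m / fact (2 * m) * I)) * (4 * (real (2 * m + 1) / real (2 * m + 4)) / (real (2 * m + 2) * real (2 * m + 1)))"
    unfolding rec f power_Suc divide_inverse inverse_mult_distrib by (simp only: mult_ac)
  also have "4 * (real (2 * m + 1) / real (2 * m + 4)) / (real (2 * m + 2) * real (2 * m + 1)) = 1 / (real (m + 2) * real (m + 1))"
    by (simp add: divide_simps) (simp add: algebra_simps)
  also have "4 / pi * (4 ^ m / fact (2 * m) * I) = 1 / (fact m * fact (m + 1))"
    using Suc by (simp add: I_def)
  finally show ?case by (simp add: field_simps)
qed

lemma not_nonpos_Int: "0 < Re z \<Longrightarrow> z \<notin> \<int>\<^sub>\<le>\<^sub>0"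
  by (auto elim!: nonpos_Ints_cases)

text \<open>The counterpart for the Struve function: up to sign, coefficients of y^(2m+1) in H_1(2y)
  / y. The successive quotient 1 / ((m + 3/2)(m + 5/2)) is the functional equation of the two Gamma
  factors, and the start is Gamma(3/2) Gamma(5/2) = 3 pi / 8.\<close>

lemma semicircle_moment_odd:
  "complex_of_real (4 / pi * (2 * 4 ^ m / fact (2 * m + 1) * semicircle_moment (2 * m + 1)))
    = 1 / (Gamma (of_nat m + 3 / 2) * Gamma (of_nat m + 5 / 2))"
proof (induction m)
  case 0
  have half: "(1 / 2 :: complex) \<notin> \<int>\<^sub>\<le>\<^sub>0" "(3 / 2 :: complex) \<notin> \<int>\<^sub>\<le>\<^sub>0"
    by (intro not_nonpos_Int; simp)+
  have 1: "Gamma (3 / 2 :: complex) = 1 / 2 * of_real (sqrt pi)"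
    using Gamma_plus1[OF half(1)] by (simp add: Gamma_one_half_complex)
  have 2: "Gamma (5 / 2 :: complex) = 3 / 2 * (1 / 2 * of_real (sqrt pi))"
    using Gamma_plus1[OF half(2)] by (simp add: 1)
  have "complex_of_real (sqrt pi) * complex_of_real (sqrt pi) = of_real pi"
    by (simp flip: of_real_mult)
  then have g: "Gamma (3 / 2 :: complex) * Gamma (5 / 2) = 3 / 8 * of_real pi"
    by (simp add: 1 2)
  have m1: "semicircle_moment (Suc 0) = 1 / 3" using semicircle_moment_1 by simp
  show ?case by (simp add: g m1)
next
  case (Suc m)
  define I where "I = semicircle_moment (2 * m + 1)"
  define g where "g = Gamma (of_nat m + 3 / 2) * Gamma (of_nat m + 5 / 2 :: complex)"
  have rec: "semicircle_moment (2 * Suc m + 1) = real (2 * m + 2) / real (2 * m + 5) * I"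
    using semicircle_moment_rec[of "2 * m + 1"] by (simp add: I_def field_simps)
  have f: "(fact (2 * Suc m + 1) :: real) = real (2 * m + 3) * real (2 * m + 2) * fact (2 * m + 1)"
    by (simp add: algebra_simps)
  have "4 / pi * (2 * 4 ^ Suc m / fact (2 * Suc m + 1) * semicircle_moment (2 * Suc m + 1))
      = (4 / pi * (2 * 4 ^ m / fact (2 * m + 1) * I)) * (4 * (real (2 * m + 2) / real (2 * m + 5)) / (real (2 * m + 3) * real (2 * m + 2)))"
    unfolding rec f power_Suc divide_inverse inverse_mult_distrib by (simp only: mult_ac)
  also have "4 * (real (2 * m + 2) / real (2 * m + 5)) / (real (2 * m + 3) * real (2 * m + 2)) = 1 / ((real m + 3 / 2) * (real m + 5 / 2))"
    by (simp add: divide_simps) (simp add: algebra_simps)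
  finally have "complex_of_real (4 / pi * (2 * 4 ^ Suc m / fact (2 * Suc m + 1) * semicircle_moment (2 * Suc m + 1)))
     = complex_of_real (4 / pi * (2 * 4 ^ m / fact (2 * m + 1) * I)) * complex_of_real (1 / ((real m + 3 / 2) * (real m + 5 / 2)))"
    by (simp only: of_real_mult)
  also have "\<dots> = 1 / g * (1 / ((of_nat m + 3 / 2) * (of_nat m + 5 / 2)))"
    using Suc by (simp add: I_def g_def)
  also have "\<dots> = 1 / (Gamma (of_nat m + 3 / 2 + 1) * Gamma (of_nat m + 5 / 2 + 1))"
    by (subst (1 2) Gamma_plus1) (auto simp: g_def intro!: not_nonpos_Int)
  also have "of_nat m + 3 / 2 + 1 = (of_nat (Suc m) + 3 / 2 :: complex)" by simp
  also have "of_nat m + 5 / 2 + 1 = (of_nat (Suc m) + 5 / 2 :: complex)" by simp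
  finally show ?case .
qed

text \<open>The Laplace transform of the semicircle density, by which the impedance is \<open>1 - semicircle_transform (a k)\<close>.\<close>

definition semicircle_transform :: "complex \<Rightarrow> complex" where
  "semicircle_transform y = of_real (4 / pi) *
     integral {0..1} (\<lambda>u. exp (- 2 * \<i> * y * of_real u) * of_real (semicircle u))"

definition semicircle_coeff :: "nat \<Rightarrow> complex" where
  "semicircle_coeff n = of_real (4 / pi) * ((- 2 * \<i>) ^ n / fact n * of_real (semicircle_moment n))"

text \<open>The exponential series converges uniformly for u in [0, 1], so it may be integrated term
  by term, and each term contributes one moment.\<close>

lemma semicircle_transform_sums: "(\<lambda>n. semicircle_coeff n * y ^ n) sums semicircle_transform y"
proof -
  define f where "f = (\<lambda>n u. (- 2 * \<i> * y * of_real u) ^ n / fact n * complex_of_real (semicircle u))"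
  have lim: "uniform_limit {0..1} (\<lambda>n u. \<Sum>i<n. f i u) (\<lambda>u. \<Sum>i. f i u) sequentially"
  proof (rule Weierstrass_m_test)
    show "norm (f n u) \<le> (2 * norm y) ^ n / fact n" if "u \<in> {0..1}" for n u
    proof -
      have "norm (f n u) = (2 * norm y) ^ n / fact n * (\<bar>u\<bar> ^ n * \<bar>semicircle u\<bar>)"
        by (simp add: f_def norm_mult norm_divide norm_power power_mult_distrib)
      also have "\<dots> \<le> (2 * norm y) ^ n / fact n * (1 * 1)"
        using that by (intro mult_left_mono mult_mono) (auto simp: power_le_one abs_square_le_1)
      finally show ?thesis by simp
    qed
    show "summable (\<lambda>n. (2 * norm y) ^ n / fact n)"
      using summable_exp[of "2 * norm y"] by (simp add: field_simps)
  qed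
  have eq: "(\<Sum>i. f i u) = exp (- 2 * \<i> * y * of_real u) * of_real (semicircle u)" for u
  proof -
    have "(\<lambda>i. (- 2 * \<i> * y * of_real u) ^ i / fact i) sums exp (- 2 * \<i> * y * of_real u)"
      using exp_converges[of "- 2 * \<i> * y * of_real u"] by (simp add: scaleR_conv_of_real divide_inverse mult.commute)
    from sums_mult2[OF this] show ?thesis by (simp add: f_def sums_iff)
  qed
  have "continuous_on {0..1} (\<lambda>u. \<Sum>i<n. f i u)" for n
    unfolding f_def by (auto intro!: continuous_intros)
  from uniform_limit_integral[OF lim this sequentially_bot]
  obtain I J where IJ: "\<And>n. ((\<lambda>u. \<Sum>i<n. f i u) has_integral I n) {0..1}"
    "((\<lambda>u. \<Sum>i. f i u) has_integral J) {0..1}" "I \<longlonglongrightarrow> J"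
    by blast
  have "(f i has_integral (- 2 * \<i> * y) ^ i / fact i * of_real (semicircle_moment i)) {0..1}" for i
  proof -
    have "f i = (\<lambda>u. (- 2 * \<i> * y) ^ i / fact i * of_real (u ^ i * semicircle u))"
      unfolding f_def power_mult_distrib[of "- 2 * \<i> * y"] of_real_mult of_real_power
      by (simp only: divide_inverse mult_ac)
    then show ?thesis
      by (simp only: has_integral_mult_right[OF has_integral_of_real[OF semicircle_moment_has_integral[of i]]])
  qed
  then have "((\<lambda>u. \<Sum>i<n. f i u) has_integral (\<Sum>i<n. (- 2 * \<i> * y) ^ i / fact i * of_real (semicircle_moment i))) {0..1}" for n
    by (intro has_integral_sum) auto
  then have "I = (\<lambda>n. \<Sum>i<n. (- 2 * \<i> * y) ^ i / fact i * of_real (semicircle_moment i))"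
    by (intro ext has_integral_unique[OF IJ(1)])
  with IJ(3) have "(\<lambda>i. (- 2 * \<i> * y) ^ i / fact i * of_real (semicircle_moment i)) sums J"
    by (simp only: sums_def)
  from sums_mult[OF this, of "of_real (4 / pi)"]
  have "(\<lambda>n. semicircle_coeff n * y ^ n) sums (of_real (4 / pi) * J)"
    unfolding semicircle_coeff_def power_mult_distrib[of "- 2 * \<i>"] divide_inverse by (simp only: mult_ac)
  moreover have "J = integral {0..1} (\<lambda>u. exp (- 2 * \<i> * y * of_real u) * of_real (semicircle u))"
    using IJ(2) unfolding eq by (simp add: integral_unique)
  ultimately show ?thesis by (simp add: semicircle_transform_def)
qed

lemma semicircle_transform_deriv:
  "(semicircle_transform has_field_derivative (\<Sum>n. diffs semicircle_coeff n * y ^ n)) (at y)"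
proof -
  have "semicircle_transform = (\<lambda>y. \<Sum>n. semicircle_coeff n * y ^ n)"
    using semicircle_transform_sums by (auto simp: sums_iff)
  then show ?thesis
    using termdiffs_strong_converges_everywhere[of semicircle_coeff y] semicircle_transform_sums
    by (simp add: sums_iff)
qed

lemma semicircle_transform_entire: "semicircle_transform holomorphic_on S"
  unfolding holomorphic_on_def field_differentiable_def
  using has_field_derivative_at_within[OF semicircle_transform_deriv] by blast

text \<open>The value expresses total mass 1. The derivative is - 2 i times the mean 4 / (3 pi) of
  the density, the origin of the low-frequency constant 8 / (3 pi).\<close>

lemma semicircle_transform_0: "semicircle_transform 0 = 1"
  "(semicircle_transform has_field_derivative - (8 * \<i> / of_real (3 * pi))) (at 0)"
proof -
  have "semicircle_transform 0 = semicircle_coeff 0"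
    using semicircle_transform_sums[of 0] powser_sums_zero_iff[of semicircle_coeff] by simp
  then show "semicircle_transform 0 = 1"
    by (simp add: semicircle_coeff_def semicircle_moment_0)
  have m1: "semicircle_moment (Suc 0) = 1 / 3" using semicircle_moment_1 by simp
  have "(\<Sum>n. diffs semicircle_coeff n * 0 ^ n) = - (8 * \<i> / of_real (3 * pi))"
    unfolding powser_zero by (simp add: diffs_def semicircle_coeff_def m1)
  then show "(semicircle_transform has_field_derivative - (8 * \<i> / of_real (3 * pi))) (at 0)"
    using semicircle_transform_deriv[of 0] by simp
qed

lemma impedance_eq:
  assumes a: "0 < a"
  shows "impedance a k = 1 - semicircle_transform (of_real a * k)"
proof -
  have eq: "1 - bessel_J1 (2 * k * of_real a) / (k * of_real a) + \<i> * (struve_H1 (2 * k * of_real a) / (k * of_real a))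
      = 1 - semicircle_transform (of_real a * k)" if k: "k \<noteq> 0" for k
  proof -
    define y where "y = of_real a * k"
    have y: "y \<noteq> 0" using a k by (simp add: y_def)
    define E where "E = (\<lambda>m. semicircle_coeff (2 * m) * y ^ (2 * m))"
    define H where "H = (\<lambda>m. semicircle_coeff (2 * m + 1) * y ^ (2 * m + 1))"
    have four: "(- 4 :: complex) ^ m = (-1) ^ m * 4 ^ m" for m by (rule power_minus)
    have E: "E m = (-1) ^ m / (fact m * fact (m + 1)) * y ^ (2 * m)" for m
    proof -
      have "semicircle_coeff (2 * m) = (-1) ^ m * complex_of_real (4 / pi * (4 ^ m / fact (2 * m) * semicircle_moment (2 * m)))"
        by (simp add: semicircle_coeff_def power_mult power_mult_distrib four)
      then show ?thesis unfolding E_def semicircle_moment_even by simp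
    qed
    have H: "H m = - \<i> * ((-1) ^ m / (Gamma (of_nat m + 3 / 2) * Gamma (of_nat m + 5 / 2)) * y ^ (2 * m + 1))" for m
    proof -
      have "semicircle_coeff (2 * m + 1) = - \<i> * (-1) ^ m * complex_of_real (4 / pi * (2 * 4 ^ m / fact (2 * m + 1) * semicircle_moment (2 * m + 1)))"
        by (simp add: semicircle_coeff_def power_mult power_mult_distrib four)
      then show ?thesis unfolding H_def semicircle_moment_odd by simp
    qed
    \<comment> \<open>The even and the odd subseries must converge separately before the paired
      series can be split into a Bessel part and a Struve part; \<open>g\<close> stands for either
      parity.\<close>
    have summ: "summable (\<lambda>m. norm (semicircle_coeff (g m) * y ^ g m))" if "\<And>m. g m = 2 * m \<or> g m = 2 * m + 1" for g
    proof (rule summable_comparison_test)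
      show "\<exists>N. \<forall>m\<ge>N. norm (norm (semicircle_coeff (g m) * y ^ g m)) \<le> 4 / pi * (1 + 2 * norm y) * ((4 * (norm y)\<^sup>2) ^ m / fact m)"
      proof (intro exI[of _ 0] allI impI)
        fix m :: nat
        have le: "norm (semicircle_coeff n * y ^ n) \<le> 4 / pi * ((2 * norm y) ^ n / fact m)" if "m \<le> n" for n
        proof -
          have "norm (semicircle_coeff n * y ^ n) = 4 / pi * ((2 * norm y) ^ n * semicircle_moment n / fact n)"
            using semicircle_moment_bound(1)[of n]
            by (simp add: semicircle_coeff_def norm_mult norm_divide norm_power power_mult_distrib)
          also have "\<dots> \<le> 4 / pi * ((2 * norm y) ^ n * 1 / fact m)"
            using that semicircle_moment_bound[of n]
            by (intro mult_left_mono frac_le fact_mono) (auto intro!: mult_left_mono)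
          finally show ?thesis by simp
        qed
        have "(2 * norm y) ^ (2 * m) = (4 * (norm y)\<^sup>2) ^ m"
          by (simp add: power_mult power_mult_distrib)
        then have le0: "norm (semicircle_coeff (2 * m) * y ^ (2 * m)) \<le> 4 / pi * 1 * ((4 * (norm y)\<^sup>2) ^ m / fact m)"
          and le1: "norm (semicircle_coeff (2 * m + 1) * y ^ (2 * m + 1)) \<le> 4 / pi * (2 * norm y) * ((4 * (norm y)\<^sup>2) ^ m / fact m)"
          using le[of "2 * m"] le[of "2 * m + 1"] by (simp_all only: power_add power_one_right) (simp_all add: mult_ac)
        have mono: "4 / pi * b * ((4 * (norm y)\<^sup>2) ^ m / fact m) \<le> 4 / pi * (1 + 2 * norm y) * ((4 * (norm y)\<^sup>2) ^ m / fact m)"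
          if "b \<le> 1 + 2 * norm y" for b
          using that by (intro mult_right_mono mult_left_mono) auto
        have b1: "1 \<le> 1 + 2 * norm y" and b2: "2 * norm y \<le> 1 + 2 * norm y" by simp_all
        show "norm (norm (semicircle_coeff (g m) * y ^ g m)) \<le> 4 / pi * (1 + 2 * norm y) * ((4 * (norm y)\<^sup>2) ^ m / fact m)"
          using that[of m]
        proof
          assume "g m = 2 * m"
          then show ?thesis using order_trans[OF le0 mono[OF b1]] by (simp only: real_norm_def abs_norm_cancel)
        next
          assume "g m = 2 * m + 1"
          then show ?thesis using order_trans[OF le1 mono[OF b2]] by (simp only: real_norm_def abs_norm_cancel)
        qed
      qed
      show "summable (\<lambda>m. 4 / pi * (1 + 2 * norm y) * ((4 * (norm y)\<^sup>2) ^ m / fact m))"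
        using summable_exp[of "4 * (norm y)\<^sup>2"] by (intro summable_mult) (simp add: field_simps)
    qed
    have sE: "summable E" and sH: "summable H"
      unfolding E_def H_def by (rule summable_norm_cancel, rule summ, simp)+
    have "(\<lambda>m. E m + H m) sums semicircle_transform y"
      using sums_group[OF semicircle_transform_sums[of y], of 2]
      by (simp add: E_def H_def mult.commute numeral_2_eq_2)
    with sums_add[OF summable_sums[OF sE] summable_sums[OF sH]]
    have W: "semicircle_transform y = suminf E + suminf H" by (rule sums_unique2[symmetric])
    have "bessel_J1 (2 * k * of_real a) = (\<Sum>m. E m * y)"
      unfolding bessel_J1_def by (intro suminf_cong) (simp add: E y_def mult_ac)
    then have J: "bessel_J1 (2 * k * of_real a) = suminf E * y" using suminf_mult2[OF sE, of y] by simp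
    have "struve_H1 (2 * k * of_real a) = (\<Sum>m. H m * (\<i> * y))"
      unfolding struve_H1_def by (intro suminf_cong) (simp add: H y_def mult_ac)
    then have S: "struve_H1 (2 * k * of_real a) = suminf H * (\<i> * y)" using suminf_mult2[OF sH, of "\<i> * y"] by simp
    have "k * of_real a = y" by (simp add: y_def)
    then show ?thesis unfolding J S W[unfolded y_def] using y by (simp add: W mult_ac flip: y_def)
  qed
  \<comment> \<open>Off 0 the two formulas agree. \<open>remove_sings\<close> sees only punctured
    neighbourhoods, and the formula with the transform is entire, so agreement extends to the
    origin, where the Bessel and Struve quotients read 0 / 0.\<close>
  have "impedance a k = remove_sings (\<lambda>k. 1 - semicircle_transform (of_real a * k)) k"
    unfolding impedance_def
  proof (rule remove_sings_cong[OF _ refl])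
    have "eventually (\<lambda>x. x \<noteq> 0) (at k)" using eventually_neq_at_within by blast
    then show "\<forall>\<^sub>F x in at k. 1 - bessel_J1 (2 * x * of_real a) / (x * of_real a) + \<i> * (struve_H1 (2 * x * of_real a) / (x * of_real a))
        = 1 - semicircle_transform (of_real a * x)"
      by eventually_elim (rule eq)
  qed
  also have "\<dots> = 1 - semicircle_transform (of_real a * k)"
  proof (rule remove_sings_at_analytic)
    have "(\<lambda>k. 1 - semicircle_transform (of_real a * k)) holomorphic_on UNIV"
      by (intro holomorphic_intros holomorphic_on_compose_gen[OF _ semicircle_transform_entire, unfolded o_def]) auto
    then show "(\<lambda>k. 1 - semicircle_transform (of_real a * k)) analytic_on {k}"
      using analytic_at by blast
  qed
  finally show ?thesis .
qed

text \<open>The density is real, and conjugation takes the exponent - 2 i y u to the same expression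
  at - cnj y. This symmetry makes the impedance real on the imaginary axis and transfers |G| to the
  negative real axis.\<close>

lemma semicircle_transform_reflect: "semicircle_transform (- cnj y) = cnj (semicircle_transform y)"
  unfolding semicircle_transform_def
  by (simp add: integral_cnj exp_cnj)

text \<open>Subtracting the total mass under the integral produces an integrand of constant sign,
  negative in the lower half-plane and positive on the positive imaginary axis up to zeros.\<close>

lemma semicircle_transform_Re:
  "Re (semicircle_transform y) - 1 = 4 / pi * integral {0..1} (\<lambda>u. (Re (exp (- 2 * \<i> * y * of_real u)) - 1) * semicircle u)"
proof -
  define F where "F = (\<lambda>u. exp (- 2 * \<i> * y * of_real u) * complex_of_real (semicircle u))"
  have "(F has_integral integral {0..1} F) {0..1}"
    unfolding F_def by (intro integrable_integral integrable_continuous_real) (auto intro!: continuous_intros)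
  then have "((\<lambda>u. Re (F u)) has_integral Re (integral {0..1} F)) {0..1}"
    by (rule has_integral_Re)
  from has_integral_diff[OF this semicircle_moment_has_integral[of 0]]
  have "((\<lambda>u. (Re (exp (- 2 * \<i> * y * of_real u)) - 1) * semicircle u) has_integral Re (integral {0..1} F) - pi / 4) {0..1}"
    by (simp add: F_def semicircle_moment_0 algebra_simps)
  then have "integral {0..1} (\<lambda>u. (Re (exp (- 2 * \<i> * y * of_real u)) - 1) * semicircle u) = Re (integral {0..1} F) - pi / 4"
    by (rule integral_unique)
  moreover have "Re (semicircle_transform y) - 1 = 4 / pi * (Re (integral {0..1} F) - pi / 4)"
    by (simp add: semicircle_transform_def F_def right_diff_distrib)
  ultimately show ?thesis by (simp only:)
qed

lemma semicircle_transform_Re_less: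
  assumes "Im y \<le> 0" "y \<noteq> 0"
  shows "Re (semicircle_transform y) < 1"
proof -
  define f where "f = (\<lambda>u. (1 - Re (exp (- 2 * \<i> * y * of_real u))) * semicircle u)"
  have cont: "continuous_on {0..1} f"
    unfolding f_def by (intro continuous_intros)
  have le: "Re (exp (- 2 * \<i> * y * of_real u)) \<le> 1" if "0 \<le> u" for u
  proof -
    have "norm (exp (- 2 * \<i> * y * of_real u)) \<le> 1"
      using assms(1) that by (simp add: mult_nonpos_nonneg)
    then show ?thesis using complex_Re_le_cmod order_trans by blast
  qed
  have nonneg: "0 \<le> f u" if "u \<in> {0..1}" for u
    using le[of u] that by (simp add: f_def abs_square_le_1)
  \<comment> \<open>With this choice |2 Re y u0| is below 1, hence below pi, so the cosine is
    strictly less than 1 when y is real and nonzero. Strictness at one point suffices, because the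
    integrand is continuous and nonnegative.\<close>
  define u0 where "u0 = 1 / (2 * (\<bar>Re y\<bar> + 1))"
  have u0: "0 < u0" "u0 < 1" by (auto simp: u0_def field_simps)
  have lt: "Re (exp (- 2 * \<i> * y * of_real u0)) < 1"
  proof (cases "Im y = 0")
    case True
    have "\<bar>2 * Re y * u0\<bar> < 1" "2 * Re y * u0 \<noteq> 0"
      using assms(2) True by (auto simp: u0_def abs_mult field_simps complex_eq_iff)
    then have "cos \<bar>2 * Re y * u0\<bar> < cos 0"
      using pi_gt3 by (intro cos_monotone_0_pi) auto
    then show ?thesis using True by (simp add: Re_exp)
  next
    case False
    then have "norm (exp (- 2 * \<i> * y * of_real u0)) < 1"
      using assms(1) u0 by (simp add: mult_neg_pos)
    then show ?thesis using complex_Re_le_cmod le_less_trans by blast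
  qed
  have "0 \<le> integral {0..1} f"
    by (intro integral_nonneg integrable_continuous_real cont nonneg)
  moreover have "integral {0..1} f \<noteq> 0"
  proof
    assume "integral {0..1} f = 0"
    then have "f u0 = 0" using integral_eq_0_iff[OF cont _ nonneg] u0 by auto
    moreover have "u0\<^sup>2 < 1" using u0 by (simp add: abs_square_less_1)
    ultimately show False using lt by (simp add: f_def)
  qed
  moreover have "integral {0..1} (\<lambda>u. (Re (exp (- 2 * \<i> * y * of_real u)) - 1) * semicircle u) = - integral {0..1} f"
    unfolding f_def by (simp add: algebra_simps flip: integral_neg)
  ultimately have "Re (semicircle_transform y) - 1 < 0"
    unfolding semicircle_transform_Re by (simp add: mult_neg_pos)
  then show ?thesis by simp
qed

text \<open>At y = i t the exponential is exp(2 t u), real and larger than 1 for u > 0. Consequently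
  the impedance is real and negative on the positive imaginary axis.\<close>

lemma semicircle_transform_imaginary:
  assumes "0 < t"
  shows "Im (semicircle_transform (\<i> * of_real t)) = 0" "1 < Re (semicircle_transform (\<i> * of_real t))"
proof -
  have "semicircle_transform (\<i> * of_real t) = cnj (semicircle_transform (\<i> * of_real t))"
    using semicircle_transform_reflect[of "\<i> * of_real t"] by simp
  then have "Im (semicircle_transform (\<i> * of_real t)) = Im (cnj (semicircle_transform (\<i> * of_real t)))" by simp
  then show "Im (semicircle_transform (\<i> * of_real t)) = 0" by simp
  define f where "f = (\<lambda>u. (Re (exp (- 2 * \<i> * (\<i> * of_real t) * of_real u)) - 1) * semicircle u)"
  have f: "f u = (exp (2 * t * u) - 1) * semicircle u" for u by (simp add: f_def Re_exp)
  have cont: "continuous_on {0..1} f"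
    unfolding f_def by (intro continuous_intros)
  have nonneg: "0 \<le> f u" if "u \<in> {0..1}" for u
    using assms that by (simp add: f abs_square_le_1)
  have "0 \<le> integral {0..1} f"
    by (intro integral_nonneg integrable_continuous_real cont nonneg)
  moreover have "integral {0..1} f \<noteq> 0"
  proof
    assume "integral {0..1} f = 0"
    then have "f (1 / 2) = 0" using integral_eq_0_iff[OF cont _ nonneg] by auto
    then show False using assms by (simp add: f power2_eq_square)
  qed
  ultimately have "0 < Re (semicircle_transform (\<i> * of_real t)) - 1"
    unfolding semicircle_transform_Re f_def[symmetric] by simp
  then show "1 < Re (semicircle_transform (\<i> * of_real t))" by simp
qed

text \<open>A Riemann-Lebesgue argument, uniform in the closed lower half-plane because the
  exponential is bounded by 1 there. The semicircle has unbounded slope at 1, hence the detour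
  through a smooth g.\<close>

lemma semicircle_transform_tendsto:
  "(semicircle_transform \<longlongrightarrow> 0) (inf at_infinity (principal {y. Im y \<le> 0}))"
proof (rule tendstoI)
  fix e :: real assume "0 < e"
  \<comment> \<open>The final bound is 4 / pi times 2 \<epsilon>, which is e / 2.\<close>
  define \<epsilon> where "\<epsilon> = e * pi / 16"
  have \<epsilon>: "0 < \<epsilon>" using \<open>0 < e\<close> by (simp add: \<epsilon>_def)
  have "continuous_on {0..1} (\<lambda>u::real. semicircle u)" by (intro continuous_intros)
  from C1_approximation[OF this \<epsilon>] obtain g g' where
    g: "\<And>x. (g has_real_derivative g' x) (at x)" "continuous_on UNIV g'"
    "\<And>x. x \<in> {0..1} \<Longrightarrow> \<bar>semicircle x - g x\<bar> < \<epsilon>" by metis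
  have "bounded (g' ` {0..1})"
    by (intro compact_imp_bounded compact_continuous_image continuous_on_subset[OF g(2)]) auto
  then obtain M where M: "\<And>x. x \<in> {0..1} \<Longrightarrow> \<bar>g' x\<bar> \<le> M"
    unfolding bounded_iff by fastforce
  define K where "K = M + \<bar>g 0\<bar> + \<bar>g 1\<bar>"
  have M0: "0 \<le> M" using M[of 0] by auto
  then have K0: "0 \<le> K" by (simp add: K_def)
  have bound: "norm (semicircle_transform y) \<le> 4 / pi * (\<epsilon> + K / norm y)" if y: "Im y \<le> 0" "y \<noteq> 0" for y
  proof -
    define q where "q = - 2 * \<i> * y"
    have q: "q \<noteq> 0" "Re q \<le> 0" "norm q = 2 * norm y" using y by (auto simp: q_def norm_mult)
    define F where "F = (\<lambda>u. exp (q * of_real u) * complex_of_real (semicircle u))"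
    \<comment> \<open>The partial integral minus the primitive exp(q x) g(x) / q suggested by parts:
      its derivative contains only the approximation error and a term with g' / q.\<close>
    define \<Phi> where "\<Phi> = (\<lambda>x. integral {0..x} F - exp (q * of_real x) * of_real (g x) / q)"
    have contF: "continuous_on {0..1} F" unfolding F_def by (intro continuous_intros)
    have nexp: "norm (exp (q * of_real x)) \<le> 1" if "0 \<le> x" for x
      using q(2) that by (simp add: mult_nonpos_nonneg)
    have contg: "continuous_on {0..1} g"
      using g(1) by (meson DERIV_isCont continuous_at_imp_continuous_on)
    have "norm (\<Phi> 1 - \<Phi> 0) \<le> (\<epsilon> + M / norm q) * 1 - (\<epsilon> + M / norm q) * 0"
    proof (rule differentiable_bound_general[where f' = "\<lambda>x. exp (q * of_real x) * of_real (semicircle x - g x) - exp (q * of_real x) * of_real (g' x) / q"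
          and \<phi>' = "\<lambda>x. \<epsilon> + M / norm q"])
      show "continuous_on {0..1} \<Phi>"
        unfolding \<Phi>_def using q contg
        by (intro continuous_intros indefinite_integral_continuous_1 integrable_continuous_real contF) auto
      fix x :: real assume x: "0 < x" "x < 1"
      have dI: "((\<lambda>x. integral {0..x} F) has_vector_derivative F x) (at x)"
        using integral_has_vector_derivative[OF contF, of x] x at_within_Icc_interior[of x 1] by simp
      have dE: "((\<lambda>x. exp (q * of_real x)) has_vector_derivative q * exp (q * of_real x)) (at x)"
        by (auto intro!: derivative_eq_intros has_vector_derivative_real_field)
      have dg: "((\<lambda>x. complex_of_real (g x)) has_vector_derivative of_real (g' x)) (at x)"
        by (rule has_vector_derivative_of_real[OF g(1)])
      have "(\<Phi> has_vector_derivative (F x - (exp (q * of_real x) * of_real (g' x) + q * exp (q * of_real x) * of_real (g x)) / q)) (at x)"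
        unfolding \<Phi>_def
        by (rule has_vector_derivative_diff[OF dI has_vector_derivative_divide[OF has_vector_derivative_mult[OF dE dg]]])
      then show "(\<Phi> has_vector_derivative exp (q * of_real x) * of_real (semicircle x - g x) - exp (q * of_real x) * of_real (g' x) / q) (at x)"
        using q(1) by (simp add: F_def algebra_simps add_divide_distrib)
      show "((\<lambda>x. (\<epsilon> + M / norm q) * x) has_vector_derivative \<epsilon> + M / norm q) (at x)"
        by (auto intro!: derivative_eq_intros simp flip: has_real_derivative_iff_has_vector_derivative)
      have "norm (exp (q * of_real x) * complex_of_real (semicircle x - g x)) \<le> 1 * \<epsilon>"
        unfolding norm_mult norm_of_real using g(3)[of x] x by (intro mult_mono nexp) auto
      moreover have "norm (exp (q * of_real x) * complex_of_real (g' x) / q) \<le> 1 * M / norm q"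
        unfolding norm_mult norm_divide norm_of_real using M[of x] x by (intro divide_right_mono mult_mono nexp) auto
      ultimately show "norm (exp (q * of_real x) * of_real (semicircle x - g x) - exp (q * of_real x) * of_real (g' x) / q) \<le> \<epsilon> + M / norm q"
        by (intro norm_triangle_le_diff) simp
    qed (auto intro!: continuous_intros)
    then have \<Phi>: "norm (\<Phi> 1 - \<Phi> 0) \<le> \<epsilon> + M / norm q" by simp
    have "integral {0..1} F = (\<Phi> 1 - \<Phi> 0) + exp q * of_real (g 1) / q - of_real (g 0) / q"
      by (simp add: \<Phi>_def)
    then have "norm (integral {0..1} F) \<le> norm (\<Phi> 1 - \<Phi> 0) + norm (exp q * of_real (g 1) / q) + norm (of_real (g 0) / q)"
      using norm_triangle_ineq4[of "(\<Phi> 1 - \<Phi> 0) + exp q * of_real (g 1) / q" "of_real (g 0) / q"]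
        norm_triangle_ineq[of "\<Phi> 1 - \<Phi> 0" "exp q * of_real (g 1) / q"] by simp
    moreover have "norm (exp q * of_real (g 1) / q) \<le> 1 * \<bar>g 1\<bar> / norm q"
      unfolding norm_mult norm_divide norm_of_real using nexp[of 1] by (intro divide_right_mono mult_right_mono) auto
    moreover have "norm (of_real (g 0) / q) = \<bar>g 0\<bar> / norm q" by (simp add: norm_divide)
    ultimately have "norm (integral {0..1} F) \<le> \<epsilon> + (M / norm q + \<bar>g 1\<bar> / norm q + \<bar>g 0\<bar> / norm q)"
      using \<Phi> by simp
    also have "M / norm q + \<bar>g 1\<bar> / norm q + \<bar>g 0\<bar> / norm q = K / norm q"
      by (simp add: K_def add_divide_distrib)
    also have "K / norm q \<le> K / norm y"
      using K0 q y by (intro divide_left_mono) auto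
    finally have "norm (integral {0..1} F) \<le> \<epsilon> + K / norm y" by simp
    moreover have "norm (semicircle_transform y) = 4 / pi * norm (integral {0..1} F)"
      unfolding semicircle_transform_def F_def q_def norm_mult norm_of_real by simp
    ultimately show ?thesis by (simp only: mult_left_mono divide_nonneg_pos pi_gt_zero zero_le_numeral)
  qed
  have ev: "eventually (\<lambda>y. K / \<epsilon> + 1 \<le> norm y) (at_infinity :: complex filter)"
    unfolding eventually_at_infinity by blast
  show "eventually (\<lambda>y. dist (semicircle_transform y) 0 < e) (inf at_infinity (principal {y. Im y \<le> 0}))"
    unfolding eventually_inf_principal
    using ev
  proof eventually_elim
    case (elim y)
    show ?case
    proof
      assume y: "y \<in> {y. Im y \<le> 0}"
      have "0 \<le> K / \<epsilon>" using K0 \<epsilon> by simp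
      then have "0 < norm y" using elim by linarith
      moreover have "K \<le> \<epsilon> * norm y"
      proof -
        have "K / \<epsilon> \<le> norm y" using elim by simp
        then show ?thesis using \<epsilon> by (simp add: pos_divide_le_eq mult.commute)
      qed
      ultimately have "K / norm y \<le> \<epsilon>" by (simp add: pos_divide_le_eq)
      then have "norm (semicircle_transform y) \<le> 4 / pi * (\<epsilon> + \<epsilon>)"
        using bound[of y] y \<open>0 < norm y\<close> by (intro order_trans[OF bound]) (auto intro!: divide_right_mono mult_left_mono)
      also have "\<dots> = e / 2" by (simp add: \<epsilon>_def)
      finally show "dist (semicircle_transform y) 0 < e" using \<open>0 < e\<close> by simp
    qed
  qed
qed

section \<open>Asymptotics in the lower half-plane\<close>

abbreviation lower :: "complex filter" where
  "lower \<equiv> inf at_infinity (principal {k. Im k \<le> 0})"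

lemma eventually_lower: "eventually P lower \<longleftrightarrow> (\<exists>R. \<forall>k. R \<le> norm k \<longrightarrow> Im k \<le> 0 \<longrightarrow> P k)"
  unfolding eventually_inf_principal eventually_at_infinity by auto

lemma lower_nonzero: "eventually (\<lambda>k. k \<noteq> 0) lower"
  unfolding eventually_lower by (intro exI[of _ 1]) auto

lemma negative_imaginary_lower: "filterlim (\<lambda>t. - \<i> * complex_of_real t) lower at_top"
  unfolding filterlim_inf filterlim_principal
proof
  show "filterlim (\<lambda>t. - \<i> * complex_of_real t) at_infinity at_top"
    by (rule tendsto_mult_filterlim_at_infinity[OF tendsto_const _ filterlim_of_real_at_infinity]) simp
  show "\<forall>\<^sub>F t in at_top. - \<i> * complex_of_real t \<in> {k. Im k \<le> 0}"
    using eventually_ge_at_top[of 0] by eventually_elim simp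
qed

text \<open>Only the derivative of \<open>D\<close> has no oscillating factor; its source \<open>F\<close> oscillates and is
  integrated by parts after replacing \<open>h\<close> by a smooth approximation.\<close>

locale rotating_system =
  fixes l :: real and h :: "real \<Rightarrow> real" and F D :: "complex \<Rightarrow> real \<Rightarrow> complex"
  assumes l_pos: "0 < l" and cont_h: "continuous_on {0..l} h"
    and cont_F: "k \<noteq> 0 \<Longrightarrow> continuous_on {0..l} (F k)" and cont_D: "k \<noteq> 0 \<Longrightarrow> continuous_on {0..l} (D k)"
    and F_deriv: "k \<noteq> 0 \<Longrightarrow> x \<in> {0<..<l} \<Longrightarrow>
       (F k has_vector_derivative (- 2 * \<i> * k * F k x + of_real (h x) * D k x)) (at x)"
    and D_deriv: "k \<noteq> 0 \<Longrightarrow> x \<in> {0<..<l} \<Longrightarrow> (D k has_vector_derivative of_real (h x) * F k x) (at x)"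
    and F_0: "k \<noteq> 0 \<Longrightarrow> F k 0 = 1" and D_0: "k \<noteq> 0 \<Longrightarrow> D k 0 = 1"
begin

lemma bounded_h: "\<exists>H. 0 \<le> H \<and> (\<forall>x\<in>{0..l}. \<bar>h x\<bar> \<le> H)"
proof -
  have "bounded (h ` {0..l})"
    by (intro compact_imp_bounded compact_continuous_image cont_h) auto
  then obtain H where H: "\<forall>x\<in>{0..l}. \<bar>h x\<bar> \<le> H"
    unfolding bounded_iff by auto
  moreover have "0 \<le> H" using H[rule_format, of 0] l_pos by auto
  ultimately show ?thesis by blast
qed

text \<open>In the derivative of |F|^2 + |D|^2 the rotation contributes 4 Im k |F|^2, which is not
  positive in the lower half-plane. The remaining terms are controlled by h alone, so the Gronwall
  bound is uniform in k.\<close>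

lemma bounded_FD:
  "\<exists>M\<ge>1. \<forall>k. k \<noteq> 0 \<longrightarrow> Im k \<le> 0 \<longrightarrow> (\<forall>x\<in>{0..l}. norm (F k x) \<le> M \<and> norm (D k x) \<le> M)"
proof -
  obtain H where H: "0 \<le> H" "\<And>x. x \<in> {0..l} \<Longrightarrow> \<bar>h x\<bar> \<le> H" using bounded_h by blast
  \<comment> \<open>Gronwall bounds the energy by 2 exp(2 H l). The summand 1 ensures M <= M^2, so
    that this bound on squares also bounds the norms by M.\<close>
  define M where "M = 1 + 2 * exp (2 * H * l)"
  have M1: "1 \<le> M" by (simp add: M_def)
  have "norm (F k x) \<le> M \<and> norm (D k x) \<le> M" if k: "k \<noteq> 0" "Im k \<le> 0" and x: "x \<in> {0..l}" for k x
  proof -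
    define e where "e = (\<lambda>x. (norm (F k x))\<^sup>2 + (norm (D k x))\<^sup>2)"
    define e' where "e' = (\<lambda>x. 2 * inner (F k x) (- 2 * \<i> * k * F k x + of_real (h x) * D k x) + 2 * inner (D k x) (of_real (h x) * F k x))"
    have "e x \<le> e 0 * exp (2 * H * (x - 0))"
    proof (rule gronwall_right[where e' = e'])
      show "continuous_on {0..x} e"
        unfolding e_def by (intro continuous_intros continuous_on_subset[OF cont_F[OF k(1)]] continuous_on_subset[OF cont_D[OF k(1)]])
          (use x in auto)
      fix t assume "0 < t" "t < x"
      then have t: "t \<in> {0<..<l}" "t \<in> {0..l}" using x by auto
      show "(e has_real_derivative e' t) (at t)"
        unfolding e_def e'_def
        by (intro DERIV_add has_real_derivative_norm_power2 F_deriv D_deriv k t)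
      have 1: "inner (F k t) (- 2 * \<i> * k * F k t) = 2 * Im k * (norm (F k t))\<^sup>2"
        by (simp only: cmod_power2 inner_complex_def) (simp add: algebra_simps power2_eq_square)
      have 2: "inner (F k t) (of_real (h t) * D k t) + inner (D k t) (of_real (h t) * F k t) = 2 * (h t * inner (F k t) (D k t))"
        by (simp add: inner_complex_def algebra_simps)
      have "\<bar>h t * inner (F k t) (D k t)\<bar> \<le> H * (norm (F k t) * norm (D k t))"
        unfolding abs_mult by (intro mult_mono H t Cauchy_Schwarz_ineq2) (use H in auto)
      moreover have "2 * (H * (norm (F k t) * norm (D k t))) \<le> H * e t"
        unfolding e_def using mult_left_mono[OF sum_squares_bound[of "norm (F k t)" "norm (D k t)"] H(1)]
        by (simp add: algebra_simps)
      moreover have "2 * Im k * (norm (F k t))\<^sup>2 \<le> 0" using k(2) by (simp add: mult_nonpos_nonneg)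
      moreover have "e' t = 2 * (2 * Im k * (norm (F k t))\<^sup>2) + 4 * (h t * inner (F k t) (D k t))"
      proof -
        have "2 * (a + b) + 2 * c = 2 * d + 4 * f" if "a = d" "b + c = 2 * f" for a b c d f :: real
        proof -
          have "2 * (a + b) + 2 * c = 2 * a + 2 * (b + c)" by simp
          then show ?thesis by (simp only: that)
        qed
        from this[OF 1 2] show ?thesis unfolding e'_def inner_add_right .
      qed
      ultimately show "e' t \<le> 2 * H * e t" 
        using abs_ge_self[of "h t * inner (F k t) (D k t)"] by linarith
    qed (use x in auto)
    also have "e 0 = 2" using k by (simp add: e_def F_0 D_0)
    also have "2 * exp (2 * H * (x - 0)) \<le> 2 * exp (2 * H * l)"
      using H(1) x by (simp add: mult_left_mono)
    finally have "(norm (F k x))\<^sup>2 + (norm (D k x))\<^sup>2 \<le> M" by (simp add: e_def M_def)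
    then have "(norm (F k x))\<^sup>2 \<le> M" "(norm (D k x))\<^sup>2 \<le> M"
      using zero_le_power2[of "norm (F k x)"] zero_le_power2[of "norm (D k x)"] by linarith+
    moreover have "M \<le> M\<^sup>2" using M1 by (simp add: power2_eq_square)
    ultimately have "(norm (F k x))\<^sup>2 \<le> M\<^sup>2" "(norm (D k x))\<^sup>2 \<le> M\<^sup>2" by linarith+
    then show ?thesis using M1 by (auto intro: power2_le_imp_le)
  qed
  with M1 show ?thesis by blast
qed

lemma D_tendsto: "((\<lambda>k. D k l) \<longlongrightarrow> 1) lower"
proof (rule tendstoI)
  fix e :: real assume "0 < e"
  obtain H where H: "0 \<le> H" "\<And>x. x \<in> {0..l} \<Longrightarrow> \<bar>h x\<bar> \<le> H" using bounded_h by blast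
  obtain M where M: "1 \<le> M" "\<And>k x. k \<noteq> 0 \<Longrightarrow> Im k \<le> 0 \<Longrightarrow> x \<in> {0..l} \<Longrightarrow> norm (F k x) \<le> M"
    "\<And>k x. k \<noteq> 0 \<Longrightarrow> Im k \<le> 0 \<Longrightarrow> x \<in> {0..l} \<Longrightarrow> norm (D k x) \<le> M"
    using bounded_FD by metis
  \<comment> \<open>The approximation error accumulates to \<epsilon> M l, which is one third of e;
    everything else is of order 1 / |k|.\<close>
  define \<epsilon> where "\<epsilon> = e / (3 * M * l)"
  have \<epsilon>: "0 < \<epsilon>" using \<open>0 < e\<close> M l_pos by (simp add: \<epsilon>_def)
  obtain g g' where g: "\<And>x. (g has_real_derivative g' x) (at x)" "continuous_on UNIV g'"
    "\<And>x. x \<in> {0..l} \<Longrightarrow> \<bar>h x - g x\<bar> < \<epsilon>" using C1_approximation[OF cont_h \<epsilon>] by metis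
  have contg: "continuous_on {0..l} g"
    using DERIV_isCont[OF g(1)] by (intro continuous_at_imp_continuous_on) blast
  have "bounded ((\<lambda>x. \<bar>g x\<bar> + \<bar>g' x\<bar>) ` {0..l})"
    by (intro compact_imp_bounded compact_continuous_image continuous_intros contg continuous_on_subset[OF g(2)]) auto
  then obtain K where K: "\<And>x. x \<in> {0..l} \<Longrightarrow> \<bar>g x\<bar> + \<bar>g' x\<bar> \<le> K"
    unfolding bounded_iff by fastforce
  have K0: "0 \<le> K" using K[of 0] l_pos by auto
  define L where "L = l * (K * M + K * H * M) + 2 * K * M"
  have bound: "norm (D k l - 1) \<le> e / 3 + L / norm k" if k: "k \<noteq> 0" "Im k \<le> 0" for k
  proof -
    define q where "q = 2 * \<i> * k"
    have q: "q \<noteq> 0" "norm q = 2 * norm k" using k by (auto simp: q_def norm_mult)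
    \<comment> \<open>Since F' = - q F + h D, the correction g F / q contributes - g F to the
      derivative and cancels the smooth part of the source h F. What is left is (h - g) F plus terms
      of order 1 / q.\<close>
    define S where "S = (\<lambda>x. D k x + of_real (g x) * F k x / q)"
    define S' where "S' = (\<lambda>x. of_real (h x - g x) * F k x + (of_real (g' x) * F k x + of_real (g x) * (of_real (h x) * D k x)) / q)"
    have "norm (S l - S 0) \<le> (\<epsilon> * M + (K * M + K * H * M) / norm q) * l - (\<epsilon> * M + (K * M + K * H * M) / norm q) * 0"
    proof (rule differentiable_bound_general[OF l_pos, where f' = S' and \<phi>' = "\<lambda>_. \<epsilon> * M + (K * M + K * H * M) / norm q"])
      show "continuous_on {0..l} S"
        unfolding S_def using k q by (intro continuous_intros cont_D cont_F contg) auto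
      fix x assume "0 < x" "x < l"
      then have x: "x \<in> {0<..<l}" "x \<in> {0..l}" by auto
      have dg: "((\<lambda>x. complex_of_real (g x)) has_vector_derivative of_real (g' x)) (at x)"
        by (rule has_vector_derivative_of_real[OF g(1)])
      have "(S has_vector_derivative of_real (h x) * F k x +
          (of_real (g x) * (- 2 * \<i> * k * F k x + of_real (h x) * D k x) + of_real (g' x) * F k x) / q) (at x)"
        unfolding S_def
        by (intro has_vector_derivative_add has_vector_derivative_divide has_vector_derivative_mult dg D_deriv F_deriv k x)
      moreover have "of_real (h x) * F k x + (of_real (g x) * (- 2 * \<i> * k * F k x + of_real (h x) * D k x) + of_real (g' x) * F k x) / q = S' x"
        using k(1) by (simp add: S'_def q_def field_simps)
      ultimately show "(S has_vector_derivative S' x) (at x)" by simp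
      have gx: "\<bar>g x\<bar> \<le> K" "\<bar>g' x\<bar> \<le> K" using K[OF x(2)] by linarith+
      have 1: "norm (of_real (h x - g x) * F k x) \<le> \<epsilon> * M"
        unfolding norm_mult norm_of_real using g(3)[OF x(2)] M(2)[OF k x(2)] \<epsilon> by (intro mult_mono) auto
      have 2: "norm (of_real (g' x) * F k x) \<le> K * M"
        unfolding norm_mult norm_of_real using gx M(2)[OF k x(2)] K0 by (intro mult_mono) auto
      have 3: "norm (of_real (g x) * (of_real (h x) * D k x)) \<le> K * (H * M)"
        unfolding norm_mult norm_of_real using gx M(3)[OF k x(2)] K0 H x by (intro mult_mono) auto
      have "norm (of_real (g' x) * F k x + of_real (g x) * (of_real (h x) * D k x)) \<le> K * M + K * H * M"
        using norm_triangle_mono[OF 2 3] by (simp add: mult.assoc)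
      then have 4: "norm ((of_real (g' x) * F k x + of_real (g x) * (of_real (h x) * D k x)) / q) \<le> (K * M + K * H * M) / norm q"
        unfolding norm_divide by (rule divide_right_mono) simp
      show "norm (S' x) \<le> \<epsilon> * M + (K * M + K * H * M) / norm q"
        unfolding S'_def by (rule norm_triangle_mono[OF 1 4])
      show "((\<lambda>x. (\<epsilon> * M + (K * M + K * H * M) / norm q) * x) has_vector_derivative \<epsilon> * M + (K * M + K * H * M) / norm q) (at x)"
        by (auto intro!: derivative_eq_intros simp flip: has_real_derivative_iff_has_vector_derivative)
    qed (auto intro!: continuous_intros)
    then have S: "norm (S l - S 0) \<le> \<epsilon> * M * l + (K * M + K * H * M) * l / norm q"
      by (simp add: algebra_simps)
    have ends: "0 \<in> {0..l}" "l \<in> {0..l}" using l_pos by auto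
    have gF: "norm (of_real (g x) * F k x / q) \<le> K * M / norm q" if x: "x \<in> {0..l}" for x
      unfolding norm_divide norm_mult norm_of_real
      using K[OF x] M(2)[OF k x] K0 by (intro divide_right_mono mult_mono) auto
    have "D k l - 1 = (S l - S 0) - of_real (g l) * F k l / q + of_real (g 0) * F k 0 / q"
      using k by (simp add: S_def D_0)
    then have "norm (D k l - 1) \<le> norm (S l - S 0) + norm (of_real (g l) * F k l / q) + norm (of_real (g 0) * F k 0 / q)"
      using norm_triangle_ineq[of "(S l - S 0) - of_real (g l) * F k l / q" "of_real (g 0) * F k 0 / q"]
        norm_triangle_ineq4[of "S l - S 0" "of_real (g l) * F k l / q"] by simp
    also have "\<dots> \<le> \<epsilon> * M * l + (K * M + K * H * M) * l / norm q + K * M / norm q + K * M / norm q"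
      using S gF[OF ends(1)] gF[OF ends(2)] by linarith
    also have "\<dots> = \<epsilon> * M * l + L / norm q"
      by (simp add: L_def add_divide_distrib[symmetric] algebra_simps)
    also have "\<epsilon> * M * l = e / 3" using M l_pos by (simp add: \<epsilon>_def)
    also have "L / norm q \<le> L / norm k"
    proof -
      have "0 \<le> L" using K0 M H l_pos by (simp add: L_def)
      then show ?thesis using q k by (intro divide_left_mono) auto
    qed
    finally show ?thesis by simp
  qed
  show "eventually (\<lambda>k. dist (D k l) 1 < e) lower"
    unfolding eventually_lower
  proof (intro exI[of _ "3 * \<bar>L\<bar> / e + 1"] allI impI)
    fix k :: complex assume *: "3 * \<bar>L\<bar> / e + 1 \<le> norm k" "Im k \<le> 0"
    have "0 \<le> 3 * \<bar>L\<bar> / e" using \<open>0 < e\<close> by simp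
    then have "0 < norm k" "3 * \<bar>L\<bar> / e \<le> norm k" using * by linarith+
    then have "3 * \<bar>L\<bar> \<le> e * norm k" using \<open>0 < e\<close> by (simp add: pos_divide_le_eq mult.commute)
    then have "L / norm k \<le> e / 3" using \<open>0 < norm k\<close> by (simp add: pos_divide_le_eq)
    moreover have "norm (D k l - 1) \<le> e / 3 + L / norm k" using bound[of k] * \<open>0 < norm k\<close> by auto
    ultimately show "dist (D k l) 1 < e" unfolding dist_norm using \<open>0 < e\<close> by linarith
  qed
qed

text \<open>At k = - i t the rotation becomes damping, F' = - 2 t F + h D, and the integrating
  factor exp(2 t x) gives a bound exp(- 2 l t) plus a multiple of 1 / t. On the real axis there is
  no such damping, so this limit is taken along one ray.\<close>

lemma F_imaginary_tendsto: "((\<lambda>t. F (- \<i> * of_real t) l) \<longlongrightarrow> 0) at_top"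
proof -
  obtain H where H: "0 \<le> H" "\<And>x. x \<in> {0..l} \<Longrightarrow> \<bar>h x\<bar> \<le> H" using bounded_h by blast
  obtain M where M: "1 \<le> M" "\<And>k x. k \<noteq> 0 \<Longrightarrow> Im k \<le> 0 \<Longrightarrow> x \<in> {0..l} \<Longrightarrow> norm (F k x) \<le> M"
    "\<And>k x. k \<noteq> 0 \<Longrightarrow> Im k \<le> 0 \<Longrightarrow> x \<in> {0..l} \<Longrightarrow> norm (D k x) \<le> M"
    using bounded_FD by metis
  have bound: "norm (F (- \<i> * of_real t) l) \<le> exp (- (2 * l * t)) + H * M / 2 / t" if t: "0 < t" for t
  proof -
    define k where "k = - \<i> * complex_of_real t"
    have k: "k \<noteq> 0" "Im k \<le> 0" "- 2 * \<i> * k = - of_real (2 * t)" using t by (auto simp: k_def)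
    define Q where "Q = (\<lambda>x. of_real (exp (2 * t * x)) * F k x)"
    define C where "C = H * M / (2 * t)"
    have "norm (Q l - Q 0) \<le> C * exp (2 * t * l) - C * exp (2 * t * 0)"
    proof (rule differentiable_bound_general[OF l_pos, where f' = "\<lambda>x. of_real (exp (2 * t * x)) * (of_real (h x) * D k x)"
          and \<phi>' = "\<lambda>x. exp (2 * t * x) * (H * M)"])
      show "continuous_on {0..l} Q"
        unfolding Q_def by (intro continuous_intros cont_F k)
      fix x assume "0 < x" "x < l"
      then have x: "x \<in> {0<..<l}" "x \<in> {0..l}" by auto
      have "((\<lambda>x. exp (2 * t * x)) has_real_derivative 2 * t * exp (2 * t * x)) (at x)"
        by (auto intro!: derivative_eq_intros)
      then have dE: "((\<lambda>x. complex_of_real (exp (2 * t * x))) has_vector_derivative of_real (2 * t * exp (2 * t * x))) (at x)"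
        by (rule has_vector_derivative_of_real)
      have "(Q has_vector_derivative of_real (exp (2 * t * x)) * (- 2 * \<i> * k * F k x + of_real (h x) * D k x) +
          of_real (2 * t * exp (2 * t * x)) * F k x) (at x)"
        unfolding Q_def by (intro has_vector_derivative_mult dE F_deriv k x)
      moreover have "of_real (exp (2 * t * x)) * (- 2 * \<i> * k * F k x + of_real (h x) * D k x) +
          of_real (2 * t * exp (2 * t * x)) * F k x = of_real (exp (2 * t * x)) * (of_real (h x) * D k x)"
        unfolding k(3) by (simp add: algebra_simps)
      ultimately show "(Q has_vector_derivative of_real (exp (2 * t * x)) * (of_real (h x) * D k x)) (at x)"
        by simp
      show "((\<lambda>x. C * exp (2 * t * x)) has_vector_derivative exp (2 * t * x) * (H * M)) (at x)"
        unfolding has_real_derivative_iff_has_vector_derivative[symmetric] C_def using t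
        by (auto intro!: derivative_eq_intros)
      show "norm (of_real (exp (2 * t * x)) * (of_real (h x) * D k x)) \<le> exp (2 * t * x) * (H * M)"
        unfolding norm_mult norm_of_real using M(3)[OF k(1,2) x(2)] H x by (auto intro!: mult_mono)
    qed (intro continuous_intros)
    moreover have "Q 0 = 1" using k by (simp add: Q_def F_0)
    moreover have "0 \<le> C" using H M t by (simp add: C_def)
    ultimately have "norm (Q l) \<le> 1 + C * exp (2 * t * l)"
      using norm_triangle_ineq2[of "Q l" 1] by simp
    moreover have "norm (Q l) = exp (2 * t * l) * norm (F k l)"
      by (simp add: Q_def norm_mult)
    ultimately have "exp (- (2 * l * t)) * (exp (2 * t * l) * norm (F k l)) \<le> exp (- (2 * l * t)) * (1 + C * exp (2 * t * l))"
      by (intro mult_left_mono) auto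
    moreover have "exp (- (2 * l * t)) * exp (2 * t * l) = 1"
      by (simp flip: exp_add)
    ultimately have "norm (F k l) \<le> exp (- (2 * l * t)) + C"
      by (simp add: distrib_left mult.assoc[symmetric]) (simp add: mult.assoc mult.left_commute)
    then show ?thesis by (simp add: k_def C_def)
  qed
  have "((\<lambda>t. exp (- (2 * l * t)) + H * M / 2 / t) \<longlongrightarrow> 0 + 0) at_top"
  proof (intro tendsto_add)
    have "filterlim (\<lambda>t::real. 2 * l * t) at_top at_top"
      by (rule filterlim_tendsto_pos_mult_at_top[OF tendsto_const _ filterlim_ident]) (use l_pos in simp)
    then have "filterlim (\<lambda>t::real. - (2 * l * t)) at_bot at_top"
      by (simp only: filterlim_uminus_at_top)
    then show "((\<lambda>t. exp (- (2 * l * t))) \<longlongrightarrow> 0) at_top"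
      by (rule filterlim_compose[OF exp_at_bot])
    show "((\<lambda>t. H * M / 2 / t) \<longlongrightarrow> 0) at_top"
      by (intro tendsto_divide_0[OF tendsto_const] filterlim_at_top_imp_at_infinity filterlim_ident)
  qed
  then have lim: "((\<lambda>t. exp (- (2 * l * t)) + H * M / 2 / t) \<longlongrightarrow> 0) at_top" by simp
  show ?thesis
    by (rule Lim_null_comparison[OF eventually_mono[OF eventually_gt_at_top[of 0] bound] lim])
qed

end

section \<open>Energy flux, the zero-free half-plane and asymptotics of \<open>G_fun\<close>\<close>

context tract
begin

lemma uu_vv_nonzero:
  assumes "x \<in> {0..l}"
  shows "uu k x \<noteq> 0 \<or> vv k x \<noteq> 0"
proof (rule ccontr)
  assume "\<not> (uu k x \<noteq> 0 \<or> vv k x \<noteq> 0)"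
  then have "uu k 0 = 0"
    using sturm_system_unique[OF sturm_system_uv cont_weight weight_pos assms _ _ ends(1)] by blast
  then show False by (simp add: sturm_uv_at_0)
qed

text \<open>The energy flux \<open>Im (r\<^sup>2 P' P\<^sup>* / k)\<close> of a solution is monotone, in a direction given by the
  sign of \<open>Im k\<close>.\<close>

definition flux :: "complex \<Rightarrow> real \<Rightarrow> real" where
  "flux k x = Im (vv k x * cnj (uu k x) / k)"

definition density :: "complex \<Rightarrow> real \<Rightarrow> real" where
  "density k x = (r x)\<^sup>2 * (norm (uu k x))\<^sup>2 + (norm (vv k x))\<^sup>2 / ((r x)\<^sup>2 * (norm k)\<^sup>2)"

lemma density_pos: "k \<noteq> 0 \<Longrightarrow> x \<in> {0..l} \<Longrightarrow> 0 < density k x"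
  using uu_vv_nonzero[of x k] radius_pos[of x] unfolding density_def
  by (auto intro: add_pos_nonneg add_nonneg_pos)

lemma flux_0: "flux k 0 = 0"
  by (simp add: flux_def sturm_uv_at_0)

lemma cont_uu: "continuous_on {0..l} (uu k)" and cont_vv: "continuous_on {0..l} (vv k)"
  using sturm_system_uv[of "k\<^sup>2"] by (auto simp: sturm_system_def)

lemma cont_flux: "k \<noteq> 0 \<Longrightarrow> continuous_on {0..l} (flux k)"
  unfolding flux_def[abs_def] by (intro continuous_intros cont_uu cont_vv) auto

text \<open>The derivative of v cnj(u) / k is |v|^2 / (r^2 k) - k r^2 |u|^2. The imaginary parts of
  1 / k and of - k are both negative multiples of Im k, so the two contributions have the same
  sign.\<close>

lemma flux_deriv:
  assumes k: "k \<noteq> 0" and x: "0 < x" "x < l"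
  shows "(flux k has_real_derivative - Im k * density k x) (at x)"
proof -
  have xl: "x \<in> {0..l}" using x by auto
  have rx: "r x \<noteq> 0" using radius_pos[OF xl] by simp
  have du: "(uu k has_vector_derivative vv k x / of_real ((r x)\<^sup>2)) (at x)"
    and dv: "(vv k has_vector_derivative - (k\<^sup>2 * of_real ((r x)\<^sup>2) * uu k x)) (at x)"
    using sturm_system_uv[of "k\<^sup>2"] x by (auto simp: sturm_system_def)
  have "((\<lambda>x. vv k x * cnj (uu k x) / k) has_vector_derivative
      (vv k x * cnj (vv k x / of_real ((r x)\<^sup>2)) + - (k\<^sup>2 * of_real ((r x)\<^sup>2) * uu k x) * cnj (uu k x)) / k) (at x)"
    by (intro has_vector_derivative_divide has_vector_derivative_mult dv has_vector_derivative_cnj du)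
  then have "((\<lambda>x. Im (vv k x * cnj (uu k x) / k)) has_vector_derivative
      Im ((vv k x * cnj (vv k x / of_real ((r x)\<^sup>2)) + - (k\<^sup>2 * of_real ((r x)\<^sup>2) * uu k x) * cnj (uu k x)) / k)) (at x)"
    by (rule bounded_linear.has_vector_derivative[OF bounded_linear_Im])
  moreover have "(vv k x * cnj (vv k x / of_real ((r x)\<^sup>2)) + - (k\<^sup>2 * of_real ((r x)\<^sup>2) * uu k x) * cnj (uu k x)) / k
      = of_real ((norm (vv k x))\<^sup>2 / (r x)\<^sup>2) / k - k * of_real ((r x)\<^sup>2 * (norm (uu k x))\<^sup>2)"
    unfolding of_real_mult of_real_divide complex_norm_square
    using k by (simp add: field_simps power2_eq_square[of k])
  moreover have "Im (of_real ((norm (vv k x))\<^sup>2 / (r x)\<^sup>2) / k - k * of_real ((r x)\<^sup>2 * (norm (uu k x))\<^sup>2)) = - Im k * density k x"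
  proof -
    have "Im (of_real c / k) = - (Im k * c / (norm k)\<^sup>2)" for c :: real
      by (simp add: Im_divide cmod_power2 mult.commute)
    then show ?thesis
      by (simp add: density_def algebra_simps del: of_real_mult of_real_divide of_real_power)
  qed
  ultimately show ?thesis
    unfolding flux_def[abs_def] by (simp add: has_real_derivative_iff_has_vector_derivative)
qed

lemma flux_nonneg:
  assumes k: "k \<noteq> 0" "Im k \<le> 0"
  shows "0 \<le> flux k l"
proof -
  have "flux k 0 \<le> flux k l"
  proof (rule DERIV_nonneg_imp_increasing_open[of 0 l "flux k"])
    fix x assume x: "0 < x" "x < l"
    then have "0 \<le> - Im k * density k x"
      using k density_pos[OF k(1), of x] by (simp add: mult_nonpos_nonneg)
    then show "\<exists>y. (flux k has_real_derivative y) (at x) \<and> 0 \<le> y"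
      using flux_deriv[OF k(1) x] by blast
  qed (use length_pos cont_flux[OF k(1)] in auto)
  then show ?thesis by (simp add: flux_0)
qed

lemma flux_neg:
  assumes k: "0 < Im k"
  shows "flux k l < 0"
proof -
  have k0: "k \<noteq> 0" using k by auto
  have "flux k l < flux k 0"
  proof (rule DERIV_neg_imp_decreasing_open[OF length_pos])
    fix x assume x: "0 < x" "x < l"
    then have "- Im k * density k x < 0"
      using k density_pos[OF k0, of x] by simp
    then show "\<exists>y. (flux k has_real_derivative y) (at x) \<and> y < 0"
      using flux_deriv[OF k0 x] by blast
  qed (rule cont_flux[OF k0])
  then show ?thesis by (simp add: flux_0)
qed

lemma impedance_radius: "impedance (r l) k = 1 - semicircle_transform (of_real (r l) * k)"
  by (rule impedance_eq[OF ends(4)])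

lemma Re_impedance_pos: "Im k \<le> 0 \<Longrightarrow> k \<noteq> 0 \<Longrightarrow> 0 < Re (impedance (r l) k)"
  using semicircle_transform_Re_less[of "of_real (r l) * k"] ends(4)
  by (simp add: impedance_radius mult_nonneg_nonpos)

lemma G_fun_eq_0_iff:
  "G_fun l r k = 0 \<longleftrightarrow> \<i> * k * (of_real (r l))\<^sup>2 * uu k l + impedance (r l) k * vv k l = 0"
  using ends by (simp add: G_fun_eq)

text \<open>At a zero of G the lip relation makes the flux at l equal to - r^2 |u|^2 Re(1/z), where
  Re(1/z) > 0 in this region. A nonnegative flux then forces u(l) = 0, hence v(l) = 0, which
  uniqueness excludes. For real k the flux is constant, and the same argument works.\<close>

lemma G_nonzero_lower:
  assumes k: "Im k \<le> 0" "k \<noteq> 0"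
  shows "G_fun l r k \<noteq> 0"
proof
  define z where "z = impedance (r l) k"
  assume "G_fun l r k = 0"
  then have eq: "\<i> * k * (of_real (r l))\<^sup>2 * uu k l + z * vv k l = 0"
    by (simp add: G_fun_eq_0_iff z_def)
  have z: "0 < Re z" using Re_impedance_pos[OF k] by (simp add: z_def)
  then have z0: "z \<noteq> 0" by auto
  have v: "vv k l = - (\<i> * k * (of_real (r l))\<^sup>2 * uu k l / z)"
    using eq z0 by (simp add: field_simps eq_neg_iff_add_eq_0)
  have "vv k l * cnj (uu k l) / k = - (\<i> * (of_real ((r l)\<^sup>2 * (norm (uu k l))\<^sup>2) * inverse z))"
    unfolding v of_real_mult complex_norm_square using k(2) by (simp add: field_simps)
  then have "flux k l = - ((r l)\<^sup>2 * (norm (uu k l))\<^sup>2 * Re (inverse z))"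
    by (simp add: flux_def)
  moreover have "0 < Re (inverse z)" using z by (auto simp: inverse_complex.sel(1) sum_power2_gt_zero_iff)
  ultimately have "uu k l = 0"
    using flux_nonneg[OF k(2,1)] ends(4) mult_pos_pos[of "(r l)\<^sup>2 * (norm (uu k l))\<^sup>2" "Re (inverse z)"]
    by (cases "uu k l = 0") auto
  then show False using v uu_vv_nonzero[OF ends(2), of k] by simp
qed

text \<open>A common zero gives u(l) = 0 and therefore flux 0 at l. But nonzero zeros of the
  impedance lie in the open upper half-plane, where the flux at l is negative. This prevents zeros
  of G from cancelling in the formula for the lip pressure.\<close>

lemma impedance_G_no_common_zero:
  assumes "k \<noteq> 0" "impedance (r l) k = 0"
  shows "G_fun l r k \<noteq> 0"
proof
  assume "G_fun l r k = 0"
  then have "uu k l = 0" using assms ends by (simp add: G_fun_eq_0_iff)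
  then have "flux k l = 0" by (simp add: flux_def)
  moreover have "0 < Im k" using Re_impedance_pos[of k] assms by force
  ultimately show False using flux_neg[of k] by simp
qed

text \<open>The amplitudes of the two waves exp(i k x) and exp(- i k x) contained in
  \<open>phi\<close>, both multiplied by exp(- i k x). For constant r, \<open>rot_D\<close> is
  identically 1 and \<open>rot_F\<close> is exp(- 2 i k x).\<close>

definition rot :: "complex \<Rightarrow> complex \<Rightarrow> real \<Rightarrow> complex" where
  "rot \<sigma> k x = (of_real (r x) * uu k x + \<sigma> * \<i> * (vv k x * of_real (1 / r x)) / k) * exp (- \<i> * k * of_real x) / of_real (r 0)"

abbreviation "rot_D \<equiv> rot (- 1)"
abbreviation "rot_F \<equiv> rot 1"

text \<open>With a = r u, b = v / r and h = r'/r, one has a' = b + h a and b' = - h b - k^2 a. The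
  opposite signs of h turn a + \<sigma> i b / k into the other amplitude, so h appears only as a
  coupling between the waves.\<close>

lemma rot_deriv:
  assumes k: "k \<noteq> 0" and x: "x \<in> {0<..<l}" and \<sigma>: "\<sigma> * \<sigma> = 1"
  shows "(rot \<sigma> k has_vector_derivative
    (- (1 + \<sigma>) * \<i> * k * rot \<sigma> k x + of_real (tract_deriv l r x / r x) * rot (- \<sigma>) k x)) (at x)"
proof -
  have xl: "x \<in> {0..l}" using x by auto
  have rx: "r x \<noteq> 0" using radius_pos[OF xl] by simp
  have da: "((\<lambda>x. of_real (r x) * uu k x) has_vector_derivative
      of_real (r x) * (vv k x / of_real ((r x)\<^sup>2)) + of_real (tract_deriv l r x) * uu k x) (at x)"
    using has_vector_derivative_mult[OF of_real_radius_deriv[OF xl] sturm_u_deriv[OF xl, of "k\<^sup>2"]]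
      at_within_Icc_interior[OF x] by simp
  have db: "((\<lambda>x. vv k x * of_real (1 / r x)) has_vector_derivative
      vv k x * of_real (- (tract_deriv l r x / (r x)\<^sup>2)) + - (k\<^sup>2 * of_real ((r x)\<^sup>2) * uu k x) * of_real (1 / r x)) (at x)"
    using has_vector_derivative_mult[OF sturm_v_deriv[OF xl, of "k\<^sup>2"] has_vector_derivative_of_real[OF inverse_radius_deriv[OF xl]]]
    unfolding at_within_Icc_interior[OF x] .
  have dE: "((\<lambda>x. exp (- \<i> * k * of_real x)) has_vector_derivative - \<i> * k * exp (- \<i> * k * of_real x)) (at x)"
    by (auto intro!: derivative_eq_intros has_vector_derivative_real_field)
  define E where "E = exp (- \<i> * k * of_real x)"
  define h where "h = complex_of_real (tract_deriv l r x / r x)"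
  define a where "a = of_real (r x) * uu k x"
  define b where "b = vv k x * of_real (1 / r x)"
  have "(rot \<sigma> k has_vector_derivative
     ((of_real (r x) * uu k x + \<sigma> * \<i> * (vv k x * of_real (1 / r x)) / k) * (- \<i> * k * E) +
      ((of_real (r x) * (vv k x / of_real ((r x)\<^sup>2)) + of_real (tract_deriv l r x) * uu k x)
       + \<sigma> * \<i> * (vv k x * of_real (- (tract_deriv l r x / (r x)\<^sup>2)) + - (k\<^sup>2 * of_real ((r x)\<^sup>2) * uu k x) * of_real (1 / r x)) / k) * E)
     / of_real (r 0)) (at x)"
    unfolding rot_def[abs_def] E_def
    by (intro has_vector_derivative_divide has_vector_derivative_mult has_vector_derivative_add
          has_vector_derivative_mult_right da db dE)
  moreover have "of_real (r x) * (vv k x / of_real ((r x)\<^sup>2)) + of_real (tract_deriv l r x) * uu k x = b + h * a"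
    "vv k x * of_real (- (tract_deriv l r x / (r x)\<^sup>2)) + - (k\<^sup>2 * of_real ((r x)\<^sup>2) * uu k x) * of_real (1 / r x) = - h * b - k\<^sup>2 * a"
    using rx by (simp_all add: a_def b_def h_def field_simps power2_eq_square)
  ultimately have "(rot \<sigma> k has_vector_derivative
     ((a + \<sigma> * \<i> * b / k) * (- \<i> * k * E) + (b + h * a + \<sigma> * \<i> * (- h * b - k\<^sup>2 * a) / k) * E) / of_real (r 0)) (at x)"
    by (simp only: a_def b_def)
  moreover have "(a + \<sigma> * \<i> * b / k) * (- \<i> * k * E) + (b + h * a + \<sigma> * \<i> * (- h * b - k\<^sup>2 * a) / k) * E
      = - (1 + \<sigma>) * \<i> * k * ((a + \<sigma> * \<i> * b / k) * E) + h * ((a + (- \<sigma>) * \<i> * b / k) * E)"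
  proof -
    define q where "q = b / k"
    have b: "b = q * k" using k by (simp add: q_def)
    have \<sigma>2: "\<sigma> * (\<sigma> * y) = y" for y using \<sigma> by (simp flip: mult.assoc)
    have eq: "s * \<i> * b / k = s * \<i> * q" "s * \<i> * (- h * b - k\<^sup>2 * a) / k = s * \<i> * (- h * q - k * a)" for s
      unfolding b using k by (simp_all add: field_simps power2_eq_square)
    show ?thesis unfolding eq unfolding b by (simp add: algebra_simps \<sigma>2)
  qed
  ultimately show ?thesis
    by (simp add: rot_def a_def b_def E_def h_def add_divide_distrib)
qed

lemma rotating: "rotating_system l (\<lambda>x. tract_deriv l r x / r x) rot_F rot_D"
proof
  show "0 < l" by (rule length_pos)
  have rnz: "x \<in> {0..l} \<Longrightarrow> r x \<noteq> 0" for x using radius_pos[of x] by simp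
  then show "continuous_on {0..l} (\<lambda>x. tract_deriv l r x / r x)"
    by (intro continuous_intros cont_radius cont_radius_deriv) auto
  fix k :: complex assume k: "k \<noteq> 0"
  have cont: "continuous_on {0..l} (rot \<sigma> k)" and "rot \<sigma> k 0 = 1" for \<sigma>
    unfolding rot_def[abs_def] using k ends(3) rnz
    by (auto intro!: continuous_intros cont_radius cont_uu cont_vv simp: sturm_uv_at_0)
  then show "continuous_on {0..l} (rot_F k)" "continuous_on {0..l} (rot_D k)" "rot_F k 0 = 1" "rot_D k 0 = 1"
    by blast+
  fix x assume "x \<in> {0<..<l}"
  from rot_deriv[OF k this, of 1] rot_deriv[OF k this, of "- 1"]
  show "(rot_D k has_vector_derivative of_real (tract_deriv l r x / r x) * rot_F k x) (at x)"
    "(rot_F k has_vector_derivative (- 2 * \<i> * k * rot_F k x + of_real (tract_deriv l r x / r x) * rot_D k x)) (at x)"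
    by simp_all
qed

text \<open>If the impedance were 1, the left side would be exactly \<open>rot_D\<close> at l. Its
  deviation from 1 multiplies the bounded difference of the amplitudes and vanishes at infinity in
  the lower half-plane.\<close>

lemma G_fun_rotating:
  assumes k: "k \<noteq> 0"
  shows "G_fun l r k * exp (- \<i> * k * of_real l) / (- \<i> * k)
    = rot_D k l + semicircle_transform (of_real (r l) * k) / 2 * (rot_F k l - rot_D k l)"
  unfolding G_fun_eq impedance_radius rot_def
  using k ends by (simp add: field_simps power2_eq_square)

lemma semicircle_transform_radius_tendsto: "((\<lambda>k. semicircle_transform (of_real (r l) * k)) \<longlongrightarrow> 0) lower"
proof -
  have "filterlim (\<lambda>k. of_real (r l) * k) lower lower"
    unfolding filterlim_inf filterlim_principal
  proof
    show "filterlim (\<lambda>k. complex_of_real (r l) * k) at_infinity lower"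
    proof (rule filterlim_mono[OF tendsto_mult_filterlim_at_infinity[OF tendsto_const _ filterlim_ident]])
      show "complex_of_real (r l) \<noteq> 0" using ends by simp
      show "lower \<le> at_infinity" by simp
    qed simp
    show "\<forall>\<^sub>F k in lower. complex_of_real (r l) * k \<in> {k. Im k \<le> 0}"
      unfolding eventually_lower using ends(4) by (intro exI[of _ 0]) (auto intro: mult_nonneg_nonpos)
  qed
  then show "((\<lambda>k. semicircle_transform (of_real (r l) * k)) \<longlongrightarrow> 0) lower"
    by (rule filterlim_compose[OF semicircle_transform_tendsto])
qed

lemma G_fun_asymptotic: "((\<lambda>k. G_fun l r k * exp (- \<i> * k * of_real l) / (- \<i> * k)) \<longlongrightarrow> 1) lower"
proof -
  interpret rotating_system l "\<lambda>x. tract_deriv l r x / r x" rot_F rot_D by (rule rotating)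
  obtain M where M: "1 \<le> M" "\<And>k x. k \<noteq> 0 \<Longrightarrow> Im k \<le> 0 \<Longrightarrow> x \<in> {0..l} \<Longrightarrow> norm (rot_F k x) \<le> M"
    "\<And>k x. k \<noteq> 0 \<Longrightarrow> Im k \<le> 0 \<Longrightarrow> x \<in> {0..l} \<Longrightarrow> norm (rot_D k x) \<le> M"
    using bounded_FD by metis
  have "((\<lambda>k. semicircle_transform (of_real (r l) * k) / 2 * (rot_F k l - rot_D k l)) \<longlongrightarrow> 0) lower"
  proof (rule Lim_null_comparison)
    show "\<forall>\<^sub>F k in lower. norm (semicircle_transform (of_real (r l) * k) / 2 * (rot_F k l - rot_D k l))
        \<le> norm (semicircle_transform (of_real (r l) * k)) * M"
      unfolding eventually_lower
    proof (intro exI[of _ 1] allI impI)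
      fix k :: complex assume k: "1 \<le> norm k" "Im k \<le> 0"
      then have "k \<noteq> 0" by auto
      then have "norm (rot_F k l - rot_D k l) \<le> M + M"
        using M(2)[of k l] M(3)[of k l] k ends(2) by (intro norm_triangle_le_diff add_mono) auto
      then have "norm (semicircle_transform (of_real (r l) * k) / 2) * norm (rot_F k l - rot_D k l)
          \<le> norm (semicircle_transform (of_real (r l) * k) / 2) * (M + M)"
        by (rule mult_left_mono) simp
      then show "norm (semicircle_transform (of_real (r l) * k) / 2 * (rot_F k l - rot_D k l))
        \<le> norm (semicircle_transform (of_real (r l) * k)) * M"
        by (simp add: norm_mult norm_divide)
    qed
    show "((\<lambda>k. norm (semicircle_transform (of_real (r l) * k)) * M) \<longlongrightarrow> 0) lower"
      using tendsto_mult_right[OF tendsto_norm[OF semicircle_transform_radius_tendsto], of M] by simp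
  qed
  from tendsto_add[OF D_tendsto this]
  have "((\<lambda>k. rot_D k l + semicircle_transform (of_real (r l) * k) / 2 * (rot_F k l - rot_D k l)) \<longlongrightarrow> 1) lower"
    by simp
  then show ?thesis
    by (rule Lim_transform_eventually) (rule eventually_mono[OF lower_nonzero], erule G_fun_rotating[symmetric])
qed

text \<open>The coefficients are (D + F) / 2 and (D - F) / 2 evaluated at - i t, where the
  amplitudes are under control. They can be used at i t because \<open>uu\<close> and
  \<open>vv\<close> depend on k^2; the impedance is not even in k and stays explicit.\<close>

lemma G_fun_imaginary:
  "\<exists>a b. (a \<longlongrightarrow> 1 / 2) at_top \<and> (b \<longlongrightarrow> 1 / 2) at_top \<and>
     (\<forall>t>0. G_fun l r (\<i> * of_real t) = of_real (t * exp (t * l)) *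
        (a t - impedance (r l) (\<i> * of_real t) * b t))"
proof -
  interpret rotating_system l "\<lambda>x. tract_deriv l r x / r x" rot_F rot_D by (rule rotating)
  define D where "D = (\<lambda>t. rot_D (- \<i> * of_real t) l)"
  define F where "F = (\<lambda>t. rot_F (- \<i> * of_real t) l)"
  have F: "(F \<longlongrightarrow> 0) at_top" unfolding F_def by (rule F_imaginary_tendsto)
  have D: "(D \<longlongrightarrow> 1) at_top"
    unfolding D_def by (rule filterlim_compose[OF D_tendsto negative_imaginary_lower])
  have "((\<lambda>t. (D t + F t) / 2) \<longlongrightarrow> (1 + 0) / 2) at_top" "((\<lambda>t. (D t - F t) / 2) \<longlongrightarrow> (1 - 0) / 2) at_top"
    by (intro tendsto_intros D F; simp)+
  moreover have "G_fun l r (\<i> * of_real t) = of_real (t * exp (t * l)) *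
        ((D t + F t) / 2 - impedance (r l) (\<i> * of_real t) * ((D t - F t) / 2))" if t: "0 < t" for t
  proof -
    define u where "u = uu (\<i> * of_real t) l"
    define v where "v = vv (\<i> * of_real t) l"
    define z where "z = impedance (r l) (\<i> * of_real t)"
    have sq: "(- (\<i> * complex_of_real t))\<^sup>2 = (\<i> * of_real t)\<^sup>2" by simp
    have e: "exp (- \<i> * (- \<i> * complex_of_real t) * of_real l) = of_real (exp (- (t * l)))"
      by (simp add: exp_of_real[symmetric])
    have ee: "complex_of_real (exp (t * l)) * of_real (exp (- (t * l))) = 1"
      by (simp flip: of_real_mult exp_add)
    have D': "D t = (of_real (r l) * u + v * of_real (1 / r l) / of_real t) * of_real (exp (- (t * l))) / of_real (r 0)"
      unfolding D_def rot_def e using t by (simp add: u_def v_def sq)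
    have F': "F t = (of_real (r l) * u - v * of_real (1 / r l) / of_real t) * of_real (exp (- (t * l))) / of_real (r 0)"
      unfolding F_def rot_def e using t by (simp add: u_def v_def sq)
    have "(D t + F t) / 2 = of_real (r l) * u / of_real (r 0) * of_real (exp (- (t * l)))"
      "(D t - F t) / 2 = v / (of_real (r l) * of_real t * of_real (r 0)) * of_real (exp (- (t * l)))"
      unfolding D' F' using t ends by (simp_all add: field_simps)
    then have "of_real (t * exp (t * l)) * ((D t + F t) / 2 - z * ((D t - F t) / 2))
      = of_real t * (complex_of_real (exp (t * l)) * of_real (exp (- (t * l)))) *
        (of_real (r l) * u / of_real (r 0) - z * (v / (of_real (r l) * of_real t * of_real (r 0))))"
      by (simp add: algebra_simps)
    also have "\<dots> = of_real t * (of_real (r l) * u / of_real (r 0) - z * (v / (of_real (r l) * of_real t * of_real (r 0))))"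
      unfolding ee by simp
    also have "\<dots> = - ((\<i> * (\<i> * of_real t) * (of_real (r l))\<^sup>2 * u + z * v) / of_real (r 0 * r l))"
      using t ends by (simp add: field_simps power2_eq_square)
    also have "\<dots> = G_fun l r (\<i> * of_real t)"
      unfolding G_fun_eq u_def v_def z_def ..
    finally show ?thesis by (simp add: z_def)
  qed
  ultimately show ?thesis by (intro exI[of _ "\<lambda>t. (D t + F t) / 2"] exI[of _ "\<lambda>t. (D t - F t) / 2"]) simp
qed

lemma impedance_imaginary:
  assumes "0 < t"
  obtains \<zeta> where "0 < \<zeta>" "impedance (r l) (\<i> * of_real t) = - of_real \<zeta>"
proof
  have t: "0 < r l * t" using assms ends by simp
  have eq: "of_real (r l) * (\<i> * of_real t) = \<i> * complex_of_real (r l * t)" by simp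
  show "0 < Re (semicircle_transform (of_real (r l) * (\<i> * of_real t))) - 1"
    unfolding eq using semicircle_transform_imaginary(2)[OF t] by simp
  show "impedance (r l) (\<i> * of_real t) = - of_real (Re (semicircle_transform (of_real (r l) * (\<i> * of_real t))) - 1)"
    unfolding impedance_radius eq using semicircle_transform_imaginary(1)[OF t] by (simp add: complex_eq_iff)
qed

section \<open>Analyticity of \<open>impedance\<close> and \<open>G_fun\<close>, and first-order
  behaviour at 0\<close>

lemma impedance_holomorphic: "impedance (r l) holomorphic_on UNIV"
  unfolding impedance_radius[abs_def]
  by (intro holomorphic_intros holomorphic_on_compose_gen[OF _ semicircle_transform_entire, unfolded o_def]) auto

lemma uu_holomorphic: "(\<lambda>k. uu k l) holomorphic_on UNIV"
  and vv_holomorphic: "(\<lambda>k. vv k l) holomorphic_on UNIV"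
proof -
  have sq: "(\<lambda>k::complex. k\<^sup>2) holomorphic_on UNIV" by (intro holomorphic_intros)
  show "(\<lambda>k. uu k l) holomorphic_on UNIV"
    using holomorphic_on_compose_gen[OF sq sturm_u_entire[OF ends(2)]] by (simp add: o_def)
  show "(\<lambda>k. vv k l) holomorphic_on UNIV"
    using holomorphic_on_compose_gen[OF sq sturm_v_entire[OF ends(2)]] by (simp add: o_def)
qed

lemma G_fun_holomorphic: "G_fun l r holomorphic_on UNIV"
  unfolding G_fun_eq[abs_def] using ends
  by (intro holomorphic_intros uu_holomorphic vv_holomorphic impedance_holomorphic) auto

lemma sturm_at_zero: "sturm_u (\<lambda>x. (r x)\<^sup>2) 0 l = 1" "sturm_v (\<lambda>x. (r x)\<^sup>2) 0 l = 0"
  by (simp_all add: sturm_u_def sturm_v_def powser_zero[of "\<lambda>n. complex_of_real ((-1) ^ n * sturm_term (\<lambda>x. (r x)\<^sup>2) (2 * n) l)", simplified])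

lemma impedance_0: "impedance (r l) 0 = 0"
  "(impedance (r l) has_field_derivative 8 * \<i> * of_real (r l) / of_real (3 * pi)) (at 0)"
proof -
  show "impedance (r l) 0 = 0" by (simp add: impedance_radius semicircle_transform_0)
  have 1: "(semicircle_transform has_field_derivative - (8 * \<i> / of_real (3 * pi))) (at (of_real (r l) * 0))"
    using semicircle_transform_0(2) by simp
  have 2: "((\<lambda>k. of_real (r l) * k) has_field_derivative complex_of_real (r l)) (at 0)"
    by (auto intro!: derivative_eq_intros)
  have "((\<lambda>k. 1 - semicircle_transform (of_real (r l) * k)) has_field_derivative
     0 - - (8 * \<i> / of_real (3 * pi)) * of_real (r l)) (at 0)"
    by (rule DERIV_diff[OF DERIV_const DERIV_chain2[OF 1 2]])
  then show "(impedance (r l) has_field_derivative 8 * \<i> * of_real (r l) / of_real (3 * pi)) (at 0)"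
    unfolding impedance_radius[abs_def] by simp
qed

text \<open>The product of impedance and \<open>vv\<close> has two factors vanishing at 0, so only
  the term i k r(l)^2 u contributes to first order.\<close>

lemma G_fun_0: "G_fun l r 0 = 0"
  "(G_fun l r has_field_derivative - (\<i> * of_real (r l / r 0))) (at 0)"
proof -
  show "G_fun l r 0 = 0" by (simp add: G_fun_eq sturm_at_zero)
  have "(\<lambda>k. uu k l) field_differentiable (at 0)" "(\<lambda>k. vv k l) field_differentiable (at 0)"
    using uu_holomorphic vv_holomorphic by (auto intro: holomorphic_on_imp_differentiable_at[OF _ open_UNIV])
  then obtain u' v' where d: "((\<lambda>k. uu k l) has_field_derivative u') (at 0)" "((\<lambda>k. vv k l) has_field_derivative v') (at 0)"
    by (auto simp: field_differentiable_def)
  have zero: "uu 0 l = 1" "vv 0 l = 0" using sturm_at_zero by simp_all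
  have "((\<lambda>k. - ((\<i> * (of_real (r l))\<^sup>2 * (k * uu k l) + impedance (r l) k * vv k l) / of_real (r 0 * r l))) has_field_derivative
     - ((\<i> * (of_real (r l))\<^sup>2 * (1 * uu 0 l + u' * 0) + (8 * \<i> * of_real (r l) / of_real (3 * pi) * vv 0 l + v' * impedance (r l) 0)) / of_real (r 0 * r l))) (at 0)"
    by (intro DERIV_minus DERIV_cdivide DERIV_add DERIV_cmult DERIV_mult DERIV_ident d impedance_0(2))
  moreover have "(\<lambda>k. - ((\<i> * (of_real (r l))\<^sup>2 * (k * uu k l) + impedance (r l) k * vv k l) / of_real (r 0 * r l))) = G_fun l r"
    by (rule ext) (simp add: G_fun_eq mult_ac)
  moreover have "- ((\<i> * (of_real (r l))\<^sup>2 * (1 * uu 0 l + u' * 0) + (8 * \<i> * of_real (r l) / of_real (3 * pi) * vv 0 l + v' * impedance (r l) 0)) / of_real (r 0 * r l))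
     = - (\<i> * of_real (r l / r 0))"
    using ends unfolding zero impedance_0 by (simp add: power2_eq_square)
  ultimately show "(G_fun l r has_field_derivative - (\<i> * of_real (r l / r 0))) (at 0)" by (simp only:)
qed

lemma G_fun_reflect: "G_fun l r (- cnj k) = cnj (G_fun l r k)"
proof -
  have sq: "(- cnj k)\<^sup>2 = cnj (k\<^sup>2)" by simp
  have z: "impedance (r l) (- cnj k) = cnj (impedance (r l) k)"
    using semicircle_transform_reflect[of "of_real (r l) * k"] by (simp add: impedance_radius)
  show ?thesis
    unfolding G_fun_eq sq z sturm_cnj[OF ends(2)] by simp
qed

end

section \<open>The pressure at the lips\<close>

lemma entire_eventually_nonzero:
  assumes f: "f holomorphic_on UNIV" and nz: "f \<beta> \<noteq> 0"
  shows "eventually (\<lambda>w. f w \<noteq> 0) (at z)"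
proof (cases "f z = 0")
  case True
  obtain e where e: "0 < e" "\<And>w. w \<in> ball z e - {z} \<Longrightarrow> f w \<noteq> 0"
    using isolated_zeros[OF f open_UNIV connected_UNIV UNIV_I True UNIV_I nz] by metis
  then show ?thesis
    unfolding eventually_at by (intro exI[of _ e]) (auto simp: dist_commute)
next
  case False
  have "isCont f z"
    using holomorphic_on_imp_continuous_on[OF f] by (simp add: continuous_on_eq_continuous_at)
  then show ?thesis using False by (rule tendsto_imp_eventually_ne[OF isContD])
qed

lemma entire_divide_at_zero:
  assumes f: "f holomorphic_on UNIV" and d: "(f has_field_derivative d) (at 0)" and z: "f 0 = 0"
  obtains g where "g holomorphic_on UNIV" "\<And>k. f k = k * g k" "g 0 = (d::complex)"
proof (rule that)
  show "(\<lambda>k. if k = 0 then deriv f 0 else (f k - f 0) / (k - 0)) holomorphic_on UNIV"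
    by (rule pole_lemma[OF f]) simp
qed (use z DERIV_imp_deriv[OF d] in auto)

context tract
begin

definition lip_quotient :: "real \<Rightarrow> real \<Rightarrow> complex \<Rightarrow> complex" where
  "lip_quotient c mu k = - (\<i> * of_real (c * mu / (pi * r 0 * r l))) * (k * impedance (r l) k) / G_fun l r k"

lemma impedance_eventually_nonzero: "eventually (\<lambda>w. impedance (r l) w \<noteq> 0) (at k)"
  by (rule entire_eventually_nonzero[OF impedance_holomorphic, of 1]) (use Re_impedance_pos[of 1] in auto)

lemma G_eventually_nonzero: "eventually (\<lambda>w. G_fun l r w \<noteq> 0) (at k)"
  by (rule entire_eventually_nonzero[OF G_fun_holomorphic, of 1]) (use G_nonzero_lower[of 1] in auto)

text \<open>The boundary value problem has a unique solution, with the explicit lip value, away from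
  the zeros of k, of the impedance and of G. These are isolated, and \<open>remove_sings\<close>
  depends only on punctured neighbourhoods.\<close>

lemma lip_pressure_eq: "lip_pressure c mu l r = remove_sings (lip_quotient c mu)"
proof
  fix k
  have "eventually (\<lambda>w::complex. w \<noteq> 0) (at k)" by (rule eventually_neq_at_within)
  then have "eventually (\<lambda>w. (if \<exists>!p. pressure_solution c mu l r w p
       then (THE p. pressure_solution c mu l r w p) l else 0) = lip_quotient c mu w) (at k)"
    using impedance_eventually_nonzero G_eventually_nonzero
  proof eventually_elim
    case (elim w)
    have ex: "\<exists>!p. pressure_solution c mu l r w p"
      using pressure_solution_exists[OF elim] pressure_solution_unique[OF _ _ elim(3)] by blast
    have "(THE p. pressure_solution c mu l r w p) l = lip_quotient c mu w"
      using pressure_solution_lip[OF theI'[OF ex] elim(3)] by (simp add: lip_quotient_def mult_ac)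
    then show ?case using ex by simp
  qed
  then show "lip_pressure c mu l r k = remove_sings (lip_quotient c mu) k"
    unfolding pressure_def by (rule remove_sings_cong) simp
qed

lemma lip_quotient_meromorphic: "lip_quotient c mu meromorphic_on A"
proof -
  have "G_fun l r meromorphic_on UNIV" "impedance (r l) meromorphic_on UNIV"
    by (intro analytic_on_imp_meromorphic_on; simp add: analytic_on_open G_fun_holomorphic impedance_holomorphic)+
  then have "lip_quotient c mu meromorphic_on UNIV"
    unfolding lip_quotient_def[abs_def] by (intro meromorphic_intros) auto
  then show ?thesis by (rule meromorphic_on_subset) simp
qed

lemma lip_pressure_meromorphic: "lip_pressure c mu l r meromorphic_on UNIV"
  unfolding lip_pressure_eq by (rule remove_sings_meromorphic[OF lip_quotient_meromorphic])

lemma lip_pressure_eventually_eq: "eventually (\<lambda>w. lip_pressure c mu l r w = lip_quotient c mu w) (at k)"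
  unfolding fun_cong[OF lip_pressure_eq]
  by (rule eventually_remove_sings_eq_at)
     (rule meromorphic_on_isolated_singularity[OF lip_quotient_meromorphic[of c mu "{k}"]])

text \<open>The numerator carries two factors k, one explicit and one from the impedance, against a
  single one in G; this leaves a simple zero. The stated modulus is the slope 8 r(l) / (3 pi) of the
  impedance over the slope r(l) / r(0) of G.\<close>

lemma lip_quotient_at_zero:
  obtains g h where "g holomorphic_on UNIV" "\<And>k. k \<noteq> 0 \<Longrightarrow> G_fun l r k = k * g k" "g 0 \<noteq> 0"
    "h holomorphic_on UNIV" "h 0 \<noteq> 0"
    "\<And>k. lip_quotient c mu k = - (\<i> * of_real (c * mu / (pi * r 0 * r l))) * h k / g k * k"
    "norm (h 0 / g 0) = 8 * r 0 / (3 * pi)"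
proof -
  obtain g where g: "g holomorphic_on UNIV" "\<And>k. G_fun l r k = k * g k" "g 0 = - (\<i> * of_real (r l / r 0))"
    using entire_divide_at_zero[OF G_fun_holomorphic G_fun_0(2,1)] by metis
  obtain h where h: "h holomorphic_on UNIV" "\<And>k. impedance (r l) k = k * h k" "h 0 = 8 * \<i> * of_real (r l) / of_real (3 * pi)"
    using entire_divide_at_zero[OF impedance_holomorphic impedance_0(2,1)] by metis
  show thesis
  proof (rule that[OF g(1) _ _ h(1)])
    show "g 0 \<noteq> 0" "h 0 \<noteq> 0" using ends by (simp_all add: g h)
    show "norm (h 0 / g 0) = 8 * r 0 / (3 * pi)"
      using ends by (simp add: g h norm_divide norm_mult)
    \<comment> \<open>At k = 0 both sides are 0, the left one by the convention 0 / 0 = 0; this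
      makes the quotient itself analytic at the origin.\<close>
    show "lip_quotient c mu k = - (\<i> * of_real (c * mu / (pi * r 0 * r l))) * h k / g k * k" for k
      unfolding lip_quotient_def g(2) h(2) by (cases "k = 0") (simp_all add: mult_ac)
  qed (rule g(2))
qed

lemma lip_quotient_analytic:
  assumes "k = 0 \<or> G_fun l r k \<noteq> 0"
  shows "lip_quotient c mu analytic_on {k}"
proof -
  obtain g h where g: "g holomorphic_on UNIV" "\<And>k. k \<noteq> 0 \<Longrightarrow> G_fun l r k = k * g k" "g 0 \<noteq> 0"
    and h: "h holomorphic_on UNIV"
    and eq: "\<And>k. lip_quotient c mu k = - (\<i> * of_real (c * mu / (pi * r 0 * r l))) * h k / g k * k"
    using lip_quotient_at_zero[of c mu] by metis
  have gk: "g k \<noteq> 0" using assms g(2)[of k] g(3) by (cases "k = 0") auto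
  have "g analytic_on {k}" "h analytic_on {k}" using g(1) h(1) by (auto simp: analytic_at intro!: exI[of _ UNIV])
  then show ?thesis unfolding eq[abs_def] using gk by (intro analytic_intros) auto
qed

lemma lip_pressure_value:
  assumes "k = 0 \<or> G_fun l r k \<noteq> 0"
  shows "lip_pressure c mu l r k = lip_quotient c mu k"
  unfolding fun_cong[OF lip_pressure_eq] by (rule remove_sings_at_analytic[OF lip_quotient_analytic[OF assms]])

text \<open>The numerator is nonzero at a nonzero zero of G, because impedance and G share no such
  zero. Hence the order of the pole is the order of the zero.\<close>

lemma lip_quotient_pole:
  assumes k: "k \<noteq> 0" and c: "0 < c" "0 < mu" and G: "G_fun l r k = 0"
  shows "is_pole (lip_quotient c mu) k" "zorder (lip_quotient c mu) k = - zorder (G_fun l r) k"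
proof -
  define f where "f = (\<lambda>k. - (\<i> * of_real (c * mu / (pi * r 0 * r l))) * (k * impedance (r l) k))"
  have f: "f holomorphic_on UNIV" unfolding f_def by (intro holomorphic_intros impedance_holomorphic)
  have "impedance (r l) k \<noteq> 0" using impedance_G_no_common_zero[OF k] G by blast
  then have fk: "f k \<noteq> 0" using k c ends by (simp add: f_def)
  have eq: "lip_quotient c mu = (\<lambda>k. f k / G_fun l r k)" by (auto simp: f_def lip_quotient_def)
  have contf: "isCont f k" and contG: "isCont (G_fun l r) k"
    using holomorphic_on_imp_continuous_on[OF f] holomorphic_on_imp_continuous_on[OF G_fun_holomorphic]
    by (simp_all add: continuous_on_eq_continuous_at)
  have "filterlim (G_fun l r) (at 0) (at k)"
    using contG G G_eventually_nonzero by (simp add: filterlim_at isCont_def)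
  then show "is_pole (lip_quotient c mu) k"
    unfolding eq by (rule is_pole_divide[OF contf _ fk])
  have an: "f analytic_on {k}" "G_fun l r analytic_on {k}"
    using f G_fun_holomorphic by (auto simp: analytic_at intro!: exI[of _ UNIV])
  have fr: "frequently (\<lambda>w. f w \<noteq> 0) (at k)" "frequently (\<lambda>w. G_fun l r w \<noteq> 0) (at k)"
    by (intro eventually_frequently entire_eventually_nonzero[OF f fk] G_eventually_nonzero; simp)+
  have "zorder (lip_quotient c mu) k = zorder f k - zorder (G_fun l r) k"
    unfolding eq by (intro zorder_divide fr analytic_on_imp_meromorphic_on an)
  moreover have "zorder f k = 0" using zorder_eq_0_iff[OF an(1) fr(1)] fk by simp
  ultimately show "zorder (lip_quotient c mu) k = - zorder (G_fun l r) k" by simp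
qed

lemma lip_pressure_pole:
  assumes k: "k \<noteq> 0" and c: "0 < c" "0 < mu"
  shows "is_pole (lip_pressure c mu l r) k \<longleftrightarrow> G_fun l r k = 0"
    and "G_fun l r k = 0 \<Longrightarrow> - zorder (lip_pressure c mu l r) k = zorder (G_fun l r) k"
proof -
  have "is_pole (lip_pressure c mu l r) k \<longleftrightarrow> is_pole (lip_quotient c mu) k"
    by (rule is_pole_cong[OF lip_pressure_eventually_eq refl])
  moreover have "\<not> is_pole (lip_quotient c mu) k" if "G_fun l r k \<noteq> 0"
    using lip_quotient_analytic[of k] that analytic_at_imp_no_pole by blast
  ultimately show "is_pole (lip_pressure c mu l r) k \<longleftrightarrow> G_fun l r k = 0"
    using lip_quotient_pole(1)[OF assms] by blast
  have "zorder (lip_pressure c mu l r) k = zorder (lip_quotient c mu) k"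
    by (rule zorder_cong[OF lip_pressure_eventually_eq refl])
  then show "G_fun l r k = 0 \<Longrightarrow> - zorder (lip_pressure c mu l r) k = zorder (G_fun l r) k"
    using lip_quotient_pole(2)[OF assms] by simp
qed

lemma lip_pressure_zero:
  assumes c: "0 < c" "0 < mu"
  shows "isolated_zero (lip_pressure c mu l r) 0" "zorder (lip_pressure c mu l r) 0 = 1"
proof -
  obtain g h where g: "g holomorphic_on UNIV" "g 0 \<noteq> 0"
    and h: "h holomorphic_on UNIV" "h 0 \<noteq> 0"
    and eq: "\<And>k. lip_quotient c mu k = - (\<i> * of_real (c * mu / (pi * r 0 * r l))) * h k / g k * k"
    using lip_quotient_at_zero[of c mu] by metis
  have "isCont (lip_quotient c mu) 0"
    using lip_quotient_analytic[of 0] by (intro analytic_at_imp_isCont) simp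
  then have "lip_quotient c mu \<midarrow>0\<rightarrow> 0" by (simp add: isCont_def lip_quotient_def)
  moreover have "eventually (\<lambda>k. lip_quotient c mu k \<noteq> 0) (at 0)"
    using impedance_eventually_nonzero[of 0] G_eventually_nonzero[of 0] eventually_neq_at_within[of 0 0 UNIV]
    by eventually_elim (use c ends in \<open>simp add: lip_quotient_def\<close>)
  ultimately have "isolated_zero (lip_quotient c mu) 0" by (simp add: isolated_zero_def)
  then show "isolated_zero (lip_pressure c mu l r) 0"
    unfolding lip_pressure_eq
    by (subst isolated_zero_remove_sings_iff)
       (rule meromorphic_on_isolated_singularity[OF lip_quotient_meromorphic[of c mu "{0}"]])
  have "zorder (lip_quotient c mu) 0 = 1"
  proof (rule zorder_eqI)
    have "continuous_on UNIV g" by (rule holomorphic_on_imp_continuous_on[OF g(1)])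
    then have "open (g -` (- {0}))" by (intro open_vimage) auto
    then show "open {k. g k \<noteq> 0}" by (simp add: vimage_def)
    show "(\<lambda>k. - (\<i> * of_real (c * mu / (pi * r 0 * r l))) * h k / g k) holomorphic_on {k. g k \<noteq> 0}"
      by (intro holomorphic_intros holomorphic_on_subset[OF g(1)] holomorphic_on_subset[OF h(1)]) auto
    show "- (\<i> * of_real (c * mu / (pi * r 0 * r l))) * h 0 / g 0 \<noteq> 0"
      using g(2) h(2) c ends by simp
    show "lip_quotient c mu w = - (\<i> * of_real (c * mu / (pi * r 0 * r l))) * h w / g w * (w - 0) powi 1" for w
      unfolding eq by simp
  qed (use g in auto)
  then show "zorder (lip_pressure c mu l r) 0 = 1"
    using zorder_cong[OF lip_pressure_eventually_eq refl] by simp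
qed

section \<open>Modulus of the lip pressure on the real axis and its two limits\<close>

lemma norm_lip_pressure_real:
  assumes k: "k \<noteq> 0" and c: "0 < c" "0 < mu"
  shows "norm (lip_pressure c mu l r (of_real k)) =
     c * mu / (pi * r 0 * r l) * (\<bar>k\<bar> * norm (impedance (r l) (of_real k))) / norm (G_fun l r (of_real k))"
proof -
  have "G_fun l r (of_real k) \<noteq> 0" using G_nonzero_lower[of "of_real k"] k by simp
  then show ?thesis
    using c ends by (simp add: lip_pressure_value lip_quotient_def norm_mult norm_divide abs_mult)
qed

lemma of_real_lower: "filterlim complex_of_real lower at_top"
  unfolding filterlim_inf filterlim_principal by (simp add: filterlim_of_real_at_infinity)

lemma norm_lip_pressure_at_top:
  assumes c: "0 < c" "0 < mu"
  shows "((\<lambda>k. norm (lip_pressure c mu l r (of_real k))) \<longlongrightarrow> c * mu / (pi * r 0 * r l)) at_top"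
proof -
  from filterlim_compose[OF semicircle_transform_radius_tendsto of_real_lower]
  have "((\<lambda>k. norm (impedance (r l) (complex_of_real k))) \<longlongrightarrow> norm (1 - 0 :: complex)) at_top"
    unfolding impedance_radius by (intro tendsto_intros)
  moreover have "((\<lambda>k. norm (G_fun l r (of_real k) * exp (- \<i> * of_real k * of_real l) / (- \<i> * of_real k))) \<longlongrightarrow> norm (1::complex)) at_top"
    by (rule tendsto_norm[OF filterlim_compose[OF G_fun_asymptotic of_real_lower]])
  ultimately have "((\<lambda>k. c * mu / (pi * r 0 * r l) * (norm (impedance (r l) (complex_of_real k)) /
      norm (G_fun l r (of_real k) * exp (- \<i> * of_real k * of_real l) / (- \<i> * of_real k)))) \<longlongrightarrow>
      c * mu / (pi * r 0 * r l) * (norm (1 - 0 :: complex) / norm (1::complex))) at_top"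
    by (intro tendsto_mult tendsto_divide tendsto_const) auto
  then have lim: "((\<lambda>k. c * mu / (pi * r 0 * r l) * (norm (impedance (r l) (complex_of_real k)) /
      norm (G_fun l r (of_real k) * exp (- \<i> * of_real k * of_real l) / (- \<i> * of_real k)))) \<longlongrightarrow>
      c * mu / (pi * r 0 * r l)) at_top" by simp
  show ?thesis
  proof (rule Lim_transform_eventually[OF lim])
    show "\<forall>\<^sub>F k in at_top. c * mu / (pi * r 0 * r l) * (norm (impedance (r l) (complex_of_real k)) /
      norm (G_fun l r (of_real k) * exp (- \<i> * of_real k * of_real l) / (- \<i> * of_real k)))
      = norm (lip_pressure c mu l r (of_real k))"
      using eventually_gt_at_top[of 0]
    proof eventually_elim
      case (elim k)
      have "norm (exp (- \<i> * of_real k * of_real l)) = 1" by simp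
      then have "norm (G_fun l r (of_real k) * exp (- \<i> * of_real k * of_real l) / (- \<i> * of_real k)) = norm (G_fun l r (of_real k)) / k"
        using elim by (simp only: norm_mult norm_divide) simp
      then show ?case using elim by (simp only: norm_lip_pressure_real[OF less_imp_neq[OF elim, symmetric] c]) simp
    qed
  qed
qed

lemma norm_lip_pressure_at_0:
  assumes c: "0 < c" "0 < mu"
  shows "((\<lambda>k. norm (lip_pressure c mu l r (of_real k)) / k) \<longlongrightarrow> 8 * c * mu / (3 * pi\<^sup>2 * r l)) (at_right 0)"
proof -
  obtain g h where g: "g holomorphic_on UNIV" "g 0 \<noteq> 0"
    and h: "h holomorphic_on UNIV"
    and eq: "\<And>k. lip_quotient c mu k = - (\<i> * of_real (c * mu / (pi * r 0 * r l))) * h k / g k * k"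
    and v: "norm (h 0 / g 0) = 8 * r 0 / (3 * pi)"
    using lip_quotient_at_zero[of c mu] by metis
  have cont: "isCont g 0" "isCont h 0"
    using holomorphic_on_imp_continuous_on[OF g(1)] holomorphic_on_imp_continuous_on[OF h(1)]
    by (simp_all add: continuous_on_eq_continuous_at)
  have "((\<lambda>k. complex_of_real k) \<longlongrightarrow> 0) (at_right 0)"
    using tendsto_of_real[OF tendsto_ident_at[of "0::real" "{0<..}"]] by simp
  then have "((\<lambda>k. g (of_real k)) \<longlongrightarrow> g 0) (at_right 0)" "((\<lambda>k. h (of_real k)) \<longlongrightarrow> h 0) (at_right 0)"
    using cont by (auto intro: isCont_tendsto_compose)
  then have "((\<lambda>k. c * mu / (pi * r 0 * r l) * norm (h (of_real k) / g (of_real k))) \<longlongrightarrow>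
      c * mu / (pi * r 0 * r l) * norm (h 0 / g 0)) (at_right 0)"
    using g(2) by (intro tendsto_intros)
  moreover have "c * mu / (pi * r 0 * r l) * norm (h 0 / g 0) = 8 * c * mu / (3 * pi\<^sup>2 * r l)"
    unfolding v using ends by (simp add: field_simps power2_eq_square)
  ultimately have lim: "((\<lambda>k. c * mu / (pi * r 0 * r l) * norm (h (of_real k) / g (of_real k))) \<longlongrightarrow> 8 * c * mu / (3 * pi\<^sup>2 * r l)) (at_right 0)"
    by simp
  show ?thesis
  proof (rule Lim_transform_eventually[OF lim])
    show "\<forall>\<^sub>F k in at_right 0. c * mu / (pi * r 0 * r l) * norm (h (of_real k) / g (of_real k)) = norm (lip_pressure c mu l r (of_real k)) / k"
      using eventually_at_right_less[of 0]
    proof eventually_elim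
      case (elim k)
      then have "G_fun l r (of_real k) \<noteq> 0" using G_nonzero_lower[of "of_real k"] by simp
      then have "norm (lip_pressure c mu l r (of_real k)) = c * mu / (pi * r 0 * r l) * norm (h (of_real k) / g (of_real k)) * k"
        using elim c ends by (simp add: lip_pressure_value eq norm_mult norm_divide abs_mult)
      then show ?case using elim by simp
    qed
  qed
qed

end

section \<open>Recovery from the modulus of the pressure\<close>

text \<open>The maximum modulus principle on the half discs \<open>{k. Im k < 0 \<and> norm k < R}\<close>.\<close>

lemma lower_half_plane_bound:
  assumes T: "open T" "{k. Im k \<le> 0} \<subseteq> T" and H: "H holomorphic_on T"
    and real: "\<And>k::real. norm (H (of_real k)) \<le> 1" and lim: "(H \<longlongrightarrow> 1) lower"
    and \<xi>: "Im \<xi> < 0"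
  shows "norm (H \<xi>) \<le> 1"
proof (rule field_le_epsilon)
  fix \<epsilon> :: real assume "0 < \<epsilon>"
  then have "eventually (\<lambda>k. dist (H k) 1 < \<epsilon>) lower" by (rule tendstoD[OF lim])
  then obtain R where R: "\<And>k. R \<le> norm k \<Longrightarrow> Im k \<le> 0 \<Longrightarrow> dist (H k) 1 < \<epsilon>"
    unfolding eventually_lower by blast
  \<comment> \<open>The radius exceeds |\<xi>|, so the half disc contains \<xi>, and exceeds R, so H
    is within \<epsilon> of 1 on the arc.\<close>
  define B where "B = max R (norm \<xi>) + 1"
  define S where "S = {k. Im k < 0} \<inter> ball 0 B"
  have open_S: "open S" unfolding S_def by (intro open_Int open_halfspace_Im_lt open_ball)
  have "closure S \<subseteq> {k. Im k \<le> 0} \<inter> cball 0 B"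
    by (rule closure_minimal) (auto simp: S_def intro: closed_Int closed_halfspace_Im_le)
  then have cl: "closure S \<subseteq> {k. Im k \<le> 0}" "closure S \<subseteq> cball 0 B" by auto
  show "norm (H \<xi>) \<le> 1 + \<epsilon>"
  proof (rule maximum_modulus_frontier[where f = H and S = S])
    show "H holomorphic_on interior S"
      unfolding interior_open[OF open_S] using T(2) by (intro holomorphic_on_subset[OF H]) (auto simp: S_def)
    show "continuous_on (closure S) H"
      using T(2) cl(1) by (intro holomorphic_on_imp_continuous_on holomorphic_on_subset[OF H]) auto
    show "bounded S" unfolding S_def by (intro bounded_Int) auto
    show "\<xi> \<in> S" using \<xi> by (auto simp: S_def B_def)
    fix z assume "z \<in> frontier S"
    then have z: "z \<in> closure S" "z \<notin> S" using open_S by (auto simp: frontier_def interior_open)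
    then have z': "Im z \<le> 0" "norm z \<le> B" using cl by auto
    then have "Im z = 0 \<or> norm z = B" using z(2) by (auto simp: S_def)
    then show "norm (H z) \<le> 1 + \<epsilon>"
    proof
      assume "Im z = 0"
      then have "z = of_real (Re z)" by (simp add: complex_eq_iff)
      then have "norm (H z) \<le> 1" using real[of "Re z"] by simp
      then show ?thesis using \<open>0 < \<epsilon>\<close> by simp
    next
      assume "norm z = B"
      then have "dist (H z) 1 < \<epsilon>" using R z' by (auto simp: B_def)
      then have "norm (H z - 1) < \<epsilon>" by (simp add: dist_norm)
      moreover have "norm (H z) \<le> norm (H z - 1) + norm (1::complex)"
        using norm_triangle_ineq[of "H z - 1" 1] by simp
      ultimately show ?thesis by simp
    qed
  qed
qed

text \<open>The quotients f / g and g / f are holomorphic near the closed half-plane, of modulus 1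
  on the real axis and with limit 1, so both are bounded by 1. Hence |f / g| = 1 throughout, the
  quotient is constant, its value is the limit 1, and the identity theorem extends f = g to the
  whole plane.\<close>

lemma lower_half_plane_unique:
  assumes f: "f holomorphic_on UNIV" and g: "g holomorphic_on UNIV"
    and f_nz: "\<And>k. Im k \<le> 0 \<Longrightarrow> f k \<noteq> 0" and g_nz: "\<And>k. Im k \<le> 0 \<Longrightarrow> g k \<noteq> 0"
    and real: "\<And>k::real. norm (f (of_real k)) = norm (g (of_real k))"
    and f_lim: "(f \<longlongrightarrow> c) lower" and g_lim: "(g \<longlongrightarrow> c) lower" and c: "c \<noteq> 0"
  shows "f k = g k"
proof -
  have open_nz: "open {k. h k \<noteq> 0}" if "h holomorphic_on UNIV" for h :: "complex \<Rightarrow> complex"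
  proof -
    have "open (h -` (- {0}))"
      by (intro open_vimage holomorphic_on_imp_continuous_on[OF that]) auto
    then show ?thesis by (simp add: vimage_def)
  qed
  \<comment> \<open>Stated for arbitrary functions because it is applied with f and g in both
    orders.\<close>
  have le: "norm (f k / g k) \<le> 1"
    if "f holomorphic_on UNIV" "g holomorphic_on UNIV" "\<And>k. Im k \<le> 0 \<Longrightarrow> g k \<noteq> 0"
      "\<And>k::real. norm (f (of_real k)) = norm (g (of_real k))" "(f \<longlongrightarrow> c) lower" "(g \<longlongrightarrow> c) lower" "Im k < 0"
    for f g k
  proof (rule lower_half_plane_bound[OF open_nz[OF that(2)] _ _ _ _ that(7)])
    show "{k. Im k \<le> 0} \<subseteq> {k. g k \<noteq> 0}" using that(3) by auto
    show "(\<lambda>k. f k / g k) holomorphic_on {k. g k \<noteq> 0}"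
      by (intro holomorphic_on_divide holomorphic_on_subset[OF that(1)] holomorphic_on_subset[OF that(2)]) auto
    show "norm (f (of_real k) / g (of_real k)) \<le> 1" for k :: real
      by (simp add: norm_divide that(4))
    show "((\<lambda>k. f k / g k) \<longlongrightarrow> 1) lower"
      using tendsto_divide[OF that(5,6) c] c by simp
  qed
  define S where "S = {k. Im k < (0::real)}"
  have S: "open S" "connected S" "- \<i> \<in> S"
    unfolding S_def by (simp_all add: open_halfspace_Im_lt convex_halfspace_Im_lt convex_connected)
  have norm1: "norm (f k / g k) = 1" if "k \<in> S" for k
  proof -
    have k: "Im k < 0" using that by (simp add: S_def)
    have "norm (f k / g k) \<le> 1" by (rule le[OF f g g_nz real f_lim g_lim k])
    moreover have "norm (g k / f k) \<le> 1" by (rule le[OF g f f_nz real[symmetric] g_lim f_lim k])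
    ultimately show ?thesis using f_nz[of k] g_nz[of k] k by (simp add: norm_divide divide_le_eq_1)
  qed
  have "(\<lambda>k. f k / g k) constant_on S"
  proof (rule maximum_modulus_principle[OF _ S(1,2) S(1) subset_refl S(3)])
    show "(\<lambda>k. f k / g k) holomorphic_on S"
      using g_nz by (intro holomorphic_on_divide holomorphic_on_subset[OF f] holomorphic_on_subset[OF g]) (auto simp: S_def)
    show "norm (f z / g z) \<le> norm (f (- \<i>) / g (- \<i>))" if "z \<in> S" for z
      using norm1[OF that] norm1[OF S(3)] by simp
  qed
  then obtain d where d: "\<And>k. k \<in> S \<Longrightarrow> f k / g k = d" unfolding constant_on_def by blast
  have "((\<lambda>k. f k / g k) \<longlongrightarrow> 1) lower" using tendsto_divide[OF f_lim g_lim c] c by simp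
  then have "((\<lambda>t. f (- \<i> * of_real t) / g (- \<i> * of_real t)) \<longlongrightarrow> 1) at_top"
    by (rule filterlim_compose[OF _ negative_imaginary_lower])
  moreover have "eventually (\<lambda>t. f (- \<i> * of_real t) / g (- \<i> * of_real t) = d) at_top"
    using eventually_gt_at_top[of 0] by eventually_elim (rule d, simp add: S_def)
  ultimately have "((\<lambda>t::real. d) \<longlongrightarrow> 1) at_top" by (rule Lim_transform_eventually)
  then have "d = 1" by (simp add: tendsto_const_iff)
  show ?thesis
  proof (rule analytic_continuation_open[OF S(1) open_UNIV _ connected_UNIV _ f g _ UNIV_I])
    show "f z = g z" if "z \<in> S" for z
      using d[OF that] \<open>d = 1\<close> g_nz[of z] that by (simp add: S_def)
  qed (use S in auto)
qed

context tract
begin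

text \<open>On the positive imaginary axis the growth of \<open>G\<close> exceeds that of the impedance by \<open>exp (t * l)\<close>,
  which reveals the length.\<close>

lemma length_le:
  assumes "tract l' r'" and rl: "r' l' = r l"
    and G: "\<And>k. G_fun l r k * exp (- \<i> * k * of_real l) = G_fun l' r' k * exp (- \<i> * k * of_real l')"
  shows "l \<le> l'"
proof (rule ccontr)
  interpret t': tract l' r' by fact
  assume "\<not> l \<le> l'"
  then have less: "l' < l" by simp
  obtain a b where a: "(a \<longlongrightarrow> 1 / 2) at_top" and b: "(b \<longlongrightarrow> 1 / 2) at_top"
    and ab: "\<And>t. t > 0 \<Longrightarrow> G_fun l r (\<i> * of_real t) = of_real (t * exp (t * l)) * (a t - impedance (r l) (\<i> * of_real t) * b t)"
    using G_fun_imaginary by blast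
  obtain a' b' where a': "(a' \<longlongrightarrow> 1 / 2) at_top" and b': "(b' \<longlongrightarrow> 1 / 2) at_top"
    and ab': "\<And>t. t > 0 \<Longrightarrow> G_fun l' r' (\<i> * of_real t) = of_real (t * exp (t * l')) * (a' t - impedance (r l) (\<i> * of_real t) * b' t)"
    using t'.G_fun_imaginary unfolding rl by blast
  have Re: "((\<lambda>t. Re (a t)) \<longlongrightarrow> 1 / 2) at_top" "((\<lambda>t. Re (b t)) \<longlongrightarrow> 1 / 2) at_top"
    "((\<lambda>t. Re (a' t)) \<longlongrightarrow> 1 / 2) at_top" "((\<lambda>t. Re (b' t)) \<longlongrightarrow> 1 / 2) at_top"
    using tendsto_Re[OF a] tendsto_Re[OF b] tendsto_Re[OF a'] tendsto_Re[OF b'] by simp_all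
  \<comment> \<open>With coefficients above 1/4 for one tract and below 3/4 for the other, Re A' < 3
    Re A whatever the size of \<zeta>. On the other hand t > 1 / (l - l') gives exp(t (l - l')) >=
    2, whose square exceeds 3.\<close>
  have "eventually (\<lambda>t. 1 / 4 < Re (a t)) at_top" "eventually (\<lambda>t. 1 / 4 < Re (b t)) at_top"
    "eventually (\<lambda>t. Re (a' t) < 3 / 4) at_top" "eventually (\<lambda>t. Re (b' t) < 3 / 4) at_top"
    by (intro order_tendstoD(1)[OF Re(1)] order_tendstoD(1)[OF Re(2)] order_tendstoD(2)[OF Re(3)] order_tendstoD(2)[OF Re(4)]; simp)+
  then have "eventually (\<lambda>t::real. False) at_top"
    using eventually_gt_at_top[of 0] eventually_gt_at_top[of "1 / (l - l')"]
  proof eventually_elim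
    case (elim t)
    obtain \<zeta> where \<zeta>: "0 < \<zeta>" "impedance (r l) (\<i> * of_real t) = - of_real \<zeta>"
      using impedance_imaginary[OF elim(5)] by metis
    define A where "A = a t + of_real \<zeta> * b t"
    define A' where "A' = a' t + of_real \<zeta> * b' t"
    \<comment> \<open>At k = i t the normalising factor is exp(t l) and joins the growth exp(t l) of
      G, which is why squares of exponentials are compared.\<close>
    have e: "exp (- \<i> * (\<i> * of_real t) * of_real s) = of_real (exp (t * s))" for s
      by (simp add: exp_of_real[symmetric])
    have "of_real (t * exp (t * l)) * A * of_real (exp (t * l)) = of_real (t * exp (t * l')) * A' * of_real (exp (t * l'))"
      using G[of "\<i> * of_real t"] unfolding ab[OF elim(5)] ab'[OF elim(5)] e \<zeta>(2) A_def A'_def by simp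
    then have "of_real (t * exp (t * l) * exp (t * l)) * A = of_real (t * exp (t * l') * exp (t * l')) * A'"
      by (simp only: of_real_mult mult_ac)
    moreover have "Re (of_real x * B) = x * Re B" for x B by simp
    ultimately have "t * exp (t * l) * exp (t * l) * Re A = t * exp (t * l') * exp (t * l') * Re A'"
      by metis
    then have eq: "(exp (t * l))\<^sup>2 * Re A = (exp (t * l'))\<^sup>2 * Re A'"
      using elim(5) by (simp add: power2_eq_square)
    have "exp (t * l) = exp (t * l') * exp (t * (l - l'))" by (simp add: algebra_simps flip: exp_add)
    then have "(exp (t * l'))\<^sup>2 * ((exp (t * (l - l')))\<^sup>2 * Re A) = (exp (t * l'))\<^sup>2 * Re A'"
      using eq by (simp add: power_mult_distrib mult.assoc)
    then have eq2: "(exp (t * (l - l')))\<^sup>2 * Re A = Re A'" by simp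
    have "1 < t * (l - l')" using elim(6) less by (simp add: field_simps)
    then have "2 \<le> exp (t * (l - l'))" using exp_ge_add_one_self[of "t * (l - l')"] by linarith
    then have "3 \<le> (exp (t * (l - l')))\<^sup>2" using power_mono[of 2 "exp (t * (l - l'))" 2] by simp
    moreover have A: "1 / 4 + \<zeta> * (1 / 4) < Re A" "Re A' < 3 / 4 + \<zeta> * (3 / 4)"
      using elim \<zeta>(1) by (auto simp: A_def A'_def intro!: add_strict_mono)
    ultimately have "3 * Re A \<le> Re A'"
      unfolding eq2[symmetric] using \<zeta>(1) by (intro mult_right_mono) auto
    then show False using A by simp
  qed
  then show False by simp
qed

end

text \<open>The order matters: the limit at 0 contains only r(l), and the limit at infinity then
  gives r(0). With the impedance and the prefactor known, |P| yields |G| on the positive axis.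
  Reflection gives the negative axis, and the half-plane argument gives G up to the factor exp(- i k
  l).\<close>

lemma tract_determined:
  assumes t: "tract l r" "tract l' r'" and c: "0 < c" "0 < mu"
    and P: "\<And>k. 0 < k \<Longrightarrow> norm (lip_pressure c mu l r (of_real k)) = norm (lip_pressure c mu l' r' (of_real k))"
  shows "r l = r' l'" "r 0 = r' 0" "G_fun l r = G_fun l' r'" "l = l'"
    "lip_pressure c mu l r = lip_pressure c mu l' r'"
proof -
  interpret tract l r by fact
  interpret t': tract l' r' by fact
  have "((\<lambda>k. norm (lip_pressure c mu l r (of_real k)) / k) \<longlongrightarrow> 8 * c * mu / (3 * pi\<^sup>2 * r' l')) (at_right 0)"
    using t'.norm_lip_pressure_at_0[OF c]
    by (rule Lim_transform_eventually) (rule eventually_mono[OF eventually_at_right_less], simp add: P)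
  then have "8 * c * mu / (3 * pi\<^sup>2 * r l) = 8 * c * mu / (3 * pi\<^sup>2 * r' l')"
    by (rule tendsto_unique[OF trivial_limit_at_right_real norm_lip_pressure_at_0[OF c]])
  then show rl: "r l = r' l'" using c ends t'.ends by (simp add: field_simps)
  have "((\<lambda>k. norm (lip_pressure c mu l r (of_real k))) \<longlongrightarrow> c * mu / (pi * r' 0 * r' l')) at_top"
    using t'.norm_lip_pressure_at_top[OF c]
    by (rule Lim_transform_eventually) (rule eventually_mono[OF eventually_gt_at_top[of 0]], simp add: P)
  then have "c * mu / (pi * r 0 * r l) = c * mu / (pi * r' 0 * r' l')"
    by (rule tendsto_unique[OF trivial_limit_at_top_linorder norm_lip_pressure_at_top[OF c]])
  then show r0: "r 0 = r' 0" using c ends t'.ends rl by (simp add: field_simps)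
  have pos: "norm (G_fun l r (of_real k)) = norm (G_fun l' r' (of_real k))" if k: "0 < k" for k
  proof -
    have nz: "G_fun l r (of_real k) \<noteq> 0" "G_fun l' r' (of_real k) \<noteq> 0" "impedance (r l) (of_real k) \<noteq> 0"
      using G_nonzero_lower[of "of_real k"] t'.G_nonzero_lower[of "of_real k"] Re_impedance_pos[of "of_real k"] k by auto
    define C where "C = c * mu / (pi * r 0 * r l) * (\<bar>k\<bar> * norm (impedance (r l) (of_real k)))"
    have "C > 0" using c ends k nz(3) by (simp add: C_def)
    moreover have "C / norm (G_fun l r (of_real k)) = C / norm (G_fun l' r' (of_real k))"
      using P[OF k] norm_lip_pressure_real[OF _ c, of k] t'.norm_lip_pressure_real[OF _ c, of k] k
      unfolding C_def rl r0 by simp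
    ultimately show ?thesis using nz by (simp add: field_simps)
  qed
  have real: "norm (G_fun l r (of_real k)) = norm (G_fun l' r' (of_real k))" for k :: real
  proof -
    consider "k = 0" | "0 < k" | "0 < - k" by linarith
    then show ?thesis
    proof cases
      case 1
      then show ?thesis by (simp add: G_fun_0 t'.G_fun_0)
    next
      case 2
      then show ?thesis by (rule pos)
    next
      case 3
      then show ?thesis
        using pos[OF 3] G_fun_reflect[of "of_real k"] t'.G_fun_reflect[of "of_real k"] by simp
    qed
  qed
  obtain g where g: "g holomorphic_on UNIV" "\<And>k. G_fun l r k = k * g k" "g 0 = - (\<i> * of_real (r l / r 0))"
    using entire_divide_at_zero[OF G_fun_holomorphic G_fun_0(2,1)] by metis
  obtain g' where g': "g' holomorphic_on UNIV" "\<And>k. G_fun l' r' k = k * g' k" "g' 0 = - (\<i> * of_real (r' l' / r' 0))"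
    using entire_divide_at_zero[OF t'.G_fun_holomorphic t'.G_fun_0(2,1)] by metis
  \<comment> \<open>This is G exp(- i k l) / (- i k) continued through the origin, with nonzero
    value r(l) / r(0) there, so f has no zero in the closed lower half-plane.\<close>
  define f where "f = (\<lambda>k. g k * exp (- \<i> * k * of_real l) / (- \<i>))"
  define f' where "f' = (\<lambda>k. g' k * exp (- \<i> * k * of_real l') / (- \<i>))"
  have "f k = f' k" for k
  proof (rule lower_half_plane_unique[where f = f and g = f' and k = k and c = 1])
    show "f holomorphic_on UNIV" "f' holomorphic_on UNIV"
      unfolding f_def f'_def by (intro holomorphic_intros g(1) g'(1); simp)+
    show "f k \<noteq> 0" if "Im k \<le> 0" for k
      using G_nonzero_lower[OF that] g ends by (cases "k = 0") (auto simp: f_def)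
    show "f' k \<noteq> 0" if "Im k \<le> 0" for k
      using t'.G_nonzero_lower[OF that] g' t'.ends by (cases "k = 0") (auto simp: f'_def)
    \<comment> \<open>At k = 0 the modulus of G carries no information; there agreement comes from
      the known radii, since the derivative of G at 0 is - i r(l) / r(0).\<close>
    show "norm (f (of_real k)) = norm (f' (of_real k))" for k :: real
    proof (cases "k = 0")
      case True
      then show ?thesis using rl r0 by (simp add: f_def f'_def g g')
    next
      case False
      then have "norm (g (of_real k)) = norm (g' (of_real k))"
        using real[of k] unfolding g g' by (simp add: norm_mult)
      then show ?thesis by (simp add: f_def f'_def norm_mult norm_divide)
    qed
    have "eventually (\<lambda>k. G_fun l r k * exp (- \<i> * k * of_real l) / (- \<i> * k) = f k) lower"
      using lower_nonzero by eventually_elim (simp add: f_def g(2))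
    with G_fun_asymptotic show "(f \<longlongrightarrow> 1) lower" by (rule Lim_transform_eventually)
    have "eventually (\<lambda>k. G_fun l' r' k * exp (- \<i> * k * of_real l') / (- \<i> * k) = f' k) lower"
      using lower_nonzero by eventually_elim (simp add: f'_def g'(2))
    with t'.G_fun_asymptotic show "(f' \<longlongrightarrow> 1) lower" by (rule Lim_transform_eventually)
  qed simp
  then have G: "G_fun l r k * exp (- \<i> * k * of_real l) = G_fun l' r' k * exp (- \<i> * k * of_real l')" for k
    unfolding g(2) g'(2) by (simp add: f_def f'_def mult.assoc)
  \<comment> \<open>The growth comparison is one-sided and is applied with the two tracts in both
    orders.\<close>
  show l: "l = l'"
    using length_le[OF t(2) rl[symmetric] G] t'.length_le[OF t(1) rl G[symmetric]] by simp
  show G_eq: "G_fun l r = G_fun l' r'"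
  proof
    show "G_fun l r k = G_fun l' r' k" for k using G[of k] unfolding l by simp
  qed
  show "lip_pressure c mu l r = lip_pressure c mu l' r'"
    unfolding lip_pressure_eq t'.lip_pressure_eq lip_quotient_def[abs_def] t'.lip_quotient_def[abs_def] G_eq rl r0 ..
qed

section \<open>Listing the zeros\<close>

text \<open>The set is countable as a union of finite sublevel sets. An injection into the naturals
  breaks ties, so every element has a rank, the finite number of its predecessors.\<close>

lemma enumeration_by_size:
  fixes m :: "'a \<Rightarrow> real"
  assumes fin: "\<And>R. finite {t \<in> T. m t \<le> R}"
  shows "\<exists>N e. bij_betw e {j. enat j < N} T \<and> (\<forall>i j. i \<le> j \<longrightarrow> enat j < N \<longrightarrow> m (e i) \<le> m (e j))"
proof -
  have "\<exists>n::nat. m t \<le> real n" for t by (rule real_arch_simple)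
  then have "T = (\<Union>n::nat. {t \<in> T. m t \<le> real n})" by auto
  moreover have "countable (\<Union>n::nat. {t \<in> T. m t \<le> real n})"
    by (rule countable_UN) (auto intro: countable_finite fin)
  ultimately have "countable T" by simp
  then obtain c :: "'a \<Rightarrow> nat" where c: "inj_on c T" unfolding countable_def by blast
  define before where "before = (\<lambda>t. {u \<in> T. m u < m t \<or> (m u = m t \<and> c u < c t)})"
  define rk where "rk = (\<lambda>t. card (before t))"
  have fin_before: "finite (before t)" for t
    by (rule finite_subset[OF _ fin[of "m t"]]) (auto simp: before_def)
  have less: "rk t < rk u" if "t \<in> T" "u \<in> T" "m t < m u \<or> (m t = m u \<and> c t < c u)" for t u
    unfolding rk_def
  proof (rule psubset_card_mono[OF fin_before])
    have "t \<in> before u" "t \<notin> before t" using that by (auto simp: before_def)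
    moreover have "before t \<subseteq> before u" using that(3) by (auto simp: before_def)
    ultimately show "before t \<subset> before u" by blast
  qed
  have inj: "inj_on rk T"
  proof (rule inj_onI, rule ccontr)
    fix t u assume tu: "t \<in> T" "u \<in> T" "rk t = rk u" "t \<noteq> u"
    then have "c t \<noteq> c u" using c by (auto simp: inj_on_def)
    then show False using less[OF tu(1,2)] less[OF tu(2,1)] tu(3) by linarith
  qed
  define S where "S = rk ` T"
  define N where "N = (if finite S then enat (card S) else \<infinity>)"
  have enum: "bij_betw (enumerate S) {j. enat j < N} S"
  proof (cases "finite S")
    case True
    then have "{j. enat j < N} = {..<card S}" by (auto simp: N_def)
    then show ?thesis using finite_bij_enumerate[OF True] by simp
  next
    case False
    then show ?thesis using bij_enumerate[OF False] by (simp add: N_def)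
  qed
  have mono: "enumerate S i \<le> enumerate S j" if "i \<le> j" "enat j < N" for i j
  proof (cases "i = j")
    case False
    then have ij: "i < j" using that by simp
    show ?thesis
    proof (cases "finite S")
      case True
      then show ?thesis using that ij by (auto simp: N_def intro!: less_imp_le[OF finite_enumerate_mono])
    next
      case False
      then show ?thesis using enumerate_mono[OF ij False] by simp
    qed
  qed simp
  have bij: "bij_betw rk T S" using inj by (simp add: S_def bij_betw_imageI)
  have inv: "bij_betw (the_inv_into T rk) S T" by (rule bij_betw_the_inv_into[OF bij])
  define e where "e = the_inv_into T rk \<circ> enumerate S"
  have e: "bij_betw e {j. enat j < N} T" unfolding e_def by (rule bij_betw_trans[OF enum inv])
  have "m (e i) \<le> m (e j)" if "i \<le> j" "enat j < N" for i j
  proof (rule ccontr)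
    assume "\<not> m (e i) \<le> m (e j)"
    then have lt: "m (e j) < m (e i)" by simp
    have iN: "enat i < N" using that by (meson enat_ord_simps(1) le_less_trans)
    have "e i \<in> T" "e j \<in> T" using e iN that(2) by (auto simp: bij_betw_def)
    then have "rk (e j) < rk (e i)" using less lt by blast
    moreover have "enumerate S i \<in> S" "enumerate S j \<in> S" using enum iN that(2) by (auto simp: bij_betw_def)
    then have "rk (e i) = enumerate S i" "rk (e j) = enumerate S j"
      using f_the_inv_into_f_bij_betw[OF bij] by (simp_all add: e_def)
    ultimately show False using mono[OF that] by simp
  qed
  with e show ?thesis by (intro exI[of _ N] exI[of _ e]) simp
qed

text \<open>Multiplicity is encoded by listing pairs: each zero w is represented by
  \<open>zorder f w\<close> tagged copies, enumerated by modulus, and the tags are then dropped.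
  Sublevel sets are finite because zeros are isolated and of finite order.\<close>

lemma zero_listing_exists:
  assumes f: "f holomorphic_on UNIV" and nz: "f \<beta> \<noteq> 0"
  shows "\<exists>N s. zero_listing f Q N s"
proof -
  have fr: "frequently (\<lambda>w. f w \<noteq> 0) (at z)" for z
    by (rule eventually_frequently[OF _ entire_eventually_nonzero[OF f nz]]) simp
  have pos: "0 < zorder f w" if "f w = 0" for w
    using zorder_pos_iff[OF f open_UNIV UNIV_I fr] that by simp
  define T where "T = (SIGMA w:{w \<in> Q. f w = 0}. {..<nat (zorder f w)})"
  have "finite {t \<in> T. norm (fst t) \<le> R}" for R
  proof (cases "f constant_on UNIV")
    case True
    then have "f w = f \<beta>" for w by (auto simp: constant_on_def)
    then have "f w \<noteq> 0" for w using nz by metis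
    then have "T = {}" by (simp add: T_def)
    then show ?thesis by simp
  next
    case False
    have "finite {z \<in> cball 0 R. f z = 0}"
      by (rule holomorphic_compact_finite_zeros[OF f open_UNIV connected_UNIV compact_cball _ False]) simp
    then have "finite (SIGMA w:{z \<in> cball 0 R. f z = 0}. {..<nat (zorder f w)})" by (intro finite_SigmaI) auto
    then show ?thesis by (rule rev_finite_subset) (auto simp: T_def)
  qed
  then have "\<exists>N e. bij_betw e {j. enat j < N} T \<and> (\<forall>i j. i \<le> j \<longrightarrow> enat j < N \<longrightarrow> norm (fst (e i)) \<le> norm (fst (e j)))"
    by (rule enumeration_by_size)
  then obtain N e where e: "bij_betw e {j. enat j < N} T"
    and mono: "\<forall>i j. i \<le> j \<longrightarrow> enat j < N \<longrightarrow> norm (fst (e i)) \<le> norm (fst (e j))"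
    by (elim exE conjE) (rule that)
  have "zero_listing f Q N (fst \<circ> e)"
    unfolding zero_listing_def
  proof (intro conjI allI impI ballI)
    fix j assume "enat j < N"
    then have "e j \<in> T" using e by (auto simp: bij_betw_def)
    then show "(fst \<circ> e) j \<in> Q" "f ((fst \<circ> e) j) = 0" by (auto simp: T_def)
  next
    fix w assume w: "w \<in> Q" "f w = 0"
    have "e ` {j. enat j < N \<and> fst (e j) = w} = {t \<in> T. fst t = w}"
      using bij_betw_imp_surj_on[OF e] by blast
    moreover have "inj_on e {j. enat j < N \<and> fst (e j) = w}"
      using e by (auto simp: bij_betw_def inj_on_def)
    ultimately have "card {j. enat j < N \<and> fst (e j) = w} = card {t \<in> T. fst t = w}"
      using card_image[of e "{j. enat j < N \<and> fst (e j) = w}"] by simp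
    also have "{t \<in> T. fst t = w} = Pair w ` {..<nat (zorder f w)}"
      using w by (auto simp: T_def)
    also have "card \<dots> = nat (zorder f w)" by (simp add: card_image inj_on_def)
    finally show "int (card {j. enat j < N \<and> (fst \<circ> e) j = w}) = zorder f w"
      using pos[OF w(2)] by simp
  next
    fix i j assume "i \<le> j \<and> enat j < N"
    then show "norm ((fst \<circ> e) i) \<le> norm ((fst \<circ> e) j)" using mono by simp
  qed
  then show ?thesis by blast
qed

text \<open>Existence of a listing makes the chosen one a genuine listing. Every zero occurs in it
  because its multiplicity, which counts its occurrences, is positive.\<close>

lemma zero_seq_image:
  assumes f: "f holomorphic_on UNIV" and nz: "f \<beta> \<noteq> 0"
  shows "zero_seq f Q ` {j. enat j < zero_number f Q} = {w \<in> Q. f w = 0}"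
proof -
  obtain N s where "zero_listing f Q N s" using zero_listing_exists[OF assms] by blast
  then have "case listed_zeros f Q of (N, s) \<Rightarrow> zero_listing f Q N s"
    unfolding listed_zeros_def by (intro someI[of "\<lambda>(N, s). zero_listing f Q N s" "(N, s)"]) simp
  then have *: "zero_listing f Q (zero_number f Q) (zero_seq f Q)"
    by (simp add: zero_number_def zero_seq_def case_prod_beta)
  show ?thesis
  proof
    show "zero_seq f Q ` {j. enat j < zero_number f Q} \<subseteq> {w \<in> Q. f w = 0}"
      using * by (auto simp: zero_listing_def)
    show "{w \<in> Q. f w = 0} \<subseteq> zero_seq f Q ` {j. enat j < zero_number f Q}"
    proof clarify
      fix w assume w: "w \<in> Q" "f w = 0"
      have "0 < zorder f w"
        using zorder_pos_iff[OF f open_UNIV UNIV_I eventually_frequently[OF _ entire_eventually_nonzero[OF f nz]]] w(2) by simp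
      moreover have "int (card {j. enat j < zero_number f Q \<and> zero_seq f Q j = w}) = zorder f w"
        using * w by (simp add: zero_listing_def)
      ultimately have "{j. enat j < zero_number f Q \<and> zero_seq f Q j = w} \<noteq> {}" by force
      then show "w \<in> zero_seq f Q ` {j. enat j < zero_number f Q}" by auto
    qed
  qed
qed

context tract
begin

lemma pressure_poles:
  assumes "0 < c" "0 < mu"
  shows "isolated_zero (lip_pressure c mu l r) 0 \<and> zorder (lip_pressure c mu l r) 0 = 1 \<and>
        lip_pressure c mu l r meromorphic_on UNIV \<and>
        (\<forall>k. k \<noteq> 0 \<longrightarrow> (is_pole (lip_pressure c mu l r) k \<longleftrightarrow> G_fun l r k = 0)) \<and>
        (\<forall>k. k \<noteq> 0 \<and> G_fun l r k = 0 \<longrightarrow>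
           - zorder (lip_pressure c mu l r) k = zorder (G_fun l r) k) \<and>
        (\<forall>Q\<in>{quadrant4, quadrant1}.
           zero_seq (G_fun l r) Q ` {j. enat j < zero_number (G_fun l r) Q}
             = {k\<in>Q. G_fun l r k = 0} \<and>
           zero_seq (G_fun l r) Q ` {j. enat j < zero_number (G_fun l r) Q}
             = {k\<in>Q. is_pole (lip_pressure c mu l r) k})"
proof -
  have img: "zero_seq (G_fun l r) Q ` {j. enat j < zero_number (G_fun l r) Q} = {k\<in>Q. G_fun l r k = 0}" for Q
    by (rule zero_seq_image[OF G_fun_holomorphic, of 1]) (use G_nonzero_lower[of 1] in simp)
  show ?thesis
  proof (intro conjI allI impI ballI lip_pressure_zero[OF assms] lip_pressure_meromorphic img)
    fix k :: complex assume "k \<noteq> 0"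
    then show "is_pole (lip_pressure c mu l r) k \<longleftrightarrow> G_fun l r k = 0"
      by (rule lip_pressure_pole(1)[OF _ assms])
  next
    fix k assume "k \<noteq> 0 \<and> G_fun l r k = 0"
    then show "- zorder (lip_pressure c mu l r) k = zorder (G_fun l r) k"
      by (elim conjE) (rule lip_pressure_pole(2)[OF _ assms])
  next
    fix Q assume "Q \<in> {quadrant4, quadrant1}"
    then have "0 \<notin> Q" by (auto simp: quadrant4_def quadrant1_def)
    then have "k \<noteq> 0" if "k \<in> Q" for k using that by metis
    then have "{k\<in>Q. G_fun l r k = 0} = {k\<in>Q. is_pole (lip_pressure c mu l r) k}"
      by (intro Collect_cong conj_cong refl lip_pressure_pole(1)[OF _ assms, symmetric])
    then show "zero_seq (G_fun l r) Q ` {j. enat j < zero_number (G_fun l r) Q}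
        = {k\<in>Q. is_pole (lip_pressure c mu l r) k}"
      unfolding img .
  qed
qed

end

section \<open>Dependence of one set of data on another\<close>

lemma yieldsI:
  "(\<And>l r l' r'. 0 < l \<and> class_A l r \<and> 0 < l' \<and> class_A l' r' \<Longrightarrow> X l r = X l' r' \<Longrightarrow> Y l r = Y l' r') \<Longrightarrow> yields X Y"
  by (simp add: yields_def)

lemma yieldsD:
  "yields X Y \<Longrightarrow> 0 < l \<and> class_A l r \<and> 0 < l' \<and> class_A l' r' \<Longrightarrow> X l r = X l' r' \<Longrightarrow> Y l r = Y l' r'"
  by (simp add: yields_def)

lemma yields_trans:
  assumes "yields X Y" "yields Z X"
  shows "yields Z Y"
  by (rule yieldsI) (rule yieldsD[OF assms(1) _ yieldsD[OF assms(2)]])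

lemma yields_comp: "yields X Y \<Longrightarrow> yields X (\<lambda>l r. F (Y l r))"
  by (rule yieldsI, rule arg_cong[of _ _ F], rule yieldsD)

lemma yields_refl: "yields X X"
  by (rule yieldsI)

lemma yields_fst: "yields (\<lambda>l r. (X l r, Y l r)) X"
  by (rule yieldsI) (simp only: prod.inject)

text \<open>Everything is obtained here as whole functions on the plane; moduli, the impedance and E
  then follow by composition, and the richer data of (c) and (d) by reduction to the
  modulus.\<close>

lemma yields_from_lip_pressure_modulus:
  assumes c: "0 < c" "0 < mu"
  defines "X \<equiv> \<lambda>l r. \<lambda>k\<in>{0<..}. norm (lip_pressure c mu l r (of_real k))"
  shows "yields X (\<lambda>l r. lip_pressure c mu l r)" "yields X (\<lambda>l r. r 0)" "yields X (\<lambda>l r. r l)"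
    "yields X (\<lambda>l r. G_fun l r)" "yields X (\<lambda>l r. l)"
proof -
  have main: "r l = r' l' \<and> r 0 = r' 0 \<and> G_fun l r = G_fun l' r' \<and> l = l' \<and> lip_pressure c mu l r = lip_pressure c mu l' r'"
    if "0 < l \<and> class_A l r \<and> 0 < l' \<and> class_A l' r'" "X l r = X l' r'" for l r l' r'
  proof -
    have t: "tract l r" "tract l' r'" using that(1) by (auto simp: tract_def)
    have P: "norm (lip_pressure c mu l r (of_real k)) = norm (lip_pressure c mu l' r' (of_real k))" if "0 < k" for k
      using fun_cong[OF \<open>X l r = X l' r'\<close>, of k] that by (simp add: X_def)
    show ?thesis by (intro conjI tract_determined[OF t c P])
  qed
  show "yields X (\<lambda>l r. lip_pressure c mu l r)" "yields X (\<lambda>l r. r 0)" "yields X (\<lambda>l r. r l)"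
    "yields X (\<lambda>l r. G_fun l r)" "yields X (\<lambda>l r. l)"
    by (rule yieldsI, drule (1) main, elim conjE, assumption)+
qed

theorem theorem6p1:
  fixes c mu :: real
  assumes "0 < c" and "0 < mu"
  shows
    "\<comment> \<open>(a)\<close>
     (let X = (\<lambda>l r. \<lambda>k\<in>{0<..}. norm (lip_pressure c mu l r (of_real k))) in
        yields X (\<lambda>l r (k::real). norm (lip_pressure c mu l r (of_real k))) \<and>
        yields X (\<lambda>l r. r 0) \<and>
        yields X (\<lambda>l r. r l) \<and>
        yields X (\<lambda>l r. impedance (r l)) \<and>
        yields X (\<lambda>l r (k::real). norm (G_fun l r (of_real k)))) \<and>
     \<comment> \<open>(b)\<close>
     (\<forall>l r. 0 < l \<and> class_A l r \<longrightarrow>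
        isolated_zero (lip_pressure c mu l r) 0 \<and> zorder (lip_pressure c mu l r) 0 = 1 \<and>
        lip_pressure c mu l r meromorphic_on UNIV \<and>
        (\<forall>k. k \<noteq> 0 \<longrightarrow> (is_pole (lip_pressure c mu l r) k \<longleftrightarrow> G_fun l r k = 0)) \<and>
        (\<forall>k. k \<noteq> 0 \<and> G_fun l r k = 0 \<longrightarrow>
           - zorder (lip_pressure c mu l r) k = zorder (G_fun l r) k) \<and>
        (\<forall>Q\<in>{quadrant4, quadrant1}.
           zero_seq (G_fun l r) Q ` {j. enat j < zero_number (G_fun l r) Q}
             = {k\<in>Q. G_fun l r k = 0} \<and>
           zero_seq (G_fun l r) Q ` {j. enat j < zero_number (G_fun l r) Q}
             = {k\<in>Q. is_pole (lip_pressure c mu l r) k})) \<and>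
     \<comment> \<open>(c)\<close>
     (let X = (\<lambda>l r. (\<lambda>k\<in>{0<..}. norm (lip_pressure c mu l r (of_real k)),
                     poles_with_mult (lip_pressure c mu l r) quadrant4)) in
        yields X (\<lambda>l r (k::real). norm (lip_pressure c mu l r (of_real k))) \<and>
        yields X (\<lambda>l r. r 0) \<and>
        yields X (\<lambda>l r. r l) \<and>
        yields X (\<lambda>l r. impedance (r l)) \<and>
        yields X (\<lambda>l r (k::real). norm (G_fun l r (of_real k))) \<and>
        yields X (\<lambda>l r. G_fun l r) \<and>
        yields X (\<lambda>l r. E_fun l r) \<and>
        yields X (\<lambda>l r. l)) \<and>
     \<comment> \<open>(d)\<close>
     (let X = (\<lambda>l r. \<lambda>k\<in>{0<..}. lip_pressure c mu l r (of_real k)) in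
        yields X (\<lambda>l r. lip_pressure c mu l r) \<and>
        yields X (\<lambda>l r. G_fun l r) \<and>
        yields X (\<lambda>l r. E_fun l r) \<and>
        yields X (\<lambda>l r. l))"
proof -
  define X where "X = (\<lambda>l r. \<lambda>k\<in>{0<..}. norm (lip_pressure c mu l r (of_real k)))"
  note X = yields_from_lip_pressure_modulus[OF assms, folded X_def]
  note P = yields_comp[OF X(1), of "\<lambda>p (k::real). norm (p (of_real k))"]
  note z = yields_comp[OF X(3), of impedance]
  note G = yields_comp[OF X(4), of "\<lambda>f (k::real). norm (f (of_real k))"]
  \<comment> \<open>E depends on the tract only through G, including the choice of the listing of
    zeros, so equal G gives literally the same product.\<close>
  have "E_fun = (\<lambda>l r k. - \<i> * k * (quadrant_product (G_fun l r) quadrant4 k * quadrant_product (G_fun l r) quadrant1 k))"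
    by (intro ext) (simp only: E_fun_def)
  then have E: "yields X (\<lambda>l r. E_fun l r)"
    using yields_comp[OF X(4), of "\<lambda>f k. - \<i> * k * (quadrant_product f quadrant4 k * quadrant_product f quadrant1 k)"]
    by (simp only:)
  note c = yields_fst[of X "\<lambda>l r. poles_with_mult (lip_pressure c mu l r) quadrant4"]
  \<comment> \<open>The data of (d) determine those of (a) by taking moduli pointwise.\<close>
  define D where "D = (\<lambda>l r. \<lambda>k\<in>{0<..}. lip_pressure c mu l r (of_real k))"
  have "X = (\<lambda>l r. \<lambda>k\<in>{0<..}. norm (D l r k))"
    by (intro ext) (simp add: X_def D_def restrict_def)
  then have d: "yields D X"
    using yields_comp[OF yields_refl[of D], of "\<lambda>p. \<lambda>k\<in>{0<..}. norm (p k)"] by (simp only:)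
  show ?thesis
    unfolding Let_def
    by (rule conjI[OF _ conjI[OF _ conjI]];
        ((intro allI impI tract.pressure_poles[OF _ assms], simp add: tract_def; fail) |
        (intro conjI X[unfolded X_def] P[unfolded X_def] z[unfolded X_def] G[unfolded X_def] E[unfolded X_def]
          X[THEN yields_trans, OF c, unfolded X_def] P[THEN yields_trans, OF c, unfolded X_def]
          z[THEN yields_trans, OF c, unfolded X_def] G[THEN yields_trans, OF c, unfolded X_def]
          E[THEN yields_trans, OF c, unfolded X_def]
          X[THEN yields_trans, OF d, unfolded D_def] E[THEN yields_trans, OF d, unfolded D_def])))
qed

end
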